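(* Let $k$ be an algebraically closed field and let $F$ be a plane de Jonquières map of degree $d\geq 2$ with base ideal $I\subset R=k[x,y,z]$. Then: (a) $R/I$ is Cohen--Macaulay, hence $I=I^{\rm sat}$. (b) The degree (algebraic multiplicity) of $R/I$ is $d(d-1)+1$. (c) $I$ is an ideal of linear type if and only if $d=2$.
   Context: $R$ is standard graded and $I^{\rm sat}=I:(x,y,z)^\infty$. A plane Cremona map of degree $d$ (without fixed part) is a birational map $\mathbb P^2\dashrightarrow\mathbb P^2$ given by three forms of degree $d$ with no nontrivial common factor; its base ideal $I$ is generated by these forms. An ideal is of linear type if the natural surjection from its symmetric algebra to its Rees algebra is an isomorphism. Base points: $e_p(D)$ is the order of vanishing at $p$ of a local equation of the curve $D$ (on a smooth surface). The proper base points are the points of $V(I)\subset\mathbb P^2$; for such $p$ put $\mu_p=\min\{e_p(f): f\in I_d\}$ and $U_p=\{f\in I_d: e_p(f)=\mu_p\}$. A point $q$ on the exceptional curve of the blowup of $p$ is a base point infinitely near to $p$ if it lies on the proper transform of every $V(f)$, $f\in U_p$; $\mu_q$ is the minimum of the multiplicities at $q$ of these proper transforms; one repeats successively. The homaloidal type of $F$ is $(d;\mu_1,\ldots,\mu_r)$, listing the multiplicities of all base points, proper and infinitely near (exponents denote repetition). $F$ is a de Jonquières map if $d\ge 2$ and its homaloidal type is $(d;d-1,1^{2d-2})$. *)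

theory Defs
  imports
    "HOL-Algebra.Algebraic_Closure_Type"
    "HOL-Algebra.Ideal_Product"
    "HOL-Algebra.Ring_Divisibility"
    "HOL-Library.Poly_Mapping"
    "HOL-Library.Numeral_Type"
    "HOL-Library.Extended_Nat"
begin

section \<open>Polynomials\<close>

text \<open>
  A value of \<open>(3, 'k) mpoly\<close> is an element of \<open>k[x,y,z]\<close>, the variables being
  \<open>var 0\<close>, \<open>var 1\<close>, \<open>var 2\<close>. Arithmetic on the index type \<open>3\<close> is modulo 3.
  As a ring record, \<open>k[x,y,z]\<close> is \<^const>\<open>ring_of_type_algebra\<close>.
\<close>

type_synonym ('v, 'a) mpoly = "('v \<Rightarrow>\<^sub>0 nat) \<Rightarrow>\<^sub>0 'a"

definition cst :: "'a::zero \<Rightarrow> ('v, 'a) mpoly" where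
  "cst c = Poly_Mapping.single 0 c"

definition var :: "'v \<Rightarrow> ('v, 'a::comm_ring_1) mpoly" where
  "var v = Poly_Mapping.single (Poly_Mapping.single v 1) 1"

definition tdeg :: "('v \<Rightarrow>\<^sub>0 nat) \<Rightarrow> nat" where
  "tdeg m = (\<Sum>v\<in>Poly_Mapping.keys m. Poly_Mapping.lookup m v)"

text \<open>\<open>forms d\<close> includes the zero polynomial.\<close>

definition forms :: "nat \<Rightarrow> ('v, 'a::zero) mpoly set" where
  "forms d = {p. \<forall>m\<in>Poly_Mapping.keys p. tdeg m = d}"

text \<open>Substitute \<open>g v\<close> for the variable \<open>v\<close>, mapping the coefficients by \<open>h\<close>.\<close>

definition subst :: "('a::zero \<Rightarrow> 'b::comm_ring_1) \<Rightarrow> ('v \<Rightarrow> 'b) \<Rightarrow> ('v, 'a) mpoly \<Rightarrow> 'b" where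
  "subst h g p = (\<Sum>m\<in>Poly_Mapping.keys p. h (Poly_Mapping.lookup p m) *
     (\<Prod>v\<in>Poly_Mapping.keys m. g v ^ Poly_Mapping.lookup m v))"


section \<open>Plane Cremona maps\<close>

text \<open>
  Birationality is the existence of an inverse rational map \<open>G\<close>. Since \<open>D\<close> and \<open>E\<close> are nonzero,
  both composites are defined, and they are the identity as rational maps.
\<close>

definition plane_cremona :: "nat \<Rightarrow> (3 \<Rightarrow> (3, 'k::field) mpoly) \<Rightarrow> bool" where
  "plane_cremona d F \<longleftrightarrow>
     (\<forall>i. F i \<in> forms d) \<and>
     (\<forall>h. (\<forall>i. h dvd F i) \<longrightarrow> h dvd 1) \<and>
     (\<exists>e G D E. (\<forall>i. G i \<in> forms e) \<and> D \<noteq> 0 \<and> E \<noteq> 0 \<and>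
        (\<forall>i. subst cst F (G i) = D * var i) \<and>
        (\<forall>i. subst cst G (F i) = E * var i))"

definition base_ideal :: "(3 \<Rightarrow> (3, 'k::field) mpoly) \<Rightarrow> (3, 'k) mpoly set" where
  "base_ideal F = Idl\<^bsub>ring_of_type_algebra\<^esub> (range F)"


section \<open>Proper and infinitely near base points\<close>

text \<open>
  A point of the projective plane is represented by its unique homogeneous coordinate vector whose
  first nonzero entry is 1; \<open>pivot p\<close> is the position of that entry.
\<close>

definition pivot :: "(3 \<Rightarrow> 'k::field) \<Rightarrow> 3" where
  "pivot p = (if p 0 \<noteq> 0 then 0 else if p 1 \<noteq> 0 then 1 else 2)"

definition proj_plane :: "(3 \<Rightarrow> 'k::field) set" where
  "proj_plane = {p. p (pivot p) = 1}"

text \<open>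
  The equation of the curve \<open>V(f)\<close> in the affine chart where the pivot coordinate is 1, translated
  so that \<open>p\<close> becomes the origin of the affine plane with coordinates \<open>u = var 0\<close>, \<open>v = var 1\<close>.
\<close>

definition local_eq :: "(3 \<Rightarrow> 'k::field) \<Rightarrow> (3, 'k) mpoly \<Rightarrow> (2, 'k) mpoly" where
  "local_eq p f = subst cst
     (\<lambda>j. cst (p j) + (if j = pivot p + 1 then var 0 else if j = pivot p + 2 then var 1 else 0)) f"

text \<open>Order of vanishing at the origin; it is \<open>\<infinity>\<close> for \<open>f = 0\<close>.\<close>

definition ord_origin :: "('v, 'k::zero) mpoly \<Rightarrow> enat" where
  "ord_origin f = (INF m\<in>Poly_Mapping.keys f. enat (tdeg m))"

text \<open>
  Blowup of the origin of the \<open>(u,v)\<close>-plane. The points of the exceptional curve are the tangent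
  directions at the origin: \<open>Some t\<close> is the direction \<open>v = t u\<close>, and \<open>None\<close> the direction \<open>u = 0\<close>.
  Each lies at the origin of one affine chart of the blown up plane, in which the blowdown is
  \<open>(u, v) \<mapsto> (u, u (v + t))\<close>, respectively \<open>(u, v) \<mapsto> (u v, v)\<close>.
  As the charts are affine planes, the construction can be iterated.
\<close>

fun blowdown :: "'k::field option \<Rightarrow> 2 \<Rightarrow> (2, 'k) mpoly" where
  "blowdown (Some t) = (\<lambda>j. if j = 0 then var 0 else var 0 * (var 1 + cst t))"
| "blowdown None = (\<lambda>j. if j = 0 then var 0 * var 1 else var 1)"

fun exceptional :: "'k::field option \<Rightarrow> (2, 'k) mpoly" where
  "exceptional (Some t) = var 0"
| "exceptional None = var 1"

text \<open>Local equation, at the point \<open>t\<close>, of the proper transform of the curve \<open>f = 0\<close> (\<open>f \<noteq> 0\<close>).\<close>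

definition proper_transform :: "'k::field option \<Rightarrow> (2, 'k) mpoly \<Rightarrow> (2, 'k) mpoly" where
  "proper_transform t f =
     (THE g. subst cst (blowdown t) f = exceptional t ^ the_enat (ord_origin f) * g)"

definition min_ord :: "(2, 'k::field) mpoly set \<Rightarrow> enat" where
  "min_ord S = (INF f\<in>S. ord_origin f)"

definition min_members :: "(2, 'k::field) mpoly set \<Rightarrow> (2, 'k) mpoly set" where
  "min_members S = {f \<in> S. ord_origin f = min_ord S}"

text \<open>
  The pair \<open>(p, [t\<^sub>1, \<dots>, t\<^sub>n])\<close> is the point reached from \<open>p\<close> by blowing up \<open>p\<close>, then
  the point \<open>t\<^sub>1\<close> of the exceptional curve, and so on. \<open>local_system I d (p, ts)\<close> consists of
  the local equations there of the proper transforms of those curves of \<open>I\<^sub>d\<close> that have minimal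
  multiplicity at each of the preceding points.
\<close>

fun local_system ::
    "(3, 'k::field) mpoly set \<Rightarrow> nat \<Rightarrow> (3 \<Rightarrow> 'k) \<times> 'k option list \<Rightarrow> (2, 'k) mpoly set" where
  "local_system I d (p, ts) =
     fold (\<lambda>t S. proper_transform t ` min_members S) ts (local_eq p ` (I \<inter> forms d))"

inductive_set base_points ::
    "(3, 'k::field) mpoly set \<Rightarrow> nat \<Rightarrow> ((3 \<Rightarrow> 'k) \<times> 'k option list) set" for I d where
  proper: "\<lbrakk>p \<in> proj_plane; \<forall>f\<in>I. subst id p f = 0\<rbrakk> \<Longrightarrow> (p, []) \<in> base_points I d"
| infinitely_near:
    "\<lbrakk>(p, ts) \<in> base_points I d;
      \<forall>f\<in>min_members (local_system I d (p, ts)). subst id (\<lambda>_. 0) (proper_transform t f) = 0\<rbrakk>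
     \<Longrightarrow> (p, ts @ [t]) \<in> base_points I d"

definition base_mult :: "(3, 'k::field) mpoly set \<Rightarrow> nat \<Rightarrow> (3 \<Rightarrow> 'k) \<times> 'k option list \<Rightarrow> nat" where
  "base_mult I d q = the_enat (min_ord (local_system I d q))"

definition has_homaloidal_type :: "(3 \<Rightarrow> (3, 'k::field) mpoly) \<Rightarrow> nat \<Rightarrow> nat multiset \<Rightarrow> bool" where
  "has_homaloidal_type F d \<mu> \<longleftrightarrow>
     finite (base_points (base_ideal F) d) \<and>
     image_mset (base_mult (base_ideal F) d) (mset_set (base_points (base_ideal F) d)) = \<mu>"

definition de_jonquieres :: "nat \<Rightarrow> (3 \<Rightarrow> (3, 'k::field) mpoly) \<Rightarrow> bool" where
  "de_jonquieres d F \<longleftrightarrow>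
     plane_cremona d F \<and> d \<ge> 2 \<and>
     has_homaloidal_type F d (add_mset (d - 1) (replicate_mset (2 * d - 2) 1))"


section \<open>Cohen--Macaulay rings\<close>

definition regular_sequence :: "('a, 'm) ring_scheme \<Rightarrow> 'a list \<Rightarrow> bool" where
  "regular_sequence A xs \<longleftrightarrow>
     set xs \<subseteq> carrier A \<and> Idl\<^bsub>A\<^esub> (set xs) \<noteq> carrier A \<and>
     (\<forall>i<length xs. \<forall>b\<in>carrier A.
        xs ! i \<otimes>\<^bsub>A\<^esub> b \<in> Idl\<^bsub>A\<^esub> (set (take i xs)) \<longrightarrow> b \<in> Idl\<^bsub>A\<^esub> (set (take i xs)))"

definition ideal_depth :: "('a, 'm) ring_scheme \<Rightarrow> 'a set \<Rightarrow> enat" where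
  "ideal_depth A J = Sup {enat (length xs) |xs. regular_sequence A xs \<and> set xs \<subseteq> J}"

definition prime_height :: "('a, 'm) ring_scheme \<Rightarrow> 'a set \<Rightarrow> enat" where
  "prime_height A P = Sup {enat n |n. \<exists>Q :: nat \<Rightarrow> 'a set.
     (\<forall>i\<le>n. primeideal (Q i) A) \<and> (\<forall>i<n. Q i \<subset> Q (Suc i)) \<and> Q n = P}"

text \<open>
  This is the definition of Eisenbud, Commutative Algebra with a View Toward Algebraic Geometry,
  Section 18.2, which avoids localizations.
\<close>

definition cohen_macaulay :: "('a, 'm) ring_scheme \<Rightarrow> bool" where
  "cohen_macaulay A \<longleftrightarrow>
     cring A \<and> noetherian_ring A \<and>
     (\<forall>M. maximalideal M A \<longrightarrow> ideal_depth A M = prime_height A M)"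


section \<open>Saturation and degree of homogeneous ideals\<close>

definition saturation :: "('v, 'k::field) mpoly set \<Rightarrow> ('v, 'k) mpoly set" where
  "saturation I =
     {f. \<exists>n::nat. \<forall>g \<in> (Idl\<^bsub>ring_of_type_algebra\<^esub> (range var)) [^]\<^bsub>ideals_set ring_of_type_algebra\<^esub> n.
        g * f \<in> I}"

text \<open>\<open>dim\<^sub>k (R\<^sub>n / I\<^sub>n)\<close>; the subtraction is harmless, as \<open>I\<^sub>n\<close> is a subspace of \<open>R\<^sub>n\<close>.\<close>

definition hilbert_function :: "('v::finite, 'k::field) mpoly set \<Rightarrow> nat \<Rightarrow> nat" where
  "hilbert_function I n =
     vector_space.dim (\<lambda>c p. cst c * p) (forms n :: ('v, 'k) mpoly set) -
     vector_space.dim (\<lambda>c p. cst c * p) (I \<inter> forms n)"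

definition hilbert_poly :: "('v::finite, 'k::field) mpoly set \<Rightarrow> rat poly" where
  "hilbert_poly I =
     (THE P. \<forall>\<^sub>F n in sequentially. poly P (of_nat n) = of_nat (hilbert_function I n))"

text \<open>
  The degree (algebraic multiplicity) of \<open>R/I\<close>. The degree of a nonzero Hilbert polynomial is
  \<open>dim (R/I) - 1\<close>; if the Hilbert polynomial is 0, then \<open>R/I\<close> has finite length.
\<close>

definition quotient_degree :: "('v::finite, 'k::field) mpoly set \<Rightarrow> rat" where
  "quotient_degree I =
     (let P = hilbert_poly I in
      if P = 0 then of_nat (\<Sum>n | hilbert_function I n \<noteq> 0. hilbert_function I n)
      else fact (Polynomial.degree P) * lead_coeff P)"


section \<open>Ideals of linear type\<close>

text \<open>
  The symmetric algebra of an ideal \<open>I\<close> of \<open>R\<close>, as an \<open>R\<close>-module: the polynomial ring over \<open>R\<close>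
  with one variable for each element of \<open>I\<close>, modulo the \<open>R\<close>-linear relations between these
  elements. Here \<open>R\<close> is the whole type \<open>'r\<close>.
\<close>

definition free_alg :: "'r::comm_ring_1 set \<Rightarrow> ('r, 'r) mpoly ring" where
  "free_alg I = ring_of_type_algebra
     \<lparr>carrier := {p. \<forall>m\<in>Poly_Mapping.keys p. Poly_Mapping.keys m \<subseteq> I}\<rparr>"

definition linear_relations :: "'r::comm_ring_1 set \<Rightarrow> ('r, 'r) mpoly set" where
  "linear_relations I =
     {var (a + b) - var a - var b |a b. a \<in> I \<and> b \<in> I} \<union>
     {var (r * a) - cst r * var a |r a. a \<in> I}"

definition symmetric_algebra :: "'r::comm_ring_1 set \<Rightarrow> ('r, 'r) mpoly set ring" where
  "symmetric_algebra I = free_alg I Quot (Idl\<^bsub>free_alg I\<^esub> (linear_relations I))"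

text \<open>The subring \<open>R[It] = \<Oplus>\<^sub>n I\<^sup>n t\<^sup>n\<close> of \<open>R[t]\<close>.\<close>

definition rees_algebra :: "'r::comm_ring_1 set \<Rightarrow> 'r poly ring" where
  "rees_algebra I = ring_of_type_algebra
     \<lparr>carrier := {p. \<forall>n. poly.coeff p n \<in> I [^]\<^bsub>ideals_set ring_of_type_algebra\<^esub> n}\<rparr>"

text \<open>
  The \<open>R\<close>-algebra map sending the class of the variable of \<open>a \<in> I\<close> to \<open>a t\<close>. It is applied to
  cosets, on which the substitution is constant.
\<close>

definition sym_to_rees :: "('r::comm_ring_1, 'r) mpoly set \<Rightarrow> 'r poly" where
  "sym_to_rees A = the_elem (subst (\<lambda>r. [:r:]) (\<lambda>a. Polynomial.monom a 1) ` A)"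

definition linear_type :: "'r::comm_ring_1 set \<Rightarrow> bool" where
  "linear_type I \<longleftrightarrow> sym_to_rees \<in> ring_iso (symmetric_algebra I) (rees_algebra I)"

end

theory Submission
  imports Defs "HOL-Computational_Algebra.Computational_Algebra"
begin

text \<open>
  Some base point has multiplicity \<open>d - 1\<close>. It may be taken to be a proper point \<open>p\<close>, because
  multiplicities do not increase along infinitely near points (\<open>base_point_proper\<close>), and a linear
  change of coordinates moves it to the vertex \<open>(0 : 0 : 1)\<close> (\<open>coordinates_at_point\<close>). The forms
  defining the map are then \<open>F\<^sub>i = z A\<^sub>i + B\<^sub>i\<close> with \<open>A\<^sub>i\<close> and \<open>B\<^sub>i\<close> in \<open>k[x,y]\<close>.

  Birationality enters in \<open>linear_syzygy\<close>. The cross product of \<open>A\<close> and \<open>B\<close> is a nonzero syzygy of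
  \<open>F\<close> with entries in \<open>k[x,y]\<close>. Substituting the inverse map \<open>G\<close> into such a syzygy of least degree
  gives a homogeneous relation between \<open>G\<^sub>0\<close> and \<open>G\<^sub>1\<close> whose coefficients are linear forms. By
  unique factorization the linear factor belonging to the root \<open>(G\<^sub>0 : G\<^sub>1)\<close> splits off from it,
  and comparing degrees shows that the syzygy of least degree is linear. Hence
  \<open>I = (x q, y q, f)\<close>, where \<open>q\<close> and \<open>f\<close> are coprime forms of degrees \<open>d - 1\<close> and \<open>d\<close> and of
  degree at most 1 in \<open>z\<close> (theorem \<open>normal_form\<close> of the locale \<open>monoidal_map\<close>). Writing
  \<open>f = p x + s y\<close>, these generators are the maximal minors of the matrix with columns
  \<open>(y, -x, 0)\<close> and \<open>(p, s, -q)\<close>. All three claims follow from this shape.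

  Degree: \<open>I\<^sub>n\<close> is the sum of \<open>q (x,y)\<^sub>n\<^sub>-\<^sub>d\<^sub>+\<^sub>1\<close> and \<open>f R\<^sub>n\<^sub>-\<^sub>d\<close>, and since \<open>q\<close> and \<open>f\<close> are coprime
  these meet in \<open>q f R\<^sub>n\<^sub>-\<^sub>2\<^sub>d\<^sub>+\<^sub>1\<close>. Counting dimensions, the Hilbert function is constant from degree
  \<open>2 d - 1\<close> on, with value \<open>d (d - 1) + 1\<close> (\<open>hilbert_function_eq\<close>).

  Cohen--Macaulay property and saturation: a prime over \<open>I\<close> contains \<open>x\<close> and \<open>y\<close>, or else \<open>q\<close> and
  \<open>f\<close>, and then also their resultant with respect to \<open>z\<close>, a nonzero binary form, and hence a linear
  form in \<open>x\<close> and \<open>y\<close>. In both cases its residue ring is generated by one element over \<open>k\<close>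
  (\<open>prime_monogenic\<close>), so \<open>R/I\<close> has dimension at most one. A linear form \<open>l = z - \<alpha> x - \<beta> y\<close> without
  zeros on the finitely many points of \<open>V(I)\<close> is a nonzerodivisor modulo \<open>I\<close>
  (\<open>ex_linear_nonzerodivisor\<close>). Both height and depth of every maximal ideal of \<open>R/I\<close> are therefore
  one (\<open>cohen_macaulay_dim_1\<close>), and \<open>I\<close> is saturated because \<open>l\<^sup>n\<close> lies in \<open>(x,y,z)\<^sup>n\<close>.

  Linear type: let \<open>T\<^sub>0, T\<^sub>1, T\<^sub>2\<close> be the generators of the symmetric algebra that belong to
  \<open>x q, y q, f\<close>. They satisfy \<open>y T\<^sub>0 = x T\<^sub>1\<close> and \<open>p T\<^sub>0 + s T\<^sub>1 = q T\<^sub>2\<close>. For \<open>d = 2\<close> either \<open>q\<close>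
  does not vanish at the vertex or \<open>f\<close> has order one there, and comparison of \<open>(x,y)\<close>-adic orders
  reduces every relation of the Rees algebra to these two (\<open>is_linear_type\<close>). For \<open>d \<ge> 3\<close> all
  syzygies vanish at the vertex, so the fibre of the symmetric algebra over it is a polynomial ring in
  three variables, while the Rees algebra satisfies a relation of degree \<open>d - 1\<close> that does not vanish
  on this fibre (\<open>not_linear_type\<close>).
\<close>

section \<open>Ring maps and substitution\<close>

text \<open>
  Evaluations, substitutions, gradings and coefficient maps between commutative rings are all instances,
  so that one family of rewrite rules computes with each of them.
\<close>

locale ring_map =
  fixes \<phi> :: "'a::comm_ring_1 \<Rightarrow> 'b::comm_ring_1"
  assumes add: "\<phi> (a + b) = \<phi> a + \<phi> b"
    and mult: "\<phi> (a * b) = \<phi> a * \<phi> b"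
    and one: "\<phi> 1 = 1"
begin

lemma zero: "\<phi> 0 = 0"
  using add[of 0 0] by simp

lemma uminus: "\<phi> (- a) = - \<phi> a"
  using add[of a "- a"] by (simp add: zero add_eq_0_iff)

lemma diff: "\<phi> (a - b) = \<phi> a - \<phi> b"
  using add[of a "- b"] by (simp add: uminus)

lemma sum: "\<phi> (sum f A) = (\<Sum>x\<in>A. \<phi> (f x))"
  by (induction A rule: infinite_finite_induct) (simp_all add: zero add)

lemma prod: "\<phi> (prod f A) = (\<Prod>x\<in>A. \<phi> (f x))"
  by (induction A rule: infinite_finite_induct) (simp_all add: one mult)

lemma power: "\<phi> (a ^ n) = \<phi> a ^ n"
  by (induction n) (simp_all add: one mult)

lemma dvd: "a dvd b \<Longrightarrow> \<phi> a dvd \<phi> b"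
  by (auto simp: mult elim!: dvdE)

lemmas maps = zero one add mult uminus diff sum prod power

end

lemma ring_map_comp: "ring_map \<phi> \<Longrightarrow> ring_map \<psi> \<Longrightarrow> ring_map (\<lambda>a. \<psi> (\<phi> a))"
  by (simp add: ring_map_def)

lemma ring_map_id: "ring_map id" "ring_map (\<lambda>a. a)"
  by (simp_all add: ring_map_def)

lemma ring_map_const_poly: "ring_map (\<lambda>c. [:c:])"
  by (simp add: ring_map_def one_pCons)

lemma ring_map_cst: "ring_map (cst :: 'a::comm_ring_1 \<Rightarrow> ('v, 'a) mpoly)"
  by unfold_locales (simp_all add: cst_def single_add mult_single)

interpretation cst: ring_map cst by (rule ring_map_cst)

lemma cst_eq_iff [simp]: "cst a = cst b \<longleftrightarrow> a = b"
  by (metis cst_def lookup_single_eq)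

lemma cst_eq_0_iff [simp]: "cst a = 0 \<longleftrightarrow> a = 0" for a :: "'a::comm_ring_1"
  using cst_eq_iff[of a 0] by (simp only: cst.zero)

lemma poly_mapping_sum_single: "p = (\<Sum>m\<in>Poly_Mapping.keys p. Poly_Mapping.single m (Poly_Mapping.lookup p m))"
proof (rule poly_mapping_eqI)
  fix k
  show "Poly_Mapping.lookup p k = Poly_Mapping.lookup
    (\<Sum>m\<in>Poly_Mapping.keys p. Poly_Mapping.single m (Poly_Mapping.lookup p m)) k"
    by (simp add: lookup_sum lookup_single when_def sum.delta in_keys_iff)
qed

lemma mpoly_sum_induct:
  fixes p :: "'b \<Rightarrow>\<^sub>0 'a::comm_monoid_add"
  assumes "\<And>m c. P (Poly_Mapping.single m c)" and "\<And>p q. P p \<Longrightarrow> P q \<Longrightarrow> P (p + q)"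
  shows "P p"
proof -
  have "P (\<Sum>m\<in>A. Poly_Mapping.single m (c m))" if "finite A" for A c
    using that
  proof induction
    case empty
    show ?case using assms(1)[of undefined 0] by simp
  qed (simp add: assms)
  then show ?thesis
    by (subst poly_mapping_sum_single) simp
qed

lemma single_var_power: fixes v :: 'v shows "Poly_Mapping.single (Poly_Mapping.single v n) (1::'a::comm_ring_1) = var v ^ n"
proof (induction n)
  case (Suc n)
  have "Poly_Mapping.single (Poly_Mapping.single v (Suc n)) (1::'a) = var v * Poly_Mapping.single (Poly_Mapping.single v n) 1"
    by (simp add: var_def mult_single flip: single_add)
  with Suc show ?case by simp
qed simp

lemma single_eq_prod:
  fixes c :: "'a::comm_ring_1"
  shows "Poly_Mapping.single m c = cst c * (\<Prod>v\<in>Poly_Mapping.keys m. var v ^ Poly_Mapping.lookup m v)"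
proof -
  have *: "Poly_Mapping.single (sum f A) (1::'a) = (\<Prod>v\<in>A. Poly_Mapping.single (f v) 1)"
    if "finite A" for A and f :: "'b \<Rightarrow> 'b \<Rightarrow>\<^sub>0 nat"
    using that
  proof induction
    case (insert x F)
    have "Poly_Mapping.single (f x + sum f F) (1::'a) = Poly_Mapping.single (f x) 1 * Poly_Mapping.single (sum f F) 1"
      by (simp add: mult_single)
    with insert show ?case by simp
  qed simp
  have "Poly_Mapping.single m c = cst c * Poly_Mapping.single m 1"
    by (simp add: cst_def mult_single)
  also have "Poly_Mapping.single m (1::'a) =
      (\<Prod>v\<in>Poly_Mapping.keys m. Poly_Mapping.single (Poly_Mapping.single v (Poly_Mapping.lookup m v)) 1)"
    by (subst poly_mapping_sum_single[of m], subst *) simp_all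
  finally show ?thesis by (simp add: single_var_power)
qed

text \<open>
  Polynomials are generated by constants and variables. Congruences modulo an ideal and identities
  between ring maps are proved with this rule, without reference to monomials.
\<close>

lemma mpoly_induct [case_names cst var add mult]:
  fixes p :: "('v, 'a::comm_ring_1) mpoly"
  assumes "\<And>c. P (cst c)" "\<And>v. P (var v)" "\<And>p q. P p \<Longrightarrow> P q \<Longrightarrow> P (p + q)"
    "\<And>p q. P p \<Longrightarrow> P q \<Longrightarrow> P (p * q)"
  shows "P p"
proof (rule mpoly_sum_induct)
  have pow: "P (var v ^ n)" for v n
    using assms(1)[of 1] by (induction n) (auto simp: assms cst.one)
  have "P (\<Prod>v\<in>A. var v ^ f v)" if "finite A" for A f
    using that assms(1)[of 1] by induction (auto simp: assms pow cst.one)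
  then show "P (Poly_Mapping.single m c)" for m c
    by (subst single_eq_prod) (simp add: assms)
qed (rule assms)

definition mon_eval :: "('v \<Rightarrow> 'b::comm_ring_1) \<Rightarrow> ('v \<Rightarrow>\<^sub>0 nat) \<Rightarrow> 'b" where
  "mon_eval g m = (\<Prod>v\<in>Poly_Mapping.keys m. g v ^ Poly_Mapping.lookup m v)"

lemma mon_eval_superset:
  "finite A \<Longrightarrow> Poly_Mapping.keys m \<subseteq> A \<Longrightarrow> mon_eval g m = (\<Prod>v\<in>A. g v ^ Poly_Mapping.lookup m v)"
  unfolding mon_eval_def by (rule prod.mono_neutral_left) (auto simp: in_keys_iff)

lemma mon_eval_add: "mon_eval g (m + n) = mon_eval g m * mon_eval g n"
proof -
  let ?A = "Poly_Mapping.keys m \<union> Poly_Mapping.keys n"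
  have "Poly_Mapping.keys (m + n) \<subseteq> ?A" by (rule Poly_Mapping.keys_add)
  then show ?thesis
    by (simp add: mon_eval_superset[of ?A] lookup_add power_add prod.distrib)
qed

lemma mon_eval_0: "mon_eval g 0 = 1"
  by (simp add: mon_eval_def)

lemma subst_alt: "subst h g p = (\<Sum>m\<in>Poly_Mapping.keys p. h (Poly_Mapping.lookup p m) * mon_eval g m)"
  by (simp add: subst_def mon_eval_def)

context ring_map
begin

lemma subst_superset:
  "finite A \<Longrightarrow> Poly_Mapping.keys p \<subseteq> A \<Longrightarrow>
     subst \<phi> g p = (\<Sum>m\<in>A. \<phi> (Poly_Mapping.lookup p m) * mon_eval g m)"
  unfolding subst_alt by (rule sum.mono_neutral_left) (auto simp: in_keys_iff zero)

lemma subst_add: "subst \<phi> g (p + q) = subst \<phi> g p + subst \<phi> g q"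
proof -
  let ?A = "Poly_Mapping.keys p \<union> Poly_Mapping.keys q"
  have "Poly_Mapping.keys (p + q) \<subseteq> ?A" by (rule Poly_Mapping.keys_add)
  then show ?thesis
    by (simp add: subst_superset[of ?A] lookup_add add distrib_right sum.distrib)
qed

lemma subst_single: "subst \<phi> g (Poly_Mapping.single m c) = \<phi> c * mon_eval g m"
  by (simp add: subst_superset[of "{m}"])

lemma subst_mult: "subst \<phi> g (p * q) = subst \<phi> g p * subst \<phi> g q"
proof (induction p rule: mpoly_sum_induct)
  case (1 m c)
  show ?case
    by (induction q rule: mpoly_sum_induct)
      (simp_all add: subst_single mult_single mult mon_eval_add subst_add algebra_simps)
qed (simp add: subst_add algebra_simps)

lemma subst_cst: "subst \<phi> g (cst c) = \<phi> c"
  by (simp add: cst_def subst_single mon_eval_0)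

lemma subst_var: "subst \<phi> g (var v) = g v"
  by (simp add: var_def subst_single mon_eval_def one)

lemma ring_map_subst: "ring_map (subst \<phi> g)"
  by unfold_locales (simp_all add: subst_add subst_mult one subst_cst flip: cst.one)

end

lemma ring_map_eqI:
  assumes "ring_map \<phi>" "ring_map \<psi>" "\<And>c. \<phi> (cst c) = \<psi> (cst c)" "\<And>v. \<phi> (var v) = \<psi> (var v)"
  shows "\<phi> p = \<psi> p"
  by (induction p rule: mpoly_induct)
    (simp_all add: assms ring_map.add[OF assms(1)] ring_map.add[OF assms(2)]
      ring_map.mult[OF assms(1)] ring_map.mult[OF assms(2)])

lemmas subst_cst_map = ring_map.ring_map_subst[OF ring_map_cst]
lemmas subst_cst_cst [simp] = ring_map.subst_cst[OF ring_map_cst]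
lemmas subst_cst_var [simp] = ring_map.subst_var[OF ring_map_cst]
lemmas subst_id_map = ring_map.ring_map_subst[OF ring_map_id(1)]
lemmas subst_id_cst [simp] = ring_map.subst_cst[OF ring_map_id(1), simplified]
lemmas subst_id_var [simp] = ring_map.subst_var[OF ring_map_id(1)]

section \<open>Gradings\<close>

text \<open>
  Every variable in \<open>S\<close> is multiplied by the new indeterminate \<open>t\<close>, so the coefficient of \<open>t\<^sup>n\<close> is the
  component of degree \<open>n\<close> in the variables of \<open>S\<close>. Since this is a ring map, statements about degrees
  and orders become statements about polynomials in one variable over a domain.
\<close>

definition grade :: "'v set \<Rightarrow> ('v, 'a::comm_ring_1) mpoly \<Rightarrow> ('v, 'a) mpoly poly" where
  "grade S = subst (\<lambda>c. [:cst c:]) (\<lambda>v. if v \<in> S then Polynomial.monom (var v) 1 else [:var v:])"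

definition weight :: "'v set \<Rightarrow> ('v::finite \<Rightarrow>\<^sub>0 nat) \<Rightarrow> nat" where
  "weight S m = (\<Sum>v\<in>S. Poly_Mapping.lookup m v)"

lemma ring_map_cst_poly: "ring_map (\<lambda>c. [:cst c:])"
  using ring_map_comp[OF ring_map_cst ring_map_const_poly] .

lemma ring_map_grade: "ring_map (grade S)"
  unfolding grade_def by (rule ring_map.ring_map_subst[OF ring_map_cst_poly])

interpretation grade: ring_map "grade S" for S by (rule ring_map_grade)

lemma grade_cst: "grade S (cst c) = [:cst c:]"
  unfolding grade_def by (rule ring_map.subst_cst[OF ring_map_cst_poly])

lemma grade_var: "grade S (var v) = (if v \<in> S then Polynomial.monom (var v) 1 else [:var v:])"
  unfolding grade_def by (rule ring_map.subst_var[OF ring_map_cst_poly])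

lemma poly_grade_1: "poly (grade S p) 1 = p"
  for p :: "('b, 'a::comm_ring_1) mpoly"
proof -
  have "ring_map (\<lambda>q. poly q (1::('b, 'a) mpoly))" by unfold_locales simp_all
  from ring_map_eqI[OF ring_map_comp[OF ring_map_grade this] ring_map_id(2)] show ?thesis
    by (simp add: grade_cst grade_var poly_monom)
qed

lemma grade_eq_0_iff [simp]: "grade S p = 0 \<longleftrightarrow> p = 0"
  using poly_grade_1[of S p] by (auto simp: grade.zero)

lemma prod_monom: "(\<Prod>v\<in>A. Polynomial.monom (a v) (n v)) = Polynomial.monom (prod a A) (sum n A)"
  if "finite A" for a :: "'b \<Rightarrow> 'c::comm_semiring_1"
  using that by induction (simp_all add: mult_monom monom_0 one_pCons)

lemma grade_single: "grade S (Poly_Mapping.single m c) = Polynomial.monom (Poly_Mapping.single m c) (weight S m)"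
  for S :: "'v::finite set" and c :: "'a::comm_ring_1"
proof -
  have *: "mon_eval g m = (\<Prod>v\<in>UNIV. g v ^ Poly_Mapping.lookup m v)" for g :: "'v \<Rightarrow> ('v, 'a) mpoly poly"
    by (rule mon_eval_superset) auto
  have 1: "(\<Prod>v\<in>UNIV. var v ^ Poly_Mapping.lookup m v :: ('v, 'a) mpoly) = Poly_Mapping.single m 1"
    using mon_eval_superset[of UNIV m "var :: 'v \<Rightarrow> ('v, 'a) mpoly"] single_eq_prod[of m "1::'a"]
    by (simp add: mon_eval_def cst.one)
  have "grade S (Poly_Mapping.single m c) = [:cst c:] *
      (\<Prod>v\<in>UNIV. (if v \<in> S then Polynomial.monom (var v) 1 else [:var v:]) ^ Poly_Mapping.lookup m v)"
    unfolding grade_def ring_map.subst_single[OF ring_map_cst_poly] * ..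
  also have "(\<Prod>v\<in>UNIV. (if v \<in> S then Polynomial.monom (var v) 1 else [:var v:]) ^ Poly_Mapping.lookup m v)
     = (\<Prod>v\<in>UNIV. Polynomial.monom (var v ^ Poly_Mapping.lookup m v) (if v \<in> S then Poly_Mapping.lookup m v else 0))"
    by (intro prod.cong refl) (auto simp: monom_power monom_0 poly_const_pow)
  also have "\<dots> = Polynomial.monom (\<Prod>v\<in>UNIV. var v ^ Poly_Mapping.lookup m v)
       (\<Sum>v\<in>UNIV. if v \<in> S then Poly_Mapping.lookup m v else 0)"
    by (rule prod_monom) simp
  also have "(\<Sum>v\<in>UNIV. if v \<in> S then Poly_Mapping.lookup m v else 0) = weight S m"
    by (simp add: weight_def sum.If_cases)
  finally show ?thesis
    by (simp add: 1 smult_monom cst_def mult_single)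
qed

lemma lookup_coeff_grade:
  "Poly_Mapping.lookup (coeff (grade S p) n) m = (if weight S m = n then Poly_Mapping.lookup p m else 0)"
  for S :: "'v::finite set"
  by (induction p rule: mpoly_sum_induct)
    (auto simp: grade_single grade.add lookup_add lookup_single when_def)

lemma tdeg_weight: "tdeg m = weight UNIV m" for m :: "'v::finite \<Rightarrow>\<^sub>0 nat"
  unfolding tdeg_def weight_def by (rule sum.mono_neutral_left) (auto simp: in_keys_iff)

lemma grade_eq_monom_iff:
  "grade S p = Polynomial.monom p n \<longleftrightarrow> (\<forall>m\<in>Poly_Mapping.keys p. weight S m = n)"
  for S :: "'v::finite set"
proof
  assume *: "grade S p = Polynomial.monom p n"
  show "\<forall>m\<in>Poly_Mapping.keys p. weight S m = n"
    using lookup_coeff_grade[of S p n] unfolding * by (auto simp: in_keys_iff) (metis coeff_monom)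
next
  assume *: "\<forall>m\<in>Poly_Mapping.keys p. weight S m = n"
  show "grade S p = Polynomial.monom p n"
    by (rule poly_eqI, rule poly_mapping_eqI)
      (use * in \<open>auto simp: lookup_coeff_grade in_keys_iff\<close>)
qed

lemma forms_iff: "p \<in> forms n \<longleftrightarrow> grade UNIV p = Polynomial.monom p n"
  for p :: "('v::finite, 'a::comm_ring_1) mpoly"
  by (simp add: forms_def grade_eq_monom_iff tdeg_weight)

lemma forms_0 [simp]: "0 \<in> forms n" by (simp add: forms_def)

lemma forms_add: "p \<in> forms n \<Longrightarrow> q \<in> forms n \<Longrightarrow> p + q \<in> forms n"
  for p :: "('v::finite, 'a::comm_ring_1) mpoly"
  by (simp add: forms_iff grade.add add_monom)

lemma forms_diff: "p \<in> forms n \<Longrightarrow> q \<in> forms n \<Longrightarrow> p - q \<in> forms n"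
  for p :: "('v::finite, 'a::comm_ring_1) mpoly"
  by (simp add: forms_iff grade.diff diff_monom)

lemma forms_sum: "(\<And>x. x \<in> A \<Longrightarrow> f x \<in> forms n) \<Longrightarrow> sum f A \<in> forms n"
  for f :: "'b \<Rightarrow> ('v::finite, 'a::comm_ring_1) mpoly"
  by (induction A rule: infinite_finite_induct) (auto simp: forms_add)

lemma forms_mult: "p \<in> forms n \<Longrightarrow> q \<in> forms k \<Longrightarrow> p * q \<in> forms (n + k)"
  for p :: "('v::finite, 'a::comm_ring_1) mpoly"
  by (simp add: forms_iff grade.mult mult_monom)

lemma forms_cst: "cst c \<in> forms 0" for c :: "'a::comm_ring_1"
  by (simp add: forms_def cst_def tdeg_def)

lemma forms_cst_mult: "p \<in> forms n \<Longrightarrow> cst c * p \<in> forms n"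
  for p :: "('v::finite, 'a::comm_ring_1) mpoly"
  using forms_mult[OF forms_cst, of p n c] by simp

lemma forms_var: "(var v :: ('v::finite, 'a::comm_ring_1) mpoly) \<in> forms 1"
  by (simp add: forms_iff grade_var)

lemma forms_power: "p \<in> forms n \<Longrightarrow> p ^ k \<in> forms (k * n)"
  for p :: "('v::finite, 'a::comm_ring_1) mpoly"
  by (induction k) (auto intro!: forms_mult simp: forms_cst simp flip: cst.one)

lemma forms_unique: "p \<in> forms n \<Longrightarrow> p \<in> forms k \<Longrightarrow> p \<noteq> 0 \<Longrightarrow> n = k"
  for p :: "('v::finite, 'a::comm_ring_1) mpoly"
  by (metis forms_iff degree_monom_eq)

definition hcomp :: "nat \<Rightarrow> ('v::finite, 'a::comm_ring_1) mpoly \<Rightarrow> ('v, 'a) mpoly" where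
  "hcomp n p = coeff (grade UNIV p) n"

lemma hcomp_forms: "hcomp n p \<in> forms n"
  by (auto simp: forms_def hcomp_def in_keys_iff lookup_coeff_grade tdeg_weight split: if_splits)

lemma hcomp_of_forms: "p \<in> forms n \<Longrightarrow> hcomp k p = (if k = n then p else 0)"
  by (auto simp: forms_iff hcomp_def)

lemma hcomp_add: "hcomp n (p + q) = hcomp n p + hcomp n q"
  and hcomp_diff: "hcomp n (p - q) = hcomp n p - hcomp n q"
  and hcomp_0: "hcomp n 0 = 0"
  by (simp_all add: hcomp_def grade.maps)

lemma hcomp_mult_forms: "q \<in> forms k \<Longrightarrow> hcomp n (q * p) = (if k \<le> n then q * hcomp (n - k) p else 0)"
  by (auto simp: forms_iff hcomp_def grade.mult coeff_monom_mult)

lemma hcomp_sum_all: "p = (\<Sum>n\<le>Polynomial.degree (grade UNIV p). hcomp n p)"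
  using poly_grade_1[of UNIV p] by (simp add: poly_altdef hcomp_def)

lemma forms_0_eq:
  fixes p :: "('v::finite, 'a::comm_ring_1) mpoly"
  assumes "p \<in> forms 0" obtains c where "p = cst c"
proof -
  have k: "m = 0" if "m \<in> Poly_Mapping.keys p" for m
  proof (rule poly_mapping_eqI)
    fix v show "Poly_Mapping.lookup m v = Poly_Mapping.lookup 0 v"
      using assms that by (auto simp: forms_def tdeg_weight weight_def)
  qed
  have "p = cst (Poly_Mapping.lookup p 0)"
    by (rule poly_mapping_eqI)
      (use k in \<open>auto simp: cst_def lookup_single when_def in_keys_iff\<close>)
  then show ?thesis by (rule that)
qed

text \<open>Over a domain, the factors of a form are forms: the highest and the lowest degrees occurring
  in a product are the sums of those of the factors.\<close>

lemma poly_mult_eq_monom: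
  fixes p q :: "'a::idom poly"
  assumes "p * q = Polynomial.monom c n" "c \<noteq> 0"
  obtains i a where "i \<le> n" "p = Polynomial.monom a i"
proof -
  have nz: "p \<noteq> 0" "q \<noteq> 0" using assms by auto
  have "order 0 p + order 0 q = n"
    using order_mult[of p q 0] assms by (simp add: order_0_monom)
  moreover have "Polynomial.degree p + Polynomial.degree q = n"
    using degree_mult_eq[OF nz] assms by (simp add: degree_monom_eq)
  moreover have "order 0 p \<le> Polynomial.degree p" "order 0 q \<le> Polynomial.degree q"
    by (simp_all add: order_degree nz)
  ultimately have *: "order 0 p = Polynomial.degree p" "Polynomial.degree p \<le> n" by linarith+
  then have "\<forall>k<Polynomial.degree p. coeff p k = 0"
    using monom_1_dvd_iff[OF nz(1)] monom_1_dvd_iff'[of "Polynomial.degree p" p] by simp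
  then have "p = Polynomial.monom (lead_coeff p) (Polynomial.degree p)"
    by (intro poly_eqI) (metis coeff_eq_0 coeff_monom linorder_neqE_nat)
  with * that show ?thesis by blast
qed

lemma forms_factor:
  fixes p q :: "('v::{finite,linorder}, 'a::idom) mpoly"
  assumes "p * q \<in> forms n" "p * q \<noteq> 0"
  obtains i where "i \<le> n" "p \<in> forms i" "q \<in> forms (n - i)"
proof -
  have eq: "grade UNIV p * grade UNIV q = Polynomial.monom (p * q) n"
    using assms by (simp add: forms_iff grade.mult)
  have form: "r \<in> forms i" if "grade UNIV r = Polynomial.monom a i" for r i and a :: "('v, 'a) mpoly"
  proof -
    have "r = a" using poly_grade_1[of UNIV r] that by (simp add: poly_monom)
    then show ?thesis using that by (simp add: forms_iff)
  qed
  obtain i a where i: "i \<le> n" "grade UNIV p = Polynomial.monom a i"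
    using poly_mult_eq_monom[OF eq assms(2)] by blast
  obtain j b where j: "j \<le> n" "grade UNIV q = Polynomial.monom b j"
    using poly_mult_eq_monom[OF eq[unfolded mult.commute[of "grade UNIV p"]] assms(2)] by blast
  have p: "p \<in> forms i" and q: "q \<in> forms j" using form i j by auto
  have "i + j = n" using forms_unique[OF forms_mult[OF p q] assms] .
  with that[OF i(1) p] q show ?thesis by auto
qed

section \<open>Common factors\<close>

text \<open>
  A copy of a field, made an instance of \<open>field_gcd\<close> with the trivial gcd. Iterated polynomials over it
  have greatest common divisors, and \<open>k[x,y,z]\<close> obtains them through the isomorphism \<open>iterated\<close>.
\<close>

typedef 'a field_copy = "UNIV :: 'a set" by simp

setup_lifting type_definition_field_copy

instantiation field_copy :: (field) field
begin
lift_definition zero_field_copy :: "'a field_copy" is 0 .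
lift_definition one_field_copy :: "'a field_copy" is 1 .
lift_definition plus_field_copy :: "'a field_copy \<Rightarrow> 'a field_copy \<Rightarrow> 'a field_copy" is "(+)" .
lift_definition minus_field_copy :: "'a field_copy \<Rightarrow> 'a field_copy \<Rightarrow> 'a field_copy" is "(-)" .
lift_definition uminus_field_copy :: "'a field_copy \<Rightarrow> 'a field_copy" is uminus .
lift_definition times_field_copy :: "'a field_copy \<Rightarrow> 'a field_copy \<Rightarrow> 'a field_copy" is "(*)" .
lift_definition inverse_field_copy :: "'a field_copy \<Rightarrow> 'a field_copy" is inverse .
lift_definition divide_field_copy :: "'a field_copy \<Rightarrow> 'a field_copy \<Rightarrow> 'a field_copy" is "(/)" .
instance
  by standard (transfer; simp add: algebra_simps field_simps)+
end

instantiation field_copy ::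
  (field) "{unique_euclidean_ring, normalization_euclidean_semiring, normalization_semidom_multiplicative}"
begin

definition [simp]: "normalize_field_copy = (normalize_field :: 'a field_copy \<Rightarrow> _)"
definition [simp]: "unit_factor_field_copy = (unit_factor_field :: 'a field_copy \<Rightarrow> _)"
definition [simp]: "modulo_field_copy = (mod_field :: 'a field_copy \<Rightarrow> _)"
definition [simp]: "euclidean_size_field_copy = (euclidean_size_field :: 'a field_copy \<Rightarrow> _)"
definition [simp]: "division_segment (x :: 'a field_copy) = 1"

instance
  by standard
    (simp_all add: dvd_field_iff field_split_simps split: if_splits)

end

instantiation field_copy :: (field) euclidean_ring_gcd
begin

definition gcd_field_copy :: "'a field_copy \<Rightarrow> 'a field_copy \<Rightarrow> 'a field_copy" where
  "gcd_field_copy = Euclidean_Algorithm.gcd"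
definition lcm_field_copy :: "'a field_copy \<Rightarrow> 'a field_copy \<Rightarrow> 'a field_copy" where
  "lcm_field_copy = Euclidean_Algorithm.lcm"
definition Gcd_field_copy :: "'a field_copy set \<Rightarrow> 'a field_copy" where
 "Gcd_field_copy = Euclidean_Algorithm.Gcd"
definition Lcm_field_copy :: "'a field_copy set \<Rightarrow> 'a field_copy" where
 "Lcm_field_copy = Euclidean_Algorithm.Lcm"

instance
  by standard (simp_all add: gcd_field_copy_def lcm_field_copy_def Gcd_field_copy_def Lcm_field_copy_def)

end

instance field_copy :: (field) field_gcd ..

lemma exhaust_3: "x = 0 \<or> x = 1 \<or> x = 2" for x :: 3
proof (induct x)
  case (of_int z)
  then have "0 \<le> z" "z < 3" by simp_all
  then have "z = 0 \<or> z = 1 \<or> z = 2" by arith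
  then show ?case by auto
qed

lemma UNIV_3: "(UNIV :: 3 set) = {0, 1, 2}"
proof (rule UNIV_eq_I)
  show "x \<in> {0, 1, 2}" for x :: 3 using exhaust_3[of x] by blast
qed

lemma sum_3: "(\<Sum>i\<in>UNIV. f i) = f 0 + f 1 + f 2" for f :: "3 \<Rightarrow> 'a::comm_monoid_add"
  unfolding UNIV_3 by (simp add: add.assoc)

lemma map_poly_ring_map:
  assumes "ring_map h"
  shows "ring_map (\<lambda>p. poly (map_poly h p) x)"
proof -
  interpret h: ring_map h by fact
  have add: "map_poly h (p + q) = map_poly h p + map_poly h q" for p q
    by (rule poly_eqI) (simp add: coeff_map_poly h.maps)
  have smult: "map_poly h (smult a q) = smult (h a) (map_poly h q)" for a q
    by (rule poly_eqI) (simp add: coeff_map_poly h.maps)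
  have mult: "map_poly h (p * q) = map_poly h p * map_poly h q" for p q
  proof (induction p)
    case (pCons a p)
    have "map_poly h (pCons a p * q) = map_poly h (smult a q + pCons 0 (p * q))" by simp
    also have "\<dots> = smult (h a) (map_poly h q) + pCons 0 (map_poly h p * map_poly h q)"
      by (simp only: add smult map_poly_pCons h.zero pCons.IH)
    finally show ?case by (simp add: map_poly_pCons h.zero)
  qed simp
  show ?thesis
  proof
    show "poly (map_poly h 1) x = 1" by (simp add: map_poly_1 h.one)
  qed (simp_all only: add mult poly_add poly_mult)
qed

text \<open>
  The isomorphism from \<open>k[x,y,z]\<close> to \<open>k[x][y][z]\<close>.
\<close>

definition iterated :: "(3, 'k::field) mpoly \<Rightarrow> 'k field_copy poly poly poly" where
  "iterated = subst (\<lambda>c. [:[:[:Abs_field_copy c:]:]:])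
     (\<lambda>i. if i = 0 then [:[:[:0, 1:]:]:] else if i = 1 then [:[:0, 1:]:] else [:0, 1:])"

lemma ring_map_Abs: "ring_map (\<lambda>c. [:[:[:Abs_field_copy c:]:]:])"
  by unfold_locales
    (simp_all add: plus_field_copy.abs_eq times_field_copy.abs_eq one_field_copy_def one_pCons mult.commute)

lemma ring_map_iterated: "ring_map iterated"
  unfolding iterated_def by (rule ring_map.ring_map_subst[OF ring_map_Abs])

lemma inj_iterated: "inj iterated"
proof -
  have "ring_map (\<lambda>c. cst (Rep_field_copy c))"
    by unfold_locales (simp_all add: plus_field_copy.rep_eq times_field_copy.rep_eq one_field_copy.rep_eq cst.maps)
  note 1 = map_poly_ring_map[OF this, of "var 0"]
  note 2 = map_poly_ring_map[OF 1, of "var 1"]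
  note 3 = map_poly_ring_map[OF 2, of "var (2::3)"]
  \<comment> \<open>The inverse replaces the three indeterminates, from the innermost outwards, by the variables.\<close>
  let ?inv = "\<lambda>p. poly (map_poly (\<lambda>p. poly (map_poly (\<lambda>p. poly (map_poly (\<lambda>c. cst (Rep_field_copy c)) p) (var 0)) p) (var 1)) p) (var (2::3))"
  have "?inv (iterated p) = p" for p
  proof (rule ring_map_eqI[OF ring_map_comp[OF ring_map_iterated 3] ring_map_id(2)])
    show "?inv (iterated (cst c)) = cst c" for c
      by (simp add: iterated_def ring_map.subst_cst[OF ring_map_Abs] map_poly_pCons ring_map.zero[OF 2] ring_map.zero[OF 1]
         Abs_field_copy_inverse zero_field_copy.rep_eq cst.zero)
    show "?inv (iterated (var i)) = var i" for i :: 3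
      using exhaust_3[of i]
      by (auto simp add: iterated_def ring_map.subst_var[OF ring_map_Abs] map_poly_pCons ring_map.zero[OF 2] ring_map.zero[OF 1]
         zero_field_copy.rep_eq one_field_copy.rep_eq cst.maps ring_map.one[OF 1] ring_map.one[OF 2])
  qed
  then show ?thesis by (rule inj_on_inverseI)
qed

lemma surj_iterated: "surj iterated"
proof -
  interpret ring_map iterated by (rule ring_map_iterated)
  have plus: "a + b \<in> range iterated" and times: "a * b \<in> range iterated"
    if "a \<in> range iterated" "b \<in> range iterated" for a b
    using that by (auto simp flip: add mult)
  have cst: "[:[:[:c:]:]:] \<in> range iterated" for c
    by (rule range_eqI[of _ _ "cst (Rep_field_copy c)"])
      (simp add: iterated_def ring_map.subst_cst[OF ring_map_Abs] Rep_field_copy_inverse)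
  have var: "[:[:[:0, 1:]:]:] \<in> range iterated" "[:[:0, 1:]:] \<in> range iterated" "[:0, 1:] \<in> range iterated"
    by (rule range_eqI[of _ _ "var 0"] range_eqI[of _ _ "var 1"] range_eqI[of _ _ "var 2"],
        simp add: iterated_def ring_map.subst_var[OF ring_map_Abs])+
  have 1: "[:[:a:]:] \<in> range iterated" for a
  proof (induction a)
    case (pCons c a)
    have "[:[:pCons c a:]:] = [:[:[:c:]:]:] + [:[:[:0, 1:]:]:] * [:[:a:]:]" by simp
    then show ?case by (rule ssubst) (intro plus times cst var pCons.IH)
  next
    case 0
    show ?case by (rule range_eqI[of _ _ 0]) (simp add: zero)
  qed
  have 2: "[:a:] \<in> range iterated" for a
  proof (induction a)
    case (pCons c a)
    have "[:pCons c a:] = [:[:c:]:] + [:[:0, 1:]:] * [:a:]" by simp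
    then show ?case by (rule ssubst) (intro plus times 1 var pCons.IH)
  next
    case 0
    show ?case using 1[of 0] by (simp only: pCons_0_0)
  qed
  have "a \<in> range iterated" for a
  proof (induction a)
    case (pCons c a)
    have "pCons c a = [:c:] + [:0, 1:] * a" by simp
    then show ?case by (rule ssubst) (intro plus times 2 var pCons.IH)
  next
    case 0
    show ?case using 2[of 0] by (simp only: pCons_0_0)
  qed
  then show ?thesis by auto
qed

text \<open>
  Coprimality of \<open>a'\<close> and \<open>b'\<close> is expressed as a cancellation property, which is the form that
  the root lemma \<open>hev_root\<close> needs.
\<close>

lemma split_common_factor:
  fixes a b :: "(3, 'k::field) mpoly"
  assumes "a \<noteq> 0"
  obtains g a' b' where "a = g * a'" "b = g * b'" "\<And>r. a' dvd r * b' \<Longrightarrow> a' dvd r"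
proof -
  interpret ring_map iterated by (rule ring_map_iterated)
  have dvd_iff: "iterated p dvd iterated q \<longleftrightarrow> p dvd q" for p q :: "(3, 'k) mpoly"
  proof
    assume "iterated p dvd iterated q"
    then obtain r' where "iterated q = iterated p * r'" by (elim dvdE)
    moreover obtain r where "r' = iterated r" using surjD[OF surj_iterated] by blast
    ultimately have "iterated q = iterated p * iterated r" by (simp only:)
    then have "q = p * r" by (intro injD[OF inj_iterated]) (simp add: mult)
    then show "p dvd q" by simp
  qed (rule dvd)
  have "iterated a \<noteq> 0"
    using assms inj_iterated by (metis injD zero)
  then have "gcd (iterated a) (iterated b) \<noteq> 0" by simp
  from gcd_coprime_exists[OF this] obtain a1 b1 where 1: "iterated a = a1 * gcd (iterated a) (iterated b)"
    "iterated b = b1 * gcd (iterated a) (iterated b)" "coprime a1 b1"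
    by blast
  obtain g a' b' where 2: "gcd (iterated a) (iterated b) = iterated g" "a1 = iterated a'" "b1 = iterated b'"
    using surjD[OF surj_iterated] by blast
  show ?thesis
  proof (rule that)
    show "a = g * a'" "b = g * b'"
      by (intro injD[OF inj_iterated], simp only: mult 1(1)[unfolded 2] mult.commute[of "iterated g"],
          intro injD[OF inj_iterated], simp only: mult 1(2)[unfolded 2] mult.commute[of "iterated g"])
    show "a' dvd r" if "a' dvd r * b'" for r
    proof -
      have "iterated a' dvd iterated r * iterated b'"
        using that by (simp only: dvd_iff flip: mult)
      then show ?thesis using 1(3) unfolding 2
        by (simp add: coprime_dvd_mult_left_iff dvd_iff)
    qed
  qed
qed

lemma no_common_factor_dvd:
  fixes a b :: "(3, 'k::field) mpoly"
  assumes "a \<noteq> 0" "\<And>h. h dvd a \<Longrightarrow> h dvd b \<Longrightarrow> h dvd 1" "a dvd r * b"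
  shows "a dvd r"
proof -
  obtain g a' b' where *: "a = g * a'" "b = g * b'" "\<And>r. a' dvd r * b' \<Longrightarrow> a' dvd r"
    using split_common_factor[OF assms(1)] by blast
  have "g dvd 1" using assms(2)[of g] * by simp
  then obtain u where u: "1 = g * u" by (elim dvdE)
  have "u * a = (g * u) * a'" using *(1) by (simp add: ac_simps)
  then have "a' = u * a" by (simp flip: u)
  have "g * a' dvd g * (r * b')"
    using assms(3) *(1,2) by (simp only: mult.left_commute)
  moreover have "g \<noteq> 0" using assms(1) *(1) by auto
  ultimately have "a' dvd r * b'" by (simp only: dvd_mult_cancel_left simp_thms)
  then have "a' dvd r" by (rule *(3))
  moreover have "a dvd a'" by (subst \<open>a' = u * a\<close>) (rule dvd_triv_right)
  ultimately show ?thesis by (rule dvd_trans[rotated])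
qed

section \<open>Binary forms\<close>

text \<open>
  The value at \<open>(x, y)\<close> of the binary form of degree \<open>n\<close> with coefficients \<open>c i\<close>. Arguments and
  coefficients lie in the same arbitrary ring: with the variables as arguments this is the form itself,
  and its coefficients may be polynomials in the same variables.
\<close>

definition hev :: "nat \<Rightarrow> (nat \<Rightarrow> 'a::comm_ring_1) \<Rightarrow> 'a \<Rightarrow> 'a \<Rightarrow> 'a" where
  "hev n c x y = (\<Sum>i\<le>n. c i * x ^ i * y ^ (n - i))"

lemma hev_0 [simp]: "hev 0 c x y = c 0"
  by (simp add: hev_def)

lemma hev_Suc: "hev (Suc n) c x y = y * hev n c x y + c (Suc n) * x ^ Suc n"
  by (simp add: hev_def sum_distrib_left Suc_diff_le algebra_simps)

lemma hev_scale: "hev n c (g * x) (g * y) = g ^ n * hev n c x y"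
proof -
  have "c i * (g * x) ^ i * (g * y) ^ (n - i) = g ^ n * (c i * x ^ i * y ^ (n - i))" if "i \<le> n" for i
  proof -
    have "g ^ n = g ^ i * g ^ (n - i)" using that by (simp flip: power_add)
    then show ?thesis by (simp add: power_mult_distrib ac_simps)
  qed
  then show ?thesis by (simp add: hev_def sum_distrib_left)
qed

lemma (in ring_map) map_hev: "\<phi> (hev n c x y) = hev n (\<lambda>i. \<phi> (c i)) (\<phi> x) (\<phi> y)"
  by (simp add: hev_def maps)

lemma hev_cong: "(\<And>i. i \<le> n \<Longrightarrow> c i = c' i) \<Longrightarrow> hev n c x y = hev n c' x y"
  by (simp add: hev_def)

text \<open>
  A binary form with the root \<open>(s, t)\<close> is divisible by \<open>t X - s Y\<close> as soon as \<open>t\<close> is coprime to \<open>s\<close>: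
  then \<open>t\<close> divides the top coefficient, and subtracting a multiple of \<open>t X - s Y\<close> leaves \<open>Y\<close> times a
  form of smaller degree with the same root. The coefficients of the quotient are \<open>\<nu> (Suc j)\<close>; the index
  is shifted so that the relation between the coefficients also holds at both ends.
\<close>

lemma hev_root:
  fixes s t :: "'a::idom"
  assumes "hev n c s t = 0" "t \<noteq> 0" "\<And>r. t dvd r * s \<Longrightarrow> t dvd r"
  obtains \<nu> where "\<nu> 0 = 0" "\<nu> (Suc n) = 0" "\<And>j. j \<le> n \<Longrightarrow> c j = t * \<nu> j - s * \<nu> (Suc j)"
  using assms(1)
proof (induction n arbitrary: c thesis)
  case 0
  show ?case by (rule 0(1)[of "\<lambda>_. 0"]) (use 0(2) in auto)
next
  case (Suc n)
  have pow: "t dvd r * s ^ k \<Longrightarrow> t dvd r" for r k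
  proof (induction k)
    case (Suc k)
    then have "t dvd (r * s ^ k) * s" by (simp add: ac_simps)
    then show ?case using assms(3) Suc.IH by blast
  qed simp
  have "c (Suc n) * s ^ Suc n = t * (- hev n c s t)"
    using Suc.prems(2) by (simp add: hev_Suc add_eq_0_iff)
  then have "t dvd c (Suc n) * s ^ Suc n" by (rule dvdI)
  then obtain e where e: "c (Suc n) = t * e" using pow by blast
  let ?c = "c(n := c n + e * s)"
  have "hev n ?c s t = hev n c s t + e * s ^ Suc n"
  proof (cases n)
    case (Suc k)
    have "hev k ?c s t = hev k c s t" using Suc by (intro hev_cong) auto
    with Suc show ?thesis by (simp add: hev_Suc algebra_simps)
  qed (simp add: algebra_simps)
  moreover have "t * (hev n c s t + e * s ^ Suc n) = 0"
    using Suc.prems(2) unfolding hev_Suc e by (simp add: distrib_left mult.assoc)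
  ultimately have "hev n ?c s t = 0" using assms(2) by simp
  then obtain \<nu> where \<nu>: "\<nu> 0 = 0" "\<nu> (Suc n) = 0" "\<And>j. j \<le> n \<Longrightarrow> ?c j = t * \<nu> j - s * \<nu> (Suc j)"
    using Suc.IH by blast
  show ?case
  proof (rule Suc.prems(1)[of "\<nu>(Suc n := e, Suc (Suc n) := 0)"])
    fix j assume "j \<le> Suc n"
    then consider "j < n" | "j = n" | "j = Suc n" by linarith
    then show "c j = t * (\<nu>(Suc n := e, Suc (Suc n) := 0)) j - s * (\<nu>(Suc n := e, Suc (Suc n) := 0)) (Suc j)"
    proof cases
      case 1 then show ?thesis using \<nu>(3)[of j] by simp
    next
      case 2
      have "c n + e * s = t * \<nu> n" using \<nu>(3)[of n] \<nu>(2) by simp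
      then have "c n = t * \<nu> n - s * e" by (simp add: eq_diff_eq mult.commute)
      with 2 show ?thesis by simp
    next
      case 3 then show ?thesis using e by simp
    qed
  qed (simp_all add: \<nu>(1))
qed

text \<open>
  This turns the relation between coefficients in \<open>hev_root\<close> into a factorization.
\<close>

lemma hev_factor:
  assumes "\<nu> 0 = 0" "\<nu> (Suc (Suc n)) = 0"
  shows "hev (Suc n) (\<lambda>j. t * \<nu> j - s * \<nu> (Suc j)) x y = (t * x - s * y) * hev n (\<lambda>j. \<nu> (Suc j)) x y"
proof -
  have "hev (Suc n) (\<lambda>j. t * \<nu> j) x y = (\<Sum>i\<le>n. t * x * (\<nu> (Suc i) * x ^ i * y ^ (n - i)))"
    unfolding hev_def by (subst sum.atMost_Suc_shift) (simp add: assms(1) ac_simps)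
  then have 1: "hev (Suc n) (\<lambda>j. t * \<nu> j) x y = t * x * hev n (\<lambda>j. \<nu> (Suc j)) x y"
    by (simp only: hev_def sum_distrib_left)
  have "hev n (\<lambda>j. s * \<nu> (Suc j)) x y = s * hev n (\<lambda>j. \<nu> (Suc j)) x y"
    by (simp only: hev_def sum_distrib_left mult.assoc)
  then have 2: "hev (Suc n) (\<lambda>j. s * \<nu> (Suc j)) x y = s * y * hev n (\<lambda>j. \<nu> (Suc j)) x y"
    by (simp add: assms(2) hev_Suc)
  have "hev (Suc n) (\<lambda>j. t * \<nu> j - s * \<nu> (Suc j)) x y =
     hev (Suc n) (\<lambda>j. t * \<nu> j) x y - hev (Suc n) (\<lambda>j. s * \<nu> (Suc j)) x y"
    by (simp only: hev_def sum_subtractf left_diff_distrib)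
  then show ?thesis by (simp only: 1 2 left_diff_distrib)
qed

section \<open>Ternary forms\<close>

definition mon :: "nat \<Rightarrow> nat \<Rightarrow> nat \<Rightarrow> 3 \<Rightarrow>\<^sub>0 nat" where
  "mon a b c = Poly_Mapping.single 0 a + Poly_Mapping.single 1 b + Poly_Mapping.single 2 c"

lemma neq_3 [simp]: "(0::3) \<noteq> 1" "(1::3) \<noteq> 0" "(0::3) \<noteq> 2" "(2::3) \<noteq> 0" "(1::3) \<noteq> 2" "(2::3) \<noteq> 1"
  by simp_all

lemma lookup_mon [simp]:
  "Poly_Mapping.lookup (mon a b c) 0 = a" "Poly_Mapping.lookup (mon a b c) 1 = b"
  "Poly_Mapping.lookup (mon a b c) 2 = c"
  by (simp_all add: mon_def lookup_add lookup_single)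

lemma weight_UNIV_3: "weight UNIV (m :: 3 \<Rightarrow>\<^sub>0 nat) =
    Poly_Mapping.lookup m 0 + Poly_Mapping.lookup m 1 + Poly_Mapping.lookup m 2"
  by (simp add: weight_def sum_3)

lemma mon_cases: "m = mon (Poly_Mapping.lookup m 0) (Poly_Mapping.lookup m 1) (Poly_Mapping.lookup m 2)"
proof (rule poly_mapping_eqI)
  fix i :: 3
  show "Poly_Mapping.lookup m i = Poly_Mapping.lookup
      (mon (Poly_Mapping.lookup m 0) (Poly_Mapping.lookup m 1) (Poly_Mapping.lookup m 2)) i"
    using exhaust_3[of i] by (elim disjE) simp_all
qed

lemma mon_eq_iff: "mon a b c = m \<longleftrightarrow>
    a = Poly_Mapping.lookup m 0 \<and> b = Poly_Mapping.lookup m 1 \<and> c = Poly_Mapping.lookup m 2"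
  by (metis mon_cases lookup_mon)

lemma single_mon: "Poly_Mapping.single (mon a b c) r = cst r * var 0 ^ a * var 1 ^ b * var 2 ^ c"
  for r :: "'a::comm_ring_1"
  by (simp add: mon_def cst_def mult_single flip: single_var_power)

lemma forms_expand:
  fixes p :: "(3, 'a::comm_ring_1) mpoly"
  assumes "p \<in> forms n"
  shows "p = (\<Sum>i\<le>n. hev i (\<lambda>j. cst (Poly_Mapping.lookup p (mon j (i - j) (n - i)))) (var 0) (var 1) * var 2 ^ (n - i))"
proof (rule poly_mapping_eqI)
  fix m
  have "Poly_Mapping.lookup (\<Sum>i\<le>n. hev i (\<lambda>j. cst (Poly_Mapping.lookup p (mon j (i - j) (n - i)))) (var 0) (var 1) * var 2 ^ (n - i)) m
     = (\<Sum>i\<le>n. \<Sum>j\<le>i. Poly_Mapping.lookup p m when mon j (i - j) (n - i) = m)"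
    by (simp add: hev_def sum_distrib_right lookup_sum lookup_single flip: single_mon)
      (auto simp: when_def intro!: sum.cong)
  also have "\<dots> = Poly_Mapping.lookup p m"
  proof (cases "weight UNIV m = n")
    case True
    let ?a = "Poly_Mapping.lookup m 0" and ?b = "Poly_Mapping.lookup m 1"
    have *: "mon j (i - j) (n - i) = m \<longleftrightarrow> i = ?a + ?b \<and> j = ?a" if "i \<le> n" "j \<le> i" for i j
      using that True by (auto simp: mon_eq_iff weight_UNIV_3)
    have "(\<Sum>i\<le>n. \<Sum>j\<le>i. Poly_Mapping.lookup p m when mon j (i - j) (n - i) = m)
       = (\<Sum>i\<le>n. if i = ?a + ?b then \<Sum>j\<le>i. if j = ?a then Poly_Mapping.lookup p m else 0 else 0)"
      by (intro sum.cong refl) (auto simp: * when_def intro!: sum.cong sum.neutral)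
    also have "\<dots> = Poly_Mapping.lookup p m"
      using True by (simp add: weight_UNIV_3)
    finally show ?thesis .
  next
    case False
    then have "Poly_Mapping.lookup p m = 0"
      using assms by (auto simp: forms_def tdeg_weight in_keys_iff)
    then show ?thesis by simp
  qed
  finally show "Poly_Mapping.lookup p m = Poly_Mapping.lookup (\<Sum>i\<le>n.
      hev i (\<lambda>j. cst (Poly_Mapping.lookup p (mon j (i - j) (n - i)))) (var 0) (var 1) * var 2 ^ (n - i)) m"
    by simp
qed

definition zdeg :: "(3, 'a::idom) mpoly \<Rightarrow> nat" where
  "zdeg p = Polynomial.degree (grade {2} p)"

lemma zdeg_cst [simp]: "zdeg (cst c) = 0"
  by (simp add: zdeg_def grade_cst)

lemma var_neq_0 [simp]: "var v \<noteq> (0 :: ('v, 'a::comm_ring_1) mpoly)"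
  by (metis lookup_single_eq lookup_zero var_def zero_neq_one)

lemma zdeg_var: "zdeg (var i) = (if i = 2 then 1 else 0)"
  by (simp add: zdeg_def grade_var degree_monom_eq)

lemma zdeg_mult: "p \<noteq> 0 \<Longrightarrow> q \<noteq> 0 \<Longrightarrow> zdeg (p * q) = zdeg p + zdeg q"
  by (simp add: zdeg_def grade.mult degree_mult_eq)

lemma zdeg_0 [simp]: "zdeg 0 = 0"
  by (simp add: zdeg_def grade.zero)

lemma zdeg_mult_le: "zdeg p \<le> a \<Longrightarrow> zdeg q \<le> b \<Longrightarrow> zdeg (p * q) \<le> a + b"
  by (cases "p = 0 \<or> q = 0") (auto simp: zdeg_mult)

lemma zdeg_add_le: "zdeg p \<le> n \<Longrightarrow> zdeg q \<le> n \<Longrightarrow> zdeg (p + q) \<le> n"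
  by (simp add: zdeg_def grade.add degree_add_le)

lemma zdeg_diff_le: "zdeg p \<le> n \<Longrightarrow> zdeg q \<le> n \<Longrightarrow> zdeg (p - q) \<le> n"
  by (simp add: zdeg_def grade.diff degree_diff_le)

lemma zdeg_sum_le: "(\<And>i. i \<in> A \<Longrightarrow> zdeg (f i) \<le> n) \<Longrightarrow> zdeg (sum f A) \<le> n"
  by (induction A rule: infinite_finite_induct) (auto intro: zdeg_add_le)

lemma zdeg_free_mult: "zdeg p = 0 \<Longrightarrow> zdeg q = 0 \<Longrightarrow> zdeg (p * q) = 0"
  using zdeg_mult_le[of p 0 q 0] by simp

lemma zdeg_free_power: "zdeg p = 0 \<Longrightarrow> zdeg (p ^ n) = 0"
  by (induction n) (auto intro: zdeg_free_mult simp flip: cst.one)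

lemma zdeg_hev: "zdeg (hev n (\<lambda>j. cst (c j)) (var 0) (var 1)) = 0"
proof -
  have "zdeg (hev n (\<lambda>j. cst (c j)) (var 0) (var 1)) \<le> 0" unfolding hev_def
    by (intro zdeg_sum_le) (simp add: zdeg_free_mult zdeg_free_power zdeg_var)
  then show ?thesis by simp
qed

lemma hev_forms: "hev n (\<lambda>j. cst (c j)) (var 0) (var 1) \<in> (forms n :: (3, 'a::comm_ring_1) mpoly set)"
proof -
  have "cst (c i) * var 0 ^ i * var 1 ^ (n - i) \<in> (forms n :: (3, 'a) mpoly set)" if "i \<le> n" for i
    using forms_mult[OF forms_cst_mult[OF forms_power[OF forms_var[of 0], of i], of "c i"]
      forms_power[OF forms_var[of 1], of "n - i"]] that by simp
  then show ?thesis unfolding hev_def by (intro forms_sum) simp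
qed

lemma lookup_zdeg: "zdeg p < Poly_Mapping.lookup m 2 \<Longrightarrow> Poly_Mapping.lookup p m = 0"
  using lookup_coeff_grade[of "{2}" p "Poly_Mapping.lookup m 2" m]
  by (simp add: weight_def zdeg_def coeff_eq_0)

lemma binary_form:
  fixes p :: "(3, 'a::idom) mpoly"
  assumes "p \<in> forms n" "zdeg p = 0"
  obtains c where "p = hev n (\<lambda>j. cst (c j)) (var 0) (var 1)"
proof -
  let ?h = "\<lambda>i. hev i (\<lambda>j. cst (Poly_Mapping.lookup p (mon j (i - j) (n - i)))) (var 0) (var 1) * var 2 ^ (n - i) :: (3, 'a) mpoly"
  have "?h i = 0" if "i < n" for i
    using that assms(2) by (simp add: hev_def lookup_zdeg cst.zero)
  then have "(\<Sum>i\<le>n. ?h i) = ?h n"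
    by (intro sum.remove[THEN trans, of _ n]) auto
  with forms_expand[OF assms(1)] that show ?thesis by simp
qed

lemma forms_zdeg_1:
  fixes p :: "(3, 'a::idom) mpoly"
  assumes "p \<in> forms (Suc n)" "zdeg p \<le> 1"
  obtains a b where "p = var 2 * hev n (\<lambda>j. cst (a j)) (var 0) (var 1) + hev (Suc n) (\<lambda>j. cst (b j)) (var 0) (var 1)"
proof -
  let ?h = "\<lambda>i. hev i (\<lambda>j. cst (Poly_Mapping.lookup p (mon j (i - j) (Suc n - i)))) (var 0) (var 1) * var 2 ^ (Suc n - i) :: (3, 'a) mpoly"
  have "?h i = 0" if "i < n" for i
    using that assms(2) by (simp add: hev_def lookup_zdeg cst.zero)
  then have "(\<Sum>i<n. ?h i) = 0" by simp
  moreover have "{..Suc n} = insert (Suc n) (insert n {..<n})" by auto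
  ultimately have "(\<Sum>i\<le>Suc n. ?h i) = ?h (Suc n) + ?h n" by simp
  with forms_expand[OF assms(1)] show ?thesis
    by (intro that[of "\<lambda>j. Poly_Mapping.lookup p (mon j (n - j) 1)"
         "\<lambda>j. Poly_Mapping.lookup p (mon j (Suc n - j) 0)"]) (simp add: ac_simps)
qed

lemma linear_form_3:
  fixes p :: "(3, 'a::comm_ring_1) mpoly"
  assumes "p \<in> forms 1"
  obtains a where "p = (\<Sum>i\<in>UNIV. cst (a i) * var i)"
proof -
  let ?a = "\<lambda>i. Poly_Mapping.lookup p (Poly_Mapping.single i 1)"
  have "p = (\<Sum>i\<in>UNIV. cst (?a i) * var i)"
    by (subst forms_expand[OF assms])
      (simp add: sum_3 hev_Suc mon_def numeral_2_eq_2[symmetric] algebra_simps)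
  then show ?thesis by (rule that)
qed

lemma linear_form_coeff:
  fixes a b :: "'v::finite \<Rightarrow> 'a::comm_ring_1"
  assumes "(\<Sum>i\<in>UNIV. cst (a i) * var i) = (\<Sum>i\<in>UNIV. cst (b i) * var i)"
  shows "a i = b i"
proof -
  interpret ring_map "subst id (\<lambda>j. if j = i then 1 else 0 :: 'a)" by (rule subst_id_map)
  from arg_cong[OF assms, of "subst id (\<lambda>j. if j = i then 1 else 0 :: 'a)"] show ?thesis
    by (simp add: maps if_distrib sum.delta cong: if_cong)
qed

lemma subst_forms_scale:
  fixes p :: "('v::finite, 'a::comm_ring_1) mpoly"
  assumes "p \<in> forms n"
  shows "subst cst (\<lambda>i. a * g i) p = a ^ n * subst cst g p"
proof -
  have "mon_eval (\<lambda>i. a * g i) m = a ^ weight UNIV m * mon_eval g m" for m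
    by (simp add: mon_eval_superset[of UNIV] weight_def power_mult_distrib prod.distrib power_sum)
  then show ?thesis using assms
    by (auto simp: subst_alt forms_def tdeg_weight sum_distrib_left ac_simps intro!: sum.cong)
qed

lemma subst_zfree:
  assumes "\<And>i. zdeg (F i) = 0" shows "zdeg (subst cst F p) = 0"
proof -
  interpret ring_map "subst cst F" by (rule subst_cst_map)
  have "zdeg (subst cst F p) \<le> 0"
  proof (induction p rule: mpoly_induct)
    case (mult p q)
    then show ?case using zdeg_mult_le[of "subst cst F p" 0 "subst cst F q" 0] by (simp add: maps)
  qed (use assms in \<open>auto simp: maps intro!: zdeg_add_le[of _ 0, simplified]\<close>)
  then show ?thesis by simp
qed

section \<open>The linear syzygy\<close>

text \<open>
  A birational map with inverse \<open>G\<close>, given by forms of degree \<open>n + 1\<close> whose multiplicity at the vertex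
  \<open>(0 : 0 : 1)\<close> is at least \<open>n\<close>; this multiplicity is expressed as degree at most 1 in \<open>z\<close>.
\<close>

locale monoidal_map =
  fixes F G :: "3 \<Rightarrow> (3, 'k::field) mpoly" and n e :: nat and D E :: "(3, 'k) mpoly"
  assumes F_forms: "F i \<in> forms (Suc n)" and F_zdeg: "zdeg (F i) \<le> 1"
    and G_forms: "G i \<in> forms e" and nz: "D \<noteq> 0" "E \<noteq> 0"
    and GF: "subst cst F (G i) = D * var i" and FG: "subst cst G (F i) = E * var i"
begin

text \<open>
  If all \<open>F i\<close> were free of \<open>z\<close>, so would be \<open>subst cst F (G 2) = D * var 2\<close>.
\<close>

lemma depends_on_z: "\<exists>i. zdeg (F i) \<noteq> 0"
proof (rule ccontr)
  assume "\<nexists>i. zdeg (F i) \<noteq> 0"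
  then have "zdeg (D * var 2) = 0" using subst_zfree[of F "G 2"] by (simp add: GF)
  then show False by (simp add: zdeg_mult nz zdeg_var)
qed

text \<open>
  A map parallel to a nonzero \<open>A\<close> over \<open>k[x,y]\<close> contracts the lines through the vertex and is not
  birational: the homogeneous forms \<open>G\<close> take parallel values on parallel vectors, so the ratio of \<open>x\<close>
  and \<open>z\<close> would be a quotient of elements of \<open>k[x,y]\<close>.
\<close>

lemma direction_nonconstant:
  assumes A: "\<And>i. zdeg (A i) = 0" and par: "\<And>i j. A i * F j = F i * A j"
  shows "A i = 0"
proof (rule ccontr)
  assume i: "A i \<noteq> 0"
  interpret sA: ring_map "subst cst A" by (rule subst_cst_map)
  have *: "A i ^ e * (D * var j) = F i ^ e * subst cst A (G j)" for j
    unfolding GF[symmetric] subst_forms_scale[OF G_forms, symmetric] par ..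
  have "F i \<noteq> 0"
    using i par[of i] depends_on_z by (metis mult_eq_0_iff zdeg_0)
  have "F i ^ e * (var 0 * subst cst A (G 2)) = F i ^ e * (var 2 * subst cst A (G 0))"
    unfolding mult.left_commute[of "F i ^ e"] *[symmetric] by (simp add: ac_simps)
  with \<open>F i \<noteq> 0\<close> have eq: "var 0 * subst cst A (G 2) = var 2 * subst cst A (G 0)" by simp
  have "A i ^ e * (D * var 0) \<noteq> 0" using i nz by simp
  then have "subst cst A (G 0) \<noteq> 0" using *[of 0] by auto
  then have "zdeg (var 2 * subst cst A (G 0)) = Suc 0"
    by (simp add: zdeg_mult zdeg_var subst_zfree A)
  moreover have "zdeg (var 0 * subst cst A (G 2)) = 0"
    by (rule zdeg_free_mult) (simp_all add: zdeg_var subst_zfree A)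
  ultimately show False using eq by simp
qed

definition binary_syzygy :: "nat \<Rightarrow> (3 \<Rightarrow> (3, 'k) mpoly) \<Rightarrow> bool" where
  "binary_syzygy l C \<longleftrightarrow> (\<forall>i. C i \<in> forms l \<and> zdeg (C i) = 0) \<and> (\<exists>i. C i \<noteq> 0) \<and> (\<Sum>i\<in>UNIV. C i * F i) = 0"

text \<open>
  For \<open>F = z A + B\<close> the cross product of \<open>A\<close> and \<open>B\<close> is orthogonal to \<open>F\<close>. It is not zero, as
  otherwise \<open>F\<close> would be parallel to \<open>A\<close>.
\<close>

lemma ex_binary_syzygy: "\<exists>l C. binary_syzygy l C"
proof -
  have "\<exists>a b. F i = var 2 * hev n (\<lambda>j. cst (a j)) (var 0) (var 1) + hev (Suc n) (\<lambda>j. cst (b j)) (var 0) (var 1)" for i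
    using forms_zdeg_1[OF F_forms F_zdeg] by metis
  then obtain a b where ab: "\<And>i. F i = var 2 * hev n (\<lambda>j. cst (a i j)) (var 0) (var 1) + hev (Suc n) (\<lambda>j. cst (b i j)) (var 0) (var 1)"
    by metis
  define A where "A i = hev n (\<lambda>j. cst (a i j)) (var 0) (var 1 :: (3, 'k) mpoly)" for i
  define B where "B i = hev (Suc n) (\<lambda>j. cst (b i j)) (var 0) (var 1 :: (3, 'k) mpoly)" for i
  have F: "F i = var 2 * A i + B i" for i by (simp add: ab A_def B_def)
  have A: "A i \<in> forms n" "zdeg (A i) = 0" and B: "B i \<in> forms (Suc n)" "zdeg (B i) = 0" for i
    by (simp_all add: A_def B_def hev_forms zdeg_hev)
  have "\<exists>i j. A i * B j \<noteq> A j * B i"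
  proof (rule ccontr)
    assume "\<nexists>i j. A i * B j \<noteq> A j * B i"
    then have "A i * F j = F i * A j" for i j by (simp add: F algebra_simps)
    then have "A i = 0" for i by (rule direction_nonconstant[OF A(2)])
    then show False using depends_on_z by (simp add: F B)
  qed
  define C :: "3 \<Rightarrow> (3, 'k) mpoly" where "C i =
    (if i = 0 then A 1 * B 2 - A 2 * B 1 else if i = 1 then A 2 * B 0 - A 0 * B 2 else A 0 * B 1 - A 1 * B 0)" for i
  have "binary_syzygy (n + Suc n) C" unfolding binary_syzygy_def
  proof (intro conjI allI)
    show "C i \<in> forms (n + Suc n)" for i
      unfolding C_def by (simp only: forms_diff[OF forms_mult forms_mult] A B split: if_split) simp
    have "zdeg (C i) \<le> 0" for i
      unfolding C_def by (simp only: zdeg_diff_le zdeg_free_mult A B order_refl split: if_split) simp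
    then show "zdeg (C i) = 0" for i by simp
    show "\<exists>i. C i \<noteq> 0"
    proof (rule ccontr)
      assume "\<nexists>i. C i \<noteq> 0"
      then have "C 0 = 0" "C 1 = 0" "C 2 = 0" by auto
      then have "A i * B j = A j * B i" for i j
        using exhaust_3[of i] exhaust_3[of j] by (elim disjE) (simp_all add: C_def)
      with \<open>\<exists>i j. A i * B j \<noteq> A j * B i\<close> show False by blast
    qed
    show "(\<Sum>i\<in>UNIV. C i * F i) = 0"
      by (simp add: sum_3 C_def F algebra_simps)
  qed
  then show ?thesis by blast
qed

lemma binary_syzygy_cancel:
  assumes "binary_syzygy l C" "\<And>i. C i = M * C' i" "\<And>i. C' i \<in> forms l'" "\<And>i. zdeg (C' i) = 0"
  shows "binary_syzygy l' C'"
proof -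
  obtain i where "C i \<noteq> 0" "(\<Sum>i\<in>UNIV. C i * F i) = 0" using assms(1) by (auto simp: binary_syzygy_def)
  moreover have "(\<Sum>i\<in>UNIV. C i * F i) = M * (\<Sum>i\<in>UNIV. C' i * F i)"
    by (simp add: assms(2) sum_distrib_left mult.assoc)
  ultimately show ?thesis using assms(2)[of i] assms(3,4) by (auto simp: binary_syzygy_def)
qed

lemma G_nz: "G i \<noteq> 0"
proof
  interpret sF: ring_map "subst cst F" by (rule subst_cst_map)
  assume "G i = 0"
  then show False using GF[of i] nz by (simp add: sF.zero)
qed

text \<open>
  Let \<open>C\<close> be a syzygy over \<open>k[x,y]\<close> of least degree \<open>l\<close>, and let \<open>\<Lambda> j\<close> be the linear form that collects
  the \<open>j\<close>-th coefficients of the three binary forms \<open>C i\<close>. Substituting \<open>G\<close> in the syzygy and dividing by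
  \<open>E\<close> shows that the binary form with coefficients \<open>\<Lambda> j\<close> vanishes at \<open>(G\<^sub>0, G\<^sub>1)\<close>, hence at \<open>(s, t)\<close>, the
  same point with common factors removed. By \<open>hev_root\<close>, \<open>\<Lambda> j = t \<nu>\<^sub>j - s \<nu>\<^sub>j\<^sub>+\<^sub>1\<close>, and since \<open>\<Lambda> j\<close> is
  linear, only one homogeneous component of the \<open>\<nu>\<^sub>j\<close> matters and \<open>s\<close>, \<open>t\<close> have degree at most 1. If they
  were constants, a linear form would split off from \<open>C\<close>, contradicting the choice of \<open>l\<close>. So
  \<open>t = \<Sum> u\<^sub>i x\<^sub>i\<close> and \<open>s = \<Sum> v\<^sub>i x\<^sub>i\<close>, the \<open>\<nu>\<^sub>j\<close> may be taken constant, and \<open>C\<close> is a multiple of the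
  vector with entries \<open>u\<^sub>i x - v\<^sub>i y\<close>, which is therefore a syzygy itself. The first conclusion says
  that \<open>u\<close> and \<open>v\<close> are linearly independent; this holds because \<open>s\<close> and \<open>t\<close> are coprime.
\<close>

theorem linear_syzygy:
  obtains u v where "\<forall>a b. (\<forall>i. a * u i + b * v i = 0) \<longrightarrow> a = 0 \<and> b = 0"
    "(\<Sum>i\<in>UNIV. (cst (u i) * var 0 - cst (v i) * var 1) * F i) = 0"
proof -
  interpret sG: ring_map "subst cst G" by (rule subst_cst_map)
  define l where "l = (LEAST l. \<exists>C. binary_syzygy l C)"
  obtain C where C: "binary_syzygy l C"
    using LeastI_ex[OF ex_binary_syzygy] unfolding l_def by blast
  have least: "l \<le> l'" if "binary_syzygy l' C'" for l' C'
    unfolding l_def by (rule Least_le) (use that in blast)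
  have "\<exists>c. C i = hev l (\<lambda>j. cst (c j)) (var 0) (var 1)" for i
    using binary_form[of "C i" l] C by (auto simp: binary_syzygy_def)
  then obtain c where c: "\<And>i. C i = hev l (\<lambda>j. cst (c i j)) (var 0) (var 1)" by metis
  have c_nz: "\<exists>i j. j \<le> l \<and> c i j \<noteq> 0"
  proof (rule ccontr)
    assume "\<nexists>i j. j \<le> l \<and> c i j \<noteq> 0"
    then have "C i = 0" for i by (simp add: c hev_def cst.zero)
    with C show False by (simp add: binary_syzygy_def)
  qed
  define \<Lambda> :: "nat \<Rightarrow> (3, 'k) mpoly" where "\<Lambda> j = (\<Sum>i\<in>UNIV. cst (c i j) * var i)" for j
  have \<Lambda>_forms: "\<Lambda> j \<in> forms 1" for j
    unfolding \<Lambda>_def by (intro forms_sum forms_cst_mult forms_var)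
  have "subst cst G (\<Sum>i\<in>UNIV. C i * F i) = E * hev l \<Lambda> (G 0) (G 1)"
  proof -
    have "hev l \<Lambda> a b = (\<Sum>i\<in>UNIV. hev l (\<lambda>j. cst (c i j)) a b * var i)" for a b
      unfolding hev_def \<Lambda>_def sum_distrib_right by (subst sum.swap) (simp add: ac_simps)
    then show ?thesis by (simp add: sG.maps sG.map_hev FG c sum_distrib_left ac_simps)
  qed
  \<comment> \<open>The inverse map satisfies a binary relation with linear coefficients.\<close>
  then have root: "hev l \<Lambda> (G 0) (G 1) = 0"
    using C nz by (simp add: binary_syzygy_def sG.zero)
  obtain g t s where g: "G 1 = g * t" "G 0 = g * s" and cop: "\<And>r. t dvd r * s \<Longrightarrow> t dvd r"
    using split_common_factor[OF G_nz[of 1]] by metis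
  have nz': "g \<noteq> 0" "t \<noteq> 0" "s \<noteq> 0" using G_nz[of 0] G_nz[of 1] g by auto
  obtain i0 where "g \<in> forms i0" "t \<in> forms (e - i0)"
    using forms_factor[of g t e] G_forms[of 1] G_nz[of 1] g by metis
  moreover obtain i1 where "g \<in> forms i1" "s \<in> forms (e - i1)"
    using forms_factor[of g s e] G_forms[of 0] G_nz[of 0] g by metis
  ultimately obtain k where k: "t \<in> forms k" "s \<in> forms k"
    using forms_unique nz' by metis
  have "hev l \<Lambda> s t = 0"
    using root nz' unfolding g by (simp add: hev_scale)
  from hev_root[OF this nz'(2) cop] obtain \<nu> where
    \<nu>: "\<nu> 0 = 0" "\<nu> (Suc l) = 0" "\<And>j. j \<le> l \<Longrightarrow> \<Lambda> j = t * \<nu> j - s * \<nu> (Suc j)"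
    by metis
  have \<Lambda>_eq: "\<Lambda> j = (if k \<le> 1 then t * hcomp (1 - k) (\<nu> j) - s * hcomp (1 - k) (\<nu> (Suc j)) else 0)"
    if "j \<le> l" for j
    using arg_cong[OF \<nu>(3)[OF that], of "hcomp 1"] hcomp_of_forms[OF \<Lambda>_forms, of 1 j]
    by (simp add: hcomp_diff hcomp_mult_forms[OF k(1)] hcomp_mult_forms[OF k(2)] split: if_splits)
  have \<Lambda>_nz: "\<exists>j\<le>l. \<Lambda> j \<noteq> 0"
  proof -
    obtain i j where "j \<le> l" "c i j \<noteq> 0" using c_nz by blast
    then show ?thesis using linear_form_coeff[of "\<lambda>i. c i j" "\<lambda>_. 0" i] by (auto simp: \<Lambda>_def cst.zero)
  qed
  then have "k \<le> 1" using \<Lambda>_eq by metis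
  have "l \<noteq> 0"
  proof
    assume "l = 0"
    then show False using \<Lambda>_nz \<nu>(3)[of 0] \<nu>(1,2) by simp
  qed
  then obtain l' where l': "l = Suc l'" by (cases l) auto
  \<comment> \<open>Constants \<open>s\<close> and \<open>t\<close> give a syzygy of smaller degree.\<close>
  have "k \<noteq> 0"
  proof
    assume "k = 0"
    then obtain \<tau> \<sigma> where st: "t = cst \<tau>" "s = cst \<sigma>" using forms_0_eq k by metis
    have "\<exists>b. hcomp 1 (\<nu> j) = (\<Sum>i\<in>UNIV. cst (b i) * var i)" for j
      using linear_form_3[OF hcomp_forms] by metis
    then obtain b where b: "\<And>j. hcomp 1 (\<nu> j) = (\<Sum>i\<in>UNIV. cst (b j i) * var i)" by metis
    have b0: "b 0 i = 0" "b (Suc l) i = 0" for i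
      using linear_form_coeff[of "b 0" "\<lambda>_. 0" i] linear_form_coeff[of "b (Suc l)" "\<lambda>_. 0" i] \<nu>(1,2) b[of 0] b[of "Suc l"]
      by (simp_all add: hcomp_0 cst.zero)
    have cb: "c i j = \<tau> * b j i - \<sigma> * b (Suc j) i" if "j \<le> l" for i j
    proof (rule linear_form_coeff)
      show "(\<Sum>i\<in>UNIV. cst (c i j) * var i) = (\<Sum>i\<in>UNIV. cst (\<tau> * b j i - \<sigma> * b (Suc j) i) * var i)"
        using \<Lambda>_eq[OF that] \<open>k = 0\<close>
        by (simp add: \<Lambda>_def b[unfolded One_nat_def] st cst.maps sum_distrib_left sum_subtractf left_diff_distrib mult.assoc)
    qed
    define C' where "C' i = hev l' (\<lambda>j. cst (b (Suc j) i)) (var 0) (var 1 :: (3, 'k) mpoly)" for i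
    have "C i = (cst \<tau> * var 0 - cst \<sigma> * var 1) * C' i" for i
    proof -
      have "C i = hev (Suc l') (\<lambda>j. cst \<tau> * cst (b j i) - cst \<sigma> * cst (b (Suc j) i)) (var 0) (var 1)"
        unfolding c l' by (rule hev_cong) (simp add: cb l' cst.maps)
      also have "\<dots> = (cst \<tau> * var 0 - cst \<sigma> * var 1) * C' i"
        unfolding C'_def by (rule hev_factor) (use b0 l' in \<open>simp_all add: cst.zero\<close>)
      finally show ?thesis .
    qed
    then have "binary_syzygy l' C'"
      by (rule binary_syzygy_cancel[OF C]) (simp_all add: C'_def hev_forms zdeg_hev)
    then show False using least l' by fastforce
  qed
  with \<open>k \<le> 1\<close> have "k = 1" by simp
  obtain u where u: "t = (\<Sum>i\<in>UNIV. cst (u i) * var i)" using linear_form_3[of t] k \<open>k = 1\<close> by metis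
  obtain v where v: "s = (\<Sum>i\<in>UNIV. cst (v i) * var i)" using linear_form_3[of s] k \<open>k = 1\<close> by metis
  show ?thesis
  proof (rule that)
    have "a = 0 \<and> b = 0" if ab: "\<forall>i. a * u i + b * v i = 0" for a b
    proof -
    have "cst a * t + cst b * s = (\<Sum>i\<in>UNIV. cst (a * u i + b * v i) * var i)"
      by (simp add: u v sum_distrib_left sum.distrib cst.maps algebra_simps)
    then have ts: "cst a * t + cst b * s = 0" by (simp add: ab cst.zero)
    have "b = 0"
    proof (rule ccontr)
      assume "b \<noteq> 0"
      have "s = cst (inverse b) * (cst b * s)"
        using \<open>b \<noteq> 0\<close> by (simp flip: mult.assoc cst.mult add: cst.one)
      also have "cst b * s = t * - cst a" using ts by (simp add: add_eq_0_iff2 mult.commute)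
      finally have "t dvd s" by (simp add: mult.left_commute[of _ t])
      then have "t dvd 1 * s" by simp
      then have "t dvd 1" by (rule cop)
      then obtain w where "t * w = 1" by (metis dvdE)
      then have "t * w \<in> forms 0" using forms_cst[of "1::'k"] by (simp add: cst.one)
      moreover have "t * w \<noteq> 0" using \<open>t * w = 1\<close> by simp
      ultimately obtain i where "i \<le> 0" "t \<in> forms i" by (rule forms_factor)
      then have "t \<in> forms 0" by simp
      then have "0 = k" by (rule forms_unique[OF _ k(1) nz'(2)])
      with \<open>k = 1\<close> show False by simp
    qed
    moreover have "a = 0" using ts \<open>b = 0\<close> nz' by (simp add: cst.zero)
    ultimately show "a = 0 \<and> b = 0" by simp
    qed
    then show "\<forall>a b. (\<forall>i. a * u i + b * v i = 0) \<longrightarrow> a = 0 \<and> b = 0" by blast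
  next
    have "\<exists>b. hcomp 0 (\<nu> j) = cst b" for j using forms_0_eq[OF hcomp_forms] by metis
    then obtain b where b: "\<And>j. hcomp 0 (\<nu> j) = cst (b j)" by metis
    have b0: "b 0 = 0" "b (Suc l) = 0" using b[of 0] b[of "Suc l"] \<nu>(1,2) by (simp_all add: hcomp_0)
    have cb: "c i j = u i * b j - v i * b (Suc j)" if "j \<le> l" for i j
    proof (rule linear_form_coeff)
      show "(\<Sum>i\<in>UNIV. cst (c i j) * var i) = (\<Sum>i\<in>UNIV. cst (u i * b j - v i * b (Suc j)) * var i)"
        using \<Lambda>_eq[OF that] \<open>k = 1\<close>
        by (simp add: \<Lambda>_def b u v cst.maps sum_distrib_left sum_subtractf right_diff_distrib ac_simps)
    qed
    define M where "M = hev l' (\<lambda>j. cst (b (Suc j))) (var 0) (var 1 :: (3, 'k) mpoly)"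
    define L where "L i = cst (u i) * var 0 - cst (v i) * (var 1 :: (3, 'k) mpoly)" for i :: 3
    have CL: "C i = M * L i" for i
    proof -
      have "C i = hev (Suc l') (\<lambda>j. cst (u i) * cst (b j) - cst (v i) * cst (b (Suc j))) (var 0) (var 1)"
        unfolding c l' by (rule hev_cong) (simp add: cb l' cst.maps)
      also have "\<dots> = (cst (u i) * var 0 - cst (v i) * var 1) * M"
        unfolding M_def by (rule hev_factor) (use b0 l' in \<open>simp_all add: cst.zero\<close>)
      finally show ?thesis by (simp add: mult.commute L_def)
    qed
    have "binary_syzygy 1 L"
      by (rule binary_syzygy_cancel[OF C CL])
        (auto simp: L_def zdeg_free_mult zdeg_var intro!: forms_diff forms_cst_mult forms_var[unfolded One_nat_def] le_antisym[OF zdeg_diff_le])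
    then show "(\<Sum>i\<in>UNIV. (cst (u i) * var 0 - cst (v i) * var 1) * F i) = 0"
      by (simp add: binary_syzygy_def L_def)
  qed
qed

end

section \<open>Ideals of a ring type\<close>

text \<open>
  Ideals of a ring that is a whole type; \<open>ideal_type_iff\<close> relates them to ideals of the ring record.
\<close>

definition is_ideal :: "'a::comm_ring_1 set \<Rightarrow> bool" where
  "is_ideal I \<longleftrightarrow> 0 \<in> I \<and> (\<forall>a\<in>I. \<forall>b\<in>I. a + b \<in> I) \<and> (\<forall>r. \<forall>a\<in>I. r * a \<in> I)"

lemma is_ideal_add: "is_ideal I \<Longrightarrow> a \<in> I \<Longrightarrow> b \<in> I \<Longrightarrow> a + b \<in> I"
  and is_ideal_mult: "is_ideal I \<Longrightarrow> a \<in> I \<Longrightarrow> r * a \<in> I"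
  and is_ideal_0: "is_ideal I \<Longrightarrow> 0 \<in> I"
  by (auto simp: is_ideal_def)

lemma is_ideal_mult2: "is_ideal I \<Longrightarrow> a \<in> I \<Longrightarrow> a * r \<in> I"
  using is_ideal_mult[of I a r] by (simp add: mult.commute)

lemma is_ideal_uminus: "is_ideal I \<Longrightarrow> a \<in> I \<Longrightarrow> - a \<in> I"
  using is_ideal_mult[of I a "- 1"] by simp

lemma is_ideal_diff: "is_ideal I \<Longrightarrow> a \<in> I \<Longrightarrow> b \<in> I \<Longrightarrow> a - b \<in> I"
  using is_ideal_add[of I a "- b"] by (simp add: is_ideal_uminus)

lemma is_ideal_sum: "is_ideal I \<Longrightarrow> (\<And>x. x \<in> A \<Longrightarrow> f x \<in> I) \<Longrightarrow> sum f A \<in> I"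
  by (induction A rule: infinite_finite_induct) (auto simp: is_ideal_0 is_ideal_add)

lemma type_ring_simps [simp]:
  "carrier ring_of_type_algebra = UNIV" "a \<otimes>\<^bsub>ring_of_type_algebra\<^esub> b = a * b"
  "a \<oplus>\<^bsub>ring_of_type_algebra\<^esub> b = a + b" "\<one>\<^bsub>ring_of_type_algebra\<^esub> = 1" "\<zero>\<^bsub>ring_of_type_algebra\<^esub> = 0"
  by (simp_all add: ring_of_type_algebra_def)

lemma type_ring_cring: "cring (ring_of_type_algebra :: 'a::comm_ring_1 ring)" by (rule cring_from_type_algebra)

lemma type_ring_a_inv [simp]: "\<ominus>\<^bsub>ring_of_type_algebra\<^esub> a = - a" for a :: "'a::comm_ring_1"
proof -
  interpret cring "ring_of_type_algebra :: 'a ring" by (rule type_ring_cring)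
  show ?thesis using minus_equality[of "- a" a] by simp
qed

lemma ideal_type_iff: "ideal I ring_of_type_algebra \<longleftrightarrow> is_ideal I" for I :: "'a::comm_ring_1 set"
proof
  assume "ideal I ring_of_type_algebra"
  then interpret ideal I ring_of_type_algebra .
  show "is_ideal I"
    unfolding is_ideal_def using additive_subgroup.a_closed[OF is_additive_subgroup] I_l_closed
      additive_subgroup.zero_closed[OF is_additive_subgroup] by auto
next
  assume *: "is_ideal I"
  interpret cring "ring_of_type_algebra :: 'a ring" by (rule type_ring_cring)
  have "- a \<in> I" if "a \<in> I" for a
    using * that unfolding is_ideal_def by (metis mult_minus1)
  then have inv: "inv\<^bsub>add_monoid ring_of_type_algebra\<^esub> a \<in> I" if "a \<in> I" for a
    using type_ring_a_inv[of a] that unfolding a_inv_def by simp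
  show "ideal I ring_of_type_algebra"
  proof (intro idealI ring_axioms)
    show "subgroup I (add_monoid ring_of_type_algebra)"
      by (rule subgroup.intro) (use * inv in \<open>auto simp: is_ideal_def\<close>)
    show "x \<otimes>\<^bsub>ring_of_type_algebra\<^esub> a \<in> I" "a \<otimes>\<^bsub>ring_of_type_algebra\<^esub> x \<in> I" if "a \<in> I" for a x
      using that by (simp_all add: is_ideal_mult[OF *] is_ideal_mult2[OF *])
  qed
qed

lemma genideal_type: "Idl\<^bsub>ring_of_type_algebra\<^esub> S = \<Inter>{I. is_ideal I \<and> S \<subseteq> I}" for S :: "'a::comm_ring_1 set"
  by (simp add: genideal_def ideal_type_iff)

lemma is_ideal_genideal: "is_ideal (Idl\<^bsub>ring_of_type_algebra\<^esub> S)" for S :: "'a::comm_ring_1 set"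
  unfolding genideal_type by (auto simp: is_ideal_def)

lemma genideal_type_subset: "S \<subseteq> Idl\<^bsub>ring_of_type_algebra\<^esub> S" for S :: "'a::comm_ring_1 set"
  unfolding genideal_type by auto

lemma genideal_type_minimal: "is_ideal I \<Longrightarrow> S \<subseteq> I \<Longrightarrow> Idl\<^bsub>ring_of_type_algebra\<^esub> S \<subseteq> I" for S :: "'a::comm_ring_1 set"
  unfolding genideal_type by auto

definition ideal3 :: "'a::comm_ring_1 \<Rightarrow> 'a \<Rightarrow> 'a \<Rightarrow> 'a set" where
  "ideal3 a b c = {r * a + s * b + t * c | r s t. True}"

lemma is_ideal_ideal3: "is_ideal (ideal3 a b c)"
  unfolding is_ideal_def
proof (intro conjI ballI allI)
  show "0 \<in> ideal3 a b c" unfolding ideal3_def by (rule CollectI) (metis add_0 mult_zero_left)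
  show "p + q \<in> ideal3 a b c" if pq: "p \<in> ideal3 a b c" "q \<in> ideal3 a b c" for p q
  proof -
    obtain r s t r' s' t' where "p = r * a + s * b + t * c" "q = r' * a + s' * b + t' * c"
      using pq unfolding ideal3_def by blast
    then have "p + q = (r + r') * a + (s + s') * b + (t + t') * c" by (simp add: algebra_simps)
    then show ?thesis unfolding ideal3_def by blast
  qed
  show "r * p \<in> ideal3 a b c" if p: "p \<in> ideal3 a b c" for r p
  proof -
    obtain r' s' t' where "p = r' * a + s' * b + t' * c"
      using p unfolding ideal3_def by blast
    then have "r * p = (r * r') * a + (r * s') * b + (r * t') * c" by (simp add: algebra_simps)
    then show ?thesis unfolding ideal3_def by blast
  qed
qed

lemma ideal3_gens: "a \<in> ideal3 a b c" "b \<in> ideal3 a b c" "c \<in> ideal3 a b c"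
  unfolding ideal3_def by (rule CollectI, metis add_0 add.right_neutral mult_zero_left mult_1)+

lemma genideal_range_3: "Idl\<^bsub>ring_of_type_algebra\<^esub> (range F) = ideal3 (F 0) (F 1) (F 2)"
  for F :: "3 \<Rightarrow> 'a::comm_ring_1"
proof
  have "F i \<in> ideal3 (F 0) (F 1) (F 2)" for i
    using exhaust_3[of i] by (elim disjE) (simp_all only: ideal3_gens)
  then show "Idl\<^bsub>ring_of_type_algebra\<^esub> (range F) \<subseteq> ideal3 (F 0) (F 1) (F 2)"
    by (intro genideal_type_minimal is_ideal_ideal3) auto
  show "ideal3 (F 0) (F 1) (F 2) \<subseteq> Idl\<^bsub>ring_of_type_algebra\<^esub> (range F)"
    using genideal_type_subset[of "range F"] is_ideal_genideal[of "range F"]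
    by (auto simp: ideal3_def intro!: is_ideal_add is_ideal_mult)
qed

section \<open>The normal form\<close>

text \<open>
  Substituting \<open>g v\<close> for the single variable \<open>v\<close> is reduction modulo \<open>var v - g v\<close>.
\<close>

lemma dvd_diff_subst:
  fixes p :: "('v, 'a::comm_ring_1) mpoly"
  assumes "\<And>w. w \<noteq> v \<Longrightarrow> g w = var w"
  shows "(var v - g v) dvd p - subst cst g p"
proof -
  interpret ring_map "subst cst g" by (rule subst_cst_map)
  show ?thesis
  proof (induction p rule: mpoly_induct)
    case (var w)
    then show ?case by (cases "w = v") (simp_all add: assms)
  next
    case (add p q)
    then show ?case using dvd_add[OF add] by (simp add: maps algebra_simps)
  next
    case (mult p q)
    have "p * q - subst cst g (p * q) = p * (q - subst cst g q) + (p - subst cst g p) * subst cst g q"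
      by (simp add: maps algebra_simps)
    with mult show ?case by simp
  qed simp
qed

lemma var_dvd_var_mult:
  fixes p :: "('v::linorder, 'a::idom) mpoly"
  assumes "v \<noteq> w" "var v dvd var w * p"
  shows "var v dvd p"
proof -
  let ?s = "subst cst (var(v := 0)) :: ('v, 'a) mpoly \<Rightarrow> ('v, 'a) mpoly"
  interpret ring_map ?s by (rule subst_cst_map)
  have "?s (var w * p) = 0" using dvd[OF assms(2)] by simp
  then have "?s p = 0" using assms(1) by (simp add: maps)
  with dvd_diff_subst[of v "var(v := 0)" p] show ?thesis by simp
qed

lemma obtain_minor:
  fixes u v :: "3 \<Rightarrow> 'k::field"
  assumes "\<forall>a b. (\<forall>i. a * u i + b * v i = 0) \<longrightarrow> a = 0 \<and> b = 0"
  obtains i j k where "UNIV = {i, j, k}" "i \<noteq> j" "j \<noteq> k" "i \<noteq> k" "u i * v j - u j * v i \<noteq> 0"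
proof -
  obtain i where i: "u i \<noteq> 0" using assms[THEN spec, of 1, THEN spec, of 0] by auto
  have "\<exists>j. u i * v j - u j * v i \<noteq> 0"
  proof (rule ccontr)
    assume "\<nexists>j. u i * v j - u j * v i \<noteq> 0"
    then have "(- v i) * u j + u i * v j = 0" for j by (simp add: algebra_simps)
    with assms i show False by blast
  qed
  then obtain j where j: "u i * v j - u j * v i \<noteq> 0" by blast
  then have "i \<noteq> j" by auto
  have "\<exists>k. k \<noteq> i \<and> k \<noteq> j" by (metis neq_3)
  then obtain k where k: "k \<noteq> i" "k \<noteq> j" by blast
  have "x = i \<or> x = j \<or> x = k" for x
    using exhaust_3[of x] exhaust_3[of i] exhaust_3[of j] exhaust_3[of k] k \<open>i \<noteq> j\<close>
    by (elim disjE) simp_all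
  then have "UNIV = {i, j, k}" by (intro UNIV_eq_I) blast
  from that[OF this \<open>i \<noteq> j\<close> _ _ j] k show ?thesis by blast
qed

context monoidal_map
begin

text \<open>
  The linear syzygy says \<open>x P = y Q\<close> for two independent linear combinations \<open>P\<close> and \<open>Q\<close> of the
  \<open>F l\<close>. Hence \<open>P = y q\<close> and \<open>Q = x q\<close>. A nonzero minor of the coefficient matrix makes it possible to
  express two of the \<open>F l\<close> by \<open>P\<close>, \<open>Q\<close> and the third one, which serves as \<open>f\<close>. A common factor of
  \<open>q\<close> and \<open>f\<close> would divide all \<open>F l\<close>.
\<close>

theorem normal_form:
  assumes coprime: "\<And>h. (\<And>i. h dvd F i) \<Longrightarrow> h dvd 1"
  obtains q f where "q \<in> forms n" "f \<in> forms (Suc n)" "zdeg q \<le> 1" "zdeg f \<le> 1" "q \<noteq> 0"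
    "zdeg q \<noteq> 0 \<or> zdeg f \<noteq> 0" "\<And>h. h dvd q \<Longrightarrow> h dvd f \<Longrightarrow> h dvd 1"
    "ideal3 (F 0) (F 1) (F 2) = ideal3 (var 0 * q) (var 1 * q) f"
proof -
  obtain u v where uv: "\<forall>a b. (\<forall>i. a * u i + b * v i = 0) \<longrightarrow> a = 0 \<and> b = 0"
    "(\<Sum>i\<in>UNIV. (cst (u i) * var 0 - cst (v i) * var 1) * F i) = 0"
    by (rule linear_syzygy)
  obtain i j k where ijk: "UNIV = {i, j, k}" "i \<noteq> j" "j \<noteq> k" "i \<noteq> k" and det: "u i * v j - u j * v i \<noteq> 0"
    by (rule obtain_minor[OF uv(1)])
  have cases3: "l = i \<or> l = j \<or> l = k" for l
    using UNIV_I[of l] unfolding ijk(1) by blast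
  have sum: "(\<Sum>l\<in>UNIV. g l) = g i + g j + g k" for g :: "3 \<Rightarrow> (3, 'k) mpoly"
    unfolding ijk(1) using ijk(2-4) by (simp add: add.assoc)
  define P where "P = (\<Sum>l\<in>UNIV. cst (u l) * F l)"
  define Q where "Q = (\<Sum>l\<in>UNIV. cst (v l) * F l)"
  have PQ: "var 0 * P = var 1 * Q"
  proof -
    have "var 0 * P - var 1 * Q = (\<Sum>i\<in>UNIV. (cst (u i) * var 0 - cst (v i) * var 1) * F i)"
      unfolding P_def Q_def sum_distrib_left sum_subtractf[symmetric]
      by (intro sum.cong refl) (simp add: algebra_simps)
    then show ?thesis using uv(2) by simp
  qed
  have "(var 0 :: (3, 'k) mpoly) dvd Q"
    using var_dvd_var_mult[of 0 1 Q] PQ[symmetric] by simp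
  then obtain q where q: "Q = var 0 * q" by (elim dvdE)
  then have P: "P = var 1 * q" using PQ by (simp add: mult.left_commute)
  let ?f = "F k"
  have Fi: "cst (u i * v j - u j * v i) * F i = cst (v j) * (var 1 * q - cst (u k) * ?f) - cst (u j) * (var 0 * q - cst (v k) * ?f)"
    unfolding P[symmetric] q[symmetric] unfolding P_def Q_def sum by (simp add: cst.maps algebra_simps)
  have Fj: "cst (u i * v j - u j * v i) * F j = cst (u i) * (var 0 * q - cst (v k) * ?f) - cst (v i) * (var 1 * q - cst (u k) * ?f)"
    unfolding P[symmetric] q[symmetric] unfolding P_def Q_def sum by (simp add: cst.maps algebra_simps)
  have solve: "F l = cst (inverse (u i * v j - u j * v i)) * (cst (u i * v j - u j * v i) * F l)" for l
    using det by (simp flip: mult.assoc cst.mult add: cst.one)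
  have mem: "F l \<in> I" if I: "is_ideal I" "var 0 * q \<in> I" "var 1 * q \<in> I" "?f \<in> I" for l I
  proof -
    have "F i \<in> I" by (subst solve, subst Fi) (intro is_ideal_mult is_ideal_diff I)
    moreover have "F j \<in> I" by (subst solve, subst Fj) (intro is_ideal_mult is_ideal_diff I)
    ultimately show ?thesis using cases3[of l] I(4) by auto
  qed
  have common: "h dvd F l" if "h dvd q" "h dvd ?f" for h l
  proof -
    have "is_ideal {p. h dvd p}" by (auto simp: is_ideal_def)
    from mem[OF this] that show ?thesis by simp
  qed
  have PQ_forms: "P \<in> forms (Suc n)" "Q \<in> forms (Suc n)"
    unfolding P_def Q_def by (intro forms_sum forms_cst_mult F_forms)+
  have "zdeg (cst c * F l) \<le> 1" for c l
    using zdeg_mult_le[of "cst c" 0 "F l" 1] F_zdeg by simp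
  then have PQ_zdeg: "zdeg Q \<le> 1" unfolding Q_def by (intro zdeg_sum_le)
  have q_nz: "q \<noteq> 0"
  proof
    assume "q = 0"
    have "F i = cst (inverse (u i * v j - u j * v i) * (u j * v k - v j * u k)) * ?f"
      using \<open>q = 0\<close> by (subst solve, subst Fi) (simp add: cst.maps algebra_simps)
    moreover have "F j = cst (inverse (u i * v j - u j * v i) * (v i * u k - u i * v k)) * ?f"
      using \<open>q = 0\<close> by (subst solve, subst Fj) (simp add: cst.maps algebra_simps)
    ultimately have "?f dvd F l" for l using cases3[of l] by auto
    then have "?f dvd 1" by (rule coprime)
    then obtain w where "?f * w = 1" by (metis dvdE)
    then have w: "?f * w \<in> forms 0" "?f * w \<noteq> 0" using forms_cst[of "1::'k"] by (simp_all add: cst.one)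
    then obtain l where l: "l \<le> 0" "?f \<in> forms l" by (rule forms_factor)
    moreover have "?f \<noteq> 0" using w by auto
    ultimately show False using forms_unique[OF F_forms[of k] l(2)] by simp
  qed
  show ?thesis
  proof (rule that)
    obtain l where "l \<le> Suc n" "var 0 \<in> (forms l :: (3, 'k) mpoly set)" "q \<in> forms (Suc n - l)"
      using forms_factor[of "var 0" q "Suc n"] PQ_forms(2) q_nz unfolding q by auto
    moreover from this(2) have "1 = l" by (rule forms_unique[OF forms_var _ var_neq_0])
    ultimately show "q \<in> forms n" by simp
    show "?f \<in> forms (Suc n)" "zdeg ?f \<le> 1" by (fact F_forms F_zdeg)+
    show "zdeg q \<le> 1" using PQ_zdeg q_nz unfolding q by (simp add: zdeg_mult zdeg_var)
    show "q \<noteq> 0" by fact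
    show "h dvd 1" if "h dvd q" "h dvd ?f" for h by (rule coprime) (rule common[OF that])
    have F_mem: "F l \<in> ideal3 (F 0) (F 1) (F 2)" for l
      using exhaust_3[of l] by (elim disjE) (simp_all only: ideal3_gens)
    have P_mem: "P \<in> ideal3 (F 0) (F 1) (F 2)" "Q \<in> ideal3 (F 0) (F 1) (F 2)"
      unfolding P_def Q_def by (intro is_ideal_sum is_ideal_ideal3 is_ideal_mult F_mem)+
    have le: "ideal3 a b c \<subseteq> I" if "is_ideal I" "a \<in> I" "b \<in> I" "c \<in> I" for a b c and I :: "(3, 'k) mpoly set"
      using that by (auto simp: ideal3_def intro!: is_ideal_add is_ideal_mult)
    show "ideal3 (F 0) (F 1) (F 2) = ideal3 (var 0 * q) (var 1 * q) ?f"
    proof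
      show "ideal3 (F 0) (F 1) (F 2) \<subseteq> ideal3 (var 0 * q) (var 1 * q) ?f"
        by (rule le[OF is_ideal_ideal3]; rule mem[OF is_ideal_ideal3 ideal3_gens])
      show "ideal3 (var 0 * q) (var 1 * q) ?f \<subseteq> ideal3 (F 0) (F 1) (F 2)"
        by (rule le[OF is_ideal_ideal3 P_mem(2)[unfolded q] P_mem(1)[unfolded P] F_mem])
    qed
    show "zdeg q \<noteq> 0 \<or> zdeg ?f \<noteq> 0"
    proof (rule ccontr)
      assume "\<not> (zdeg q \<noteq> 0 \<or> zdeg ?f \<noteq> 0)"
      then have z: "zdeg q = 0" "zdeg ?f = 0" by auto
      have zd: "zdeg (p - p') = 0" if "zdeg p = 0" "zdeg p' = 0" for p p' :: "(3, 'k) mpoly"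
        using zdeg_diff_le[of p 0 p'] that by simp
      have "zdeg (F i) = 0"
        by (subst solve, subst Fi) (intro zdeg_free_mult zd zdeg_cst z, simp_all add: zdeg_var)
      moreover have "zdeg (F j) = 0"
        by (subst solve, subst Fj) (intro zdeg_free_mult zd zdeg_cst z, simp_all add: zdeg_var)
      ultimately have "zdeg (F l) = 0" for l using z cases3[of l] by auto
      then show False using depends_on_z by simp
    qed
  qed
qed

end

section \<open>Binary forms over an algebraically closed field\<close>

abbreviation bf :: "nat \<Rightarrow> (nat \<Rightarrow> 'a::comm_ring_1) \<Rightarrow> (3, 'a) mpoly" where
  "bf k c \<equiv> hev k (\<lambda>j. cst (c j)) (var 0) (var 1)"

text \<open>
  The equation of the line through the vertex in the direction \<open>(s : t)\<close>.
\<close>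

abbreviation lin :: "'a::comm_ring_1 \<Rightarrow> 'a \<Rightarrow> (3, 'a) mpoly" where
  "lin s t \<equiv> cst t * var 0 - cst s * var 1"

abbreviation ev :: "'a::comm_ring_1 \<Rightarrow> 'a \<Rightarrow> 'a \<Rightarrow> (3, 'a) mpoly \<Rightarrow> 'a" where
  "ev s t w \<equiv> subst id (\<lambda>i. if i = 0 then s else if i = 1 then t else w)"

lemma ev_ring_map: "ring_map (ev s t w)" by (rule subst_id_map)

lemma ev_bf [simp]: "ev s t w (bf k c) = hev k c s t"
  by (simp add: ring_map.map_hev[OF ev_ring_map])

lemma bf_root:
  fixes s t :: "'k::field"
  assumes "hev (Suc k) c s t = 0" "s \<noteq> 0 \<or> t \<noteq> 0"
  obtains c' where "bf (Suc k) c = lin s t * bf k c'"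
proof (cases "t = 0")
  case False
  then have "t dvd r" for r by (simp add: dvd_field_iff)
  with hev_root[OF assms(1) False] obtain \<nu> where
    \<nu>: "\<nu> 0 = 0" "\<nu> (Suc (Suc k)) = 0" "\<And>j. j \<le> Suc k \<Longrightarrow> c j = t * \<nu> j - s * \<nu> (Suc j)"
    by blast
  have "bf (Suc k) c = hev (Suc k) (\<lambda>j. cst t * cst (\<nu> j) - cst s * cst (\<nu> (Suc j))) (var 0) (var 1)"
    by (rule hev_cong) (simp add: \<nu>(3) cst.maps)
  also have "\<dots> = lin s t * bf k (\<lambda>j. \<nu> (Suc j))"
    by (rule hev_factor) (simp_all add: \<nu>(1,2) cst.zero)
  finally show ?thesis by (rule that)
next
  case True
  with assms have "c (Suc k) = 0" by (simp add: hev_Suc)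
  then have "bf (Suc k) c = var 1 * bf k c" by (simp add: hev_Suc cst.zero)
  also have "\<dots> = (cst s * cst (inverse s)) * (var 1 * bf k c)"
    using assms(2) True by (simp flip: cst.mult add: cst.one)
  also have "\<dots> = lin s t * (cst (- inverse s) * bf k c)"
    using True by (simp add: cst.maps)
  also have "cst (- inverse s) * bf k c = bf k (\<lambda>j. - inverse s * c j)"
    by (simp only: hev_def sum_distrib_left cst.mult mult.assoc)
  finally show ?thesis by (rule that)
qed

lemma hev_has_root:
  fixes c :: "nat \<Rightarrow> 'k::alg_closed_field"
  obtains s t where "s \<noteq> 0 \<or> t \<noteq> 0" "hev (Suc k) c s t = 0"
proof (cases "c (Suc k) = 0")
  case True
  then show ?thesis by (intro that[of 1 0]) (simp_all add: hev_Suc)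
next
  case False
  then obtain s where "(\<Sum>i\<le>Suc k. c i * s ^ i) = 0"
    using alg_closed[of "Suc k" c] by auto
  then show ?thesis by (intro that[of s 1]) (simp_all add: hev_def)
qed

section \<open>Prime ideals\<close>

lemma all_3: "P 0 \<Longrightarrow> P 1 \<Longrightarrow> P 2 \<Longrightarrow> P i" for i :: 3
  using exhaust_3[of i] by blast

definition is_prime :: "'a::comm_ring_1 set \<Rightarrow> bool" where
  "is_prime P \<longleftrightarrow> is_ideal P \<and> 1 \<notin> P \<and> (\<forall>a b. a * b \<in> P \<longrightarrow> a \<in> P \<or> b \<in> P)"

lemma is_prime_ideal: "is_prime P \<Longrightarrow> is_ideal P"
  and is_prime_mult: "is_prime P \<Longrightarrow> a * b \<in> P \<Longrightarrow> a \<in> P \<or> b \<in> P"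
  and is_prime_1: "is_prime P \<Longrightarrow> 1 \<notin> P"
  by (simp_all add: is_prime_def)

lemma is_prime_power: "is_prime P \<Longrightarrow> a ^ k \<in> P \<Longrightarrow> a \<in> P"
  by (induction k) (auto dest: is_prime_mult simp: is_prime_1)

lemma cst_in_ideal:
  fixes c :: "'k::field"
  assumes "is_ideal P" "cst c * a \<in> P" "c \<noteq> 0" shows "a \<in> P"
proof -
  have "cst (inverse c) * (cst c * a) = a"
    using assms(3) by (simp flip: mult.assoc cst.mult add: cst.one)
  then show ?thesis using is_ideal_mult[OF assms(1,2), of "cst (inverse c)"] by simp
qed

lemma cst_in_prime:
  fixes c :: "'k::field"
  assumes "is_prime P" "cst c \<in> P" shows "c = 0"
  using cst_in_ideal[of P c 1] assms by (auto simp: is_prime_ideal is_prime_1)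

text \<open>
  Over an algebraically closed field a binary form is a product of linear forms.
\<close>

lemma binary_form_in_prime:
  fixes c :: "nat \<Rightarrow> 'k::alg_closed_field"
  assumes "is_prime P" "bf k c \<in> P" "bf k c \<noteq> 0"
  obtains s t where "s \<noteq> 0 \<or> t \<noteq> 0" "lin s t \<in> P"
  using assms(2,3)
proof (induction k arbitrary: c thesis)
  case 0
  then show ?case using cst_in_prime[OF assms(1)] by (auto simp: cst.zero)
next
  case (Suc k)
  obtain s t where st: "s \<noteq> 0 \<or> t \<noteq> 0" "hev (Suc k) c s t = 0" by (rule hev_has_root)
  obtain c' where c': "bf (Suc k) c = lin s t * bf k c'" by (rule bf_root[OF st(2,1)])
  then have "lin s t \<in> P \<or> bf k c' \<in> P" using is_prime_mult[OF assms(1)] Suc.prems(2) by simp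
  then show ?case
  proof
    assume "bf k c' \<in> P"
    moreover have "bf k c' \<noteq> 0" using c' Suc.prems(3) by auto
    ultimately show ?thesis using Suc.IH Suc.prems(1) by blast
  qed (use st Suc.prems(1) in blast)
qed

lemma cong_mult:
  assumes "is_ideal P" "a - a' \<in> P" "b - b' \<in> P" shows "a * b - a' * b' \<in> P"
proof -
  have "a * b - a' * b' = a * (b - b') + b' * (a - a')" by (simp add: algebra_simps)
  then show ?thesis using assms by (auto intro: is_ideal_add is_ideal_mult)
qed

lemma cong_power:
  assumes "is_ideal P" "a - a' \<in> P" shows "a ^ k - a' ^ k \<in> P"
  by (induction k) (auto simp: assms is_ideal_0 cong_mult)

lemma cong_hev:
  assumes "is_ideal P" "a - a' \<in> P" "b - b' \<in> P"
  shows "hev k c a b - hev k c a' b' \<in> P"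
proof -
  have "c i * a ^ i * b ^ (k - i) - c i * a' ^ i * b' ^ (k - i) \<in> P" for i
    by (intro cong_mult cong_power assms) (simp add: is_ideal_0 assms)
  then show ?thesis unfolding hev_def sum_subtractf[symmetric] by (intro is_ideal_sum assms)
qed

lemma cong_trans: "is_ideal P \<Longrightarrow> a - b \<in> P \<Longrightarrow> b - c \<in> P \<Longrightarrow> a - c \<in> P"
  using is_ideal_add[of P "a - b" "b - c"] by simp

lemma cong_mem: "is_ideal P \<Longrightarrow> a - b \<in> P \<Longrightarrow> a \<in> P \<longleftrightarrow> b \<in> P"
  using is_ideal_add[of P "a - b" b] is_ideal_diff[of P a "a - b"] by auto

text \<open>
  Here \<open>N\<close> is the parameter on the line through \<open>(0, 0)\<close> and \<open>(s, t)\<close>.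
\<close>

lemma point_on_line:
  fixes s t :: "'k::field"
  assumes "is_ideal P" "s \<noteq> 0 \<or> t \<noteq> 0" "lin s t \<in> P"
  obtains N where "var 0 - cst s * N \<in> P" "var 1 - cst t * N \<in> P"
proof (cases "t = 0")
  case False
  have "cst (inverse t) * lin s t \<in> P" by (rule is_ideal_mult[OF assms(1,3)])
  also have "cst (inverse t) * lin s t = cst (inverse t * t) * var 0 - cst s * (cst (inverse t) * var 1)"
    by (simp only: cst.mult algebra_simps)
  finally have "var 0 - cst s * (cst (inverse t) * var 1) \<in> P" using False by (simp add: cst.one)
  moreover have "var 1 - cst t * (cst (inverse t) * var 1) = (0 :: (3, 'k) mpoly)"
    using False by (simp flip: mult.assoc cst.mult add: cst.one)
  ultimately show ?thesis using that is_ideal_0[OF assms(1)] by metis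
next
  case True
  then have s: "s \<noteq> 0" using assms(2) by simp
  have "cst (- s) * var 1 \<in> P" using assms(3) True by (simp add: cst.maps)
  then have "var 1 - cst t * (cst (inverse s) * var 0) \<in> P"
    using cst_in_ideal[OF assms(1)] s True by (simp add: cst.zero)
  moreover have "var 0 - cst s * (cst (inverse s) * var 0) = (0 :: (3, 'k) mpoly)"
    using s by (simp flip: mult.assoc cst.mult add: cst.one)
  ultimately show ?thesis using that is_ideal_0[OF assms(1)] by metis
qed

text \<open>
  Modulo \<open>P\<close> all three variables are multiples of \<open>N\<close>, so every polynomial becomes a polynomial in
  \<open>N\<close> over \<open>k\<close>.
\<close>

lemma monogenic_of_line:
  fixes P :: "(3, 'k::field) mpoly set"
  assumes "is_ideal P" "\<And>i. var i - cst (a i) * N \<in> P"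
  shows "\<exists>h. r - poly (map_poly cst h) N \<in> P"
proof -
  interpret pe: ring_map "\<lambda>h. poly (map_poly cst h) N" by (rule map_poly_ring_map[OF ring_map_cst])
  show ?thesis
  proof (induction r rule: mpoly_induct)
    case (cst c)
    show ?case by (rule exI[of _ "[:c:]"]) (simp add: map_poly_pCons cst.zero is_ideal_0 assms)
  next
    case (var i)
    show ?case by (rule exI[of _ "[:0, a i:]"])
      (use assms(2)[of i] in \<open>simp add: map_poly_pCons cst.zero mult.commute\<close>)
  next
    case (add p r)
    then obtain h h' where "p - poly (map_poly cst h) N \<in> P" "r - poly (map_poly cst h') N \<in> P" by blast
    from is_ideal_add[OF assms(1) this] show ?case
      by (intro exI[of _ "h + h'"]) (simp add: pe.add algebra_simps)
  next
    case (mult p r)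
    then obtain h h' where "p - poly (map_poly cst h) N \<in> P" "r - poly (map_poly cst h') N \<in> P" by blast
    from cong_mult[OF assms(1) this] show ?case
      by (intro exI[of _ "h * h'"]) (simp add: pe.mult)
  qed
qed

section \<open>The ideal in normal form\<close>

text \<open>
  The ideal \<open>(x q, y q, f)\<close> of a de Jonquieres map of degree \<open>m + 2\<close> with the point of high
  multiplicity at the vertex.
\<close>

locale normal_form =
  fixes q f :: "(3, 'k::alg_closed_field) mpoly" and q1 q2 f1 f2 :: "nat \<Rightarrow> 'k" and m :: nat
  assumes q_eq: "q = var 2 * bf m q1 + bf (Suc m) q2"
    and f_eq: "f = var 2 * bf (Suc m) f1 + bf (Suc (Suc m)) f2"
    and q_nz: "q \<noteq> 0" and depends: "zdeg q \<noteq> 0 \<or> zdeg f \<noteq> 0"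
    and coprime: "h dvd q \<Longrightarrow> h dvd f \<Longrightarrow> h dvd 1"
begin

lemma q_forms: "q \<in> forms (Suc m)" and f_forms: "f \<in> forms (Suc (Suc m))"
proof -
  have "var 2 * bf k c \<in> forms (Suc k)" for k and c :: "nat \<Rightarrow> 'k"
    using forms_mult[OF forms_var hev_forms, of 2 k c] by simp
  then show "q \<in> forms (Suc m)" "f \<in> forms (Suc (Suc m))"
    unfolding q_eq f_eq by (simp_all only: forms_add hev_forms)
qed

definition "I = ideal3 (var 0 * q) (var 1 * q) f"

lemma ideal_I: "is_ideal I" unfolding I_def by (rule is_ideal_ideal3)

lemma q_dvd: "q dvd r * f \<Longrightarrow> q dvd r"
  by (rule no_common_factor_dvd[OF q_nz coprime])

text \<open>
  The resultant of \<open>q\<close> and \<open>f\<close> with respect to \<open>z\<close>.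
\<close>

definition "\<Delta> = bf m q1 * bf (Suc (Suc m)) f2 - bf (Suc m) f1 * bf (Suc m) q2"

lemma \<Delta>_eq: "\<Delta> = bf m q1 * f - bf (Suc m) f1 * q"
  unfolding \<Delta>_def by (subst q_eq, subst f_eq) (simp add: algebra_simps)

text \<open>
  If the resultant were zero, \<open>q\<close> would divide its coefficient of \<open>z\<close>, a form of smaller degree.
\<close>

lemma \<Delta>_nz: "\<Delta> \<noteq> 0"
proof
  assume "\<Delta> = 0"
  then have eq: "bf m q1 * f = bf (Suc m) f1 * q" by (simp add: \<Delta>_eq)
  then have "q dvd bf m q1 * f" by simp
  then have "q dvd bf m q1" by (rule q_dvd)
  then obtain w where w: "bf m q1 = q * w" by (elim dvdE)
  have "bf m q1 = 0"
  proof (rule ccontr)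
    assume nz: "bf m q1 \<noteq> 0"
    have "q * w \<in> forms m" using hev_forms[of m q1] w by simp
    moreover have "q * w \<noteq> 0" using nz w by simp
    ultimately obtain i where "i \<le> m" "q \<in> forms i" by (rule forms_factor)
    then show False using forms_unique[OF q_forms \<open>q \<in> forms i\<close> q_nz] by simp
  qed
  moreover from this have "bf (Suc m) f1 = 0" using eq q_nz by simp
  ultimately have "zdeg q = 0" "zdeg f = 0"
    by (subst q_eq f_eq, simp add: zdeg_hev)+
  then show False using depends by simp
qed

lemma \<Delta>_binary: obtains k c where "\<Delta> = bf k c"
proof -
  have "bf m q1 * bf (Suc (Suc m)) f2 \<in> forms (m + Suc (Suc m))" by (intro forms_mult hev_forms)
  moreover have "bf (Suc m) f1 * bf (Suc m) q2 \<in> forms (Suc m + Suc m)" by (intro forms_mult hev_forms)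
  ultimately have "\<Delta> \<in> forms (m + Suc (Suc m))" unfolding \<Delta>_def by (simp add: forms_diff)
  moreover have "zdeg \<Delta> \<le> 0" unfolding \<Delta>_def
    by (intro zdeg_diff_le) (simp_all add: zdeg_free_mult zdeg_hev)
  ultimately show ?thesis using binary_form that by (metis le_zero_eq)
qed

text \<open>
  A line through the vertex contained in both curves would be a common component.
\<close>

lemma no_common_point:
  assumes "s \<noteq> 0 \<or> t \<noteq> 0"
  shows "\<not> (hev m q1 s t = 0 \<and> hev (Suc m) q2 s t = 0 \<and> hev (Suc m) f1 s t = 0 \<and> hev (Suc (Suc m)) f2 s t = 0)"
proof
  assume *: "hev m q1 s t = 0 \<and> hev (Suc m) q2 s t = 0 \<and> hev (Suc m) f1 s t = 0 \<and> hev (Suc (Suc m)) f2 s t = 0"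
  have d: "lin s t dvd bf k c" if "hev k c s t = 0" for k c
  proof (cases k)
    case 0
    then show ?thesis using that by (simp add: cst.zero)
  next
    case (Suc k')
    show ?thesis using bf_root[of k' c s t] that assms unfolding Suc by (metis dvd_triv_left)
  qed
  have "lin s t dvd q" "lin s t dvd f"
    by (subst q_eq f_eq, intro dvd_add dvd_mult d, use * in simp_all)+
  then have "lin s t dvd 1" by (rule coprime)
  then obtain w where w: "lin s t * w = 1" by (metis dvdE)
  interpret ev: ring_map "ev s t 0" by (rule ev_ring_map)
  have "ev s t 0 (lin s t * w) = 0" by (simp add: ev.maps)
  then show False unfolding w by (simp add: ev.one)
qed

text \<open>
  If the prime does not contain both \<open>x\<close> and \<open>y\<close>, then it contains \<open>q\<close> and \<open>f\<close>, their resultant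
  and the equation of a line through the vertex with parameter \<open>N\<close>. On this line \<open>q\<close> and \<open>f\<close> become
  \<open>N\<^sup>k (z b + N c)\<close> with constants \<open>b\<close> and \<open>c\<close>. They do not both vanish identically, so one of them
  determines \<open>z\<close> as a multiple of \<open>N\<close>.
\<close>

theorem prime_monogenic:
  assumes P: "is_prime P" "I \<subseteq> P"
  shows "\<exists>N. \<forall>r. \<exists>h. r - poly (map_poly cst h) N \<in> P"
proof -
  note iP = is_prime_ideal[OF P(1)]
  have "\<exists>N a. \<forall>i. var i - cst (a i) * N \<in> P"
  proof (cases "var 0 \<in> P \<and> var 1 \<in> P")
    case True
    then show ?thesis
      by (intro exI[of _ "var 2"] exI[of _ "\<lambda>i. if i = 2 then 1 else 0"])
        (rule allI, rule all_3, simp_all add: cst.maps is_ideal_0[OF iP])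
  next
    case False
    have gens: "var 0 * q \<in> P" "var 1 * q \<in> P" and f: "f \<in> P"
      using P(2) ideal3_gens unfolding I_def by blast+
    then have q: "q \<in> P" using False is_prime_mult[OF P(1)] by blast
    have "\<Delta> \<in> P" unfolding \<Delta>_eq by (intro is_ideal_diff is_ideal_mult iP q f)
    then obtain s t where st: "s \<noteq> 0 \<or> t \<noteq> 0" "lin s t \<in> P"
      using \<Delta>_binary binary_form_in_prime[OF P(1)] \<Delta>_nz by metis
    then obtain N where N: "var 0 - cst s * N \<in> P" "var 1 - cst t * N \<in> P"
      using point_on_line[OF iP] by blast
    have "N \<notin> P"
    proof
      assume "N \<in> P"
      then have "cst s * N \<in> P" "cst t * N \<in> P" by (simp_all add: is_ideal_mult[OF iP])
      then show False using False cong_mem[OF iP N(1)] cong_mem[OF iP N(2)] by simp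
    qed
    have bf_cong: "bf k c - cst (hev k c s t) * N ^ k \<in> P" for k c
    proof -
      have "bf k c - hev k (\<lambda>j. cst (c j)) (N * cst s) (N * cst t) \<in> P"
        by (rule cong_hev[OF iP]) (use N in \<open>simp_all add: mult.commute\<close>)
      then show ?thesis by (simp add: hev_scale cst.map_hev mult.commute)
    qed
    have step: "var 2 * cst (hev k a s t) + N * cst (hev (Suc k) b s t) \<in> P"
      if "var 2 * bf k a + bf (Suc k) b \<in> P" for k a b
    proof -
      have "(var 2 * bf k a + bf (Suc k) b) - N ^ k * (var 2 * cst (hev k a s t) + N * cst (hev (Suc k) b s t))
         = var 2 * (bf k a - cst (hev k a s t) * N ^ k) + (bf (Suc k) b - cst (hev (Suc k) b s t) * N ^ Suc k)"
        by (simp add: algebra_simps)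
      also have "\<dots> \<in> P" by (intro is_ideal_add is_ideal_mult bf_cong iP)
      finally have "N ^ k * (var 2 * cst (hev k a s t) + N * cst (hev (Suc k) b s t)) \<in> P"
        using cong_mem[OF iP] that by blast
      then show ?thesis using is_prime_mult[OF P(1)] is_prime_power[OF P(1)] \<open>N \<notin> P\<close> by blast
    qed
    have z: "\<exists>a. var 2 - cst a * N \<in> P" if "var 2 * cst b + N * cst c \<in> P" "b \<noteq> 0" for b c
    proof -
      have "cst (inverse b) * (var 2 * cst b + N * cst c) \<in> P" by (rule is_ideal_mult[OF iP that(1)])
      also have "cst (inverse b) * (var 2 * cst b + N * cst c) = cst (inverse b * b) * var 2 - cst (- (inverse b * c)) * N"
        by (simp only: cst.maps algebra_simps) simp
      finally show ?thesis using that(2) by (auto simp: cst.one)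
    qed
    have zero: "c = 0" if "var 2 * cst b + N * cst c \<in> P" "b = 0" for b c
      using that is_prime_mult[OF P(1), of N "cst c"] \<open>N \<notin> P\<close> cst_in_prime[OF P(1)] by (simp add: cst.zero)
    have "\<exists>a. var 2 - cst a * N \<in> P"
    proof -
      note q' = step[OF q[unfolded q_eq]] and f' = step[OF f[unfolded f_eq]]
      consider "hev m q1 s t \<noteq> 0" | "hev (Suc m) f1 s t \<noteq> 0" | "hev m q1 s t = 0" "hev (Suc m) f1 s t = 0"
        by blast
      then show ?thesis
      proof cases
        case 1 then show ?thesis by (rule z[OF q'])
      next
        case 2 then show ?thesis by (rule z[OF f'])
      next
        case 3
        with zero[OF q'] zero[OF f'] no_common_point[OF st(1)] show ?thesis by simp
      qed
    qed
    then obtain a where a: "var 2 - cst a * N \<in> P" by blast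
    show ?thesis
      by (intro exI[of _ N] exI[of _ "\<lambda>i. if i = 0 then s else if i = 1 then t else a"] allI)
        (rule all_3, use N a in simp_all)
  qed
  then obtain N a where "\<And>i. var i - cst (a i) * N \<in> P" by blast
  from monogenic_of_line[OF iP this] show ?thesis by blast
qed

end

section \<open>Dimension of a sum of subspaces\<close>

text \<open>
  The finite set \<open>D\<close> takes the place of a finite-dimensional ambient space; the space of all
  polynomials has infinite dimension.
\<close>

lemma (in vector_space) dim_sum_Int:
  assumes U: "subspace U" and W: "subspace W" and fin: "finite D" "U \<subseteq> span D" "W \<subseteq> span D"
  shows "dim {u + w | u w. u \<in> U \<and> w \<in> W} + dim (U \<inter> W) = dim U + dim W"
proof -
  obtain B where B: "B \<subseteq> U \<inter> W" "independent B" "U \<inter> W \<subseteq> span B"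
    by (rule maximal_independent_subset)
  obtain BU where BU: "B \<subseteq> BU" "BU \<subseteq> U" "independent BU" "U \<subseteq> span BU"
    using maximal_independent_subset_extend[of B U] B by blast
  obtain BW where BW: "B \<subseteq> BW" "BW \<subseteq> W" "independent BW" "W \<subseteq> span BW"
    using maximal_independent_subset_extend[of B W] B by blast
  have finU: "finite BU" and finW: "finite BW"
    using independent_span_bound[OF fin(1) BU(3) order_trans[OF BU(2) fin(2)]]
      independent_span_bound[OF fin(1) BW(3) order_trans[OF BW(2) fin(3)]] by simp_all
  have spans: "span BU \<subseteq> U" "span BW \<subseteq> W"
    using span_minimal[OF BU(2) U] span_minimal[OF BW(2) W] by simp_all
  have indep: "independent (BU \<union> C)" if "finite C" "C \<subseteq> BW - B" for C
    using that
  proof induction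
    case empty
    then show ?case using BU by simp
  next
    case (insert a C)
    have "a \<notin> span (BU \<union> C)"
    proof
      assume "a \<in> span (BU \<union> C)"
      then obtain u c where uc: "a = u + c" "u \<in> span BU" "c \<in> span C"
        unfolding span_Un by blast
      have "span C \<subseteq> W" using insert.prems BW(2) W by (intro span_minimal) auto
      moreover have "a \<in> W" using insert.prems BW(2) by auto
      ultimately have "a - c \<in> W" using W uc(3) by (auto intro: subspace_diff)
      then have "u \<in> U \<inter> W" using uc spans by auto
      then have "u \<in> span B" using B by auto
      then have "a \<in> span (B \<union> C)" unfolding span_Un using uc by blast
      moreover have "B \<union> C \<subseteq> BW - {a}" using insert BW by auto
      ultimately have "a \<in> span (BW - {a})" using span_mono by blast
      then show False using BW(3) insert.prems unfolding dependent_def by blast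
    qed
    then show ?case using insert by (simp add: independent_insertI)
  qed
  have disj: "BU \<inter> (BW - B) = {}"
  proof (rule ccontr)
    assume "BU \<inter> (BW - B) \<noteq> {}"
    then obtain a where a: "a \<in> BU" "a \<in> BW" "a \<notin> B" by blast
    then have "a \<in> span B" using BU BW B by auto
    moreover have "B \<subseteq> BW - {a}" using a BW by auto
    ultimately have "a \<in> span (BW - {a})" using span_mono by blast
    then show False using BW(3) a unfolding dependent_def by blast
  qed
  have "dim {u + w | u w. u \<in> U \<and> w \<in> W} = card (BU \<union> (BW - B))"
  proof (rule dim_unique)
    show "BU \<union> (BW - B) \<subseteq> {u + w | u w. u \<in> U \<and> w \<in> W}"
      using BU BW subspace_0[OF U] subspace_0[OF W] by auto (metis add.right_neutral subsetD, metis add_0 subsetD)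
    have "BW \<subseteq> BU \<union> (BW - B)" using BU by auto
    then have "span BW \<subseteq> span (BU \<union> (BW - B))" "span BU \<subseteq> span (BU \<union> (BW - B))"
      by (intro span_mono; blast)+
    then show "{u + w | u w. u \<in> U \<and> w \<in> W} \<subseteq> span (BU \<union> (BW - B))"
      using BU BW by (auto intro!: span_add)
    show "independent (BU \<union> (BW - B))" by (rule indep) (use finW in auto)
  qed simp
  also have "\<dots> = card BU + card (BW - B)" by (rule card_Un_disjoint) (use finU finW disj in auto)
  also have "card (BW - B) + card B = card BW"
    using card_Diff_subset[of B BW] card_mono[OF finW BW(1)] finite_subset[OF BW(1) finW] BW(1) by simp
  moreover have "dim U = card BU" "dim W = card BW" "dim (U \<inter> W) = card B"
    by (rule dim_unique; use B BU BW in blast)+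
  ultimately show ?thesis by simp
qed

interpretation mp: vector_space "\<lambda>(c::'k::field) (p::('v, 'k) mpoly). cst c * p"
  by unfold_locales (simp_all add: cst.maps algebra_simps)

lemma dim_injective_image:
  fixes g :: "('v, 'k::field) mpoly \<Rightarrow> ('w, 'k) mpoly"
  assumes add: "\<And>p r. g (p + r) = g p + g r" and scale: "\<And>c p. g (cst c * p) = cst c * g p"
    and inj: "inj g" and V: "mp.subspace V"
  shows "mp.dim (g ` V) = mp.dim V"
proof -
  have lin: "Vector_Spaces.linear (\<lambda>c p. cst c * p) (\<lambda>c p. cst c * p) g"
    by unfold_locales (simp_all add: assms cst.maps distrib_left distrib_right mult.assoc)
  then have hom: "module_hom (\<lambda>c p. cst c * p) (\<lambda>c p. cst c * p) g"
    by (simp add: module_hom_eq_linear)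
  obtain B where B: "B \<subseteq> V" "mp.independent B" "V \<subseteq> mp.span B"
    by (rule mp.maximal_independent_subset)
  have "mp.dim (g ` V) = card (g ` B)"
  proof (rule mp.dim_unique)
    show "mp.independent (g ` B)"
      by (rule module_hom.independent_injective_image[OF hom B(2)]) (use inj in \<open>auto intro: inj_on_subset\<close>)
    show "g ` V \<subseteq> mp.span (g ` B)"
      using B(3) by (auto simp: module_hom.span_image[OF hom])
  qed (use B in auto)
  also have "\<dots> = card B" by (rule card_image) (use inj in \<open>auto intro: inj_on_subset\<close>)
  also have "\<dots> = mp.dim V" using mp.dim_unique[OF B(1,3,2)] by simp
  finally show ?thesis .
qed

lemma subspace_forms: "mp.subspace (forms n :: ('v::finite, 'k::field) mpoly set)"
  by (auto simp: mp.subspace_def forms_add forms_cst_mult)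

lemma subspace_ideal: "is_ideal J \<Longrightarrow> mp.subspace J"
  by (auto simp: mp.subspace_def is_ideal_0 is_ideal_add is_ideal_mult)

lemma subspace_mult_image: "mp.subspace V \<Longrightarrow> mp.subspace ((*) a ` V)"
  for a :: "('v, 'k::field) mpoly"
proof (unfold mp.subspace_def, intro conjI ballI allI)
  assume V: "0 \<in> V \<and> (\<forall>x\<in>V. \<forall>y\<in>V. x + y \<in> V) \<and> (\<forall>c. \<forall>x\<in>V. cst c * x \<in> V)"
  show "0 \<in> (*) a ` V" using V by (metis imageI mult_zero_right)
  show "p + r \<in> (*) a ` V" if "p \<in> (*) a ` V" "r \<in> (*) a ` V" for p r
    using that V by (auto simp flip: distrib_left)
  show "cst c * p \<in> (*) a ` V" if "p \<in> (*) a ` V" for c p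
    using that V by (auto simp: mult.left_commute[of _ a])
qed

lemma dim_mult_image:
  fixes a :: "('v::linorder, 'k::field) mpoly"
  assumes "a \<noteq> 0" "mp.subspace V"
  shows "mp.dim ((*) a ` V) = mp.dim V"
  by (rule dim_injective_image) (use assms in \<open>auto simp: algebra_simps inj_on_def\<close>)

section \<open>The dimension of the space of ternary forms\<close>

definition mons :: "nat \<Rightarrow> (3 \<Rightarrow>\<^sub>0 nat) set" where
  "mons n = (\<lambda>(i, j). mon j (i - j) (n - i)) ` (SIGMA i:{..n}. {..i})"

lemma mons_iff: "m \<in> mons n \<longleftrightarrow> weight UNIV m = n"
proof
  assume "weight UNIV m = n"
  then have "m = mon (Poly_Mapping.lookup m 0) (Poly_Mapping.lookup m 0 + Poly_Mapping.lookup m 1 - Poly_Mapping.lookup m 0)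
     (n - (Poly_Mapping.lookup m 0 + Poly_Mapping.lookup m 1))"
    "Poly_Mapping.lookup m 0 + Poly_Mapping.lookup m 1 \<le> n"
    using mon_cases[of m] by (auto simp: weight_UNIV_3)
  then show "m \<in> mons n" unfolding mons_def
    by (intro image_eqI[of _ _ "(Poly_Mapping.lookup m 0 + Poly_Mapping.lookup m 1, Poly_Mapping.lookup m 0)"]) auto
qed (auto simp: mons_def weight_UNIV_3)

lemma card_mons: "2 * card (mons n) = (n + 1) * (n + 2)"
proof -
  have "inj_on (\<lambda>(i, j). mon j (i - j) (n - i)) (SIGMA i:{..n}. {..i})"
  proof (rule inj_onI, clarsimp)
    fix i j i' j' assume *: "i \<le> n" "i' \<le> n" "j \<le> i" "j' \<le> i'" "mon j (i - j) (n - i) = mon j' (i' - j') (n - i')"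
    have "j = j'" "n - i = n - i'"
      using arg_cong[OF *(5), of "\<lambda>m. Poly_Mapping.lookup m 0"] arg_cong[OF *(5), of "\<lambda>m. Poly_Mapping.lookup m 2"]
      by simp_all
    with *(1,2) show "i = i' \<and> j = j'" by linarith
  qed
  then have "card (mons n) = (\<Sum>i\<le>n. Suc i)"
    by (simp add: mons_def card_image)
  moreover have "2 * (\<Sum>i\<le>n. Suc i) = (n + 1) * (n + 2)" by (induction n) simp_all
  ultimately show ?thesis by simp
qed

lemma finite_mons: "finite (mons n)"
  by (auto simp: mons_def)

lemma forms_span: "(forms n :: (3, 'k::field) mpoly set) \<subseteq> mp.span ((\<lambda>m. Poly_Mapping.single m 1) ` mons n)"
proof
  fix p :: "(3, 'k) mpoly" assume p: "p \<in> forms n"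
  have "Poly_Mapping.single m (Poly_Mapping.lookup p m) \<in> mp.span ((\<lambda>m. Poly_Mapping.single m 1) ` mons n)"
    if "m \<in> Poly_Mapping.keys p" for m
  proof -
    have "m \<in> mons n" using that p by (simp add: forms_def tdeg_weight mons_iff)
    then have "cst (Poly_Mapping.lookup p m) * Poly_Mapping.single m 1 \<in> mp.span ((\<lambda>m. Poly_Mapping.single m 1) ` mons n)"
      by (intro mp.span_scale mp.span_base) auto
    then show ?thesis by (simp add: cst_def mult_single)
  qed
  then show "p \<in> mp.span ((\<lambda>m. Poly_Mapping.single m 1) ` mons n)"
    by (subst poly_mapping_sum_single) (rule mp.span_sum)
qed

lemma dim_forms: "mp.dim (forms n :: (3, 'k::field) mpoly set) = card (mons n)"
proof (rule mp.dim_unique)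
  let ?B = "(\<lambda>m. Poly_Mapping.single m (1::'k)) ` mons n"
  have inj: "inj_on (\<lambda>m. Poly_Mapping.single m (1::'k)) A" for A :: "(3 \<Rightarrow>\<^sub>0 nat) set"
    by (rule inj_onI) (metis keys_single singleton_inject zero_neq_one)
  show "?B \<subseteq> forms n" by (auto simp: forms_def tdeg_weight mons_iff)
  show "forms n \<subseteq> mp.span ?B" by (rule forms_span)
  show "mp.independent ?B"
    unfolding mp.independent_explicit_module
  proof (intro allI impI)
    fix t u v assume t: "finite t" "t \<subseteq> ?B" "(\<Sum>v\<in>t. cst (u v) * v) = 0" "v \<in> t"
    obtain m where m: "v = Poly_Mapping.single m 1" using t by auto
    have "0 = Poly_Mapping.lookup (\<Sum>v\<in>t. cst (u v) * v) m" by (simp add: t(3))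
    also have "\<dots> = (\<Sum>w\<in>t. if w = v then u v else 0)"
      unfolding lookup_sum
    proof (rule sum.cong[OF refl])
      fix w assume "w \<in> t"
      then obtain m' where "w = Poly_Mapping.single m' 1" using t by auto
      then show "Poly_Mapping.lookup (cst (u w) * w) m = (if w = v then u v else 0)"
        using inj[of UNIV] m by (auto simp: cst_def mult_single lookup_single when_def dest: injD)
    qed
    also have "\<dots> = u v" using t by simp
    finally show "u v = 0" by simp
  qed
  show "card ?B = card (mons n)" by (rule card_image[OF inj])
qed

section \<open>The Hilbert function\<close>

text \<open>
  The homogeneous ideal of the vertex.
\<close>

abbreviation xy_ideal :: "(3, 'k::comm_ring_1) mpoly set" where
  "xy_ideal \<equiv> ideal3 (var 0) (var 1) 0"

lemma subst_at_vertex: "p - subst cst (\<lambda>i. if i = 2 then var 2 else 0) p \<in> xy_ideal"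
  for p :: "(3, 'k::comm_ring_1) mpoly"
proof -
  let ?s = "subst cst (\<lambda>i. if i = 2 then var 2 else 0) :: (3, 'k) mpoly \<Rightarrow> _"
  interpret ring_map ?s by (rule subst_cst_map)
  note J = is_ideal_ideal3[of "var 0" "var 1" "0 :: (3, 'k) mpoly"]
  show ?thesis
  proof (induction p rule: mpoly_induct)
    case (var i)
    show ?case by (rule all_3[of _ i]) (simp_all add: ideal3_gens is_ideal_0[OF J])
  next
    case (add p r)
    from is_ideal_add[OF J add] show ?case by (simp add: maps algebra_simps)
  next
    case (mult p r)
    from cong_mult[OF J mult] show ?case by (simp add: maps)
  qed (simp add: is_ideal_0[OF J])
qed

lemma subst_at_vertex_form:
  fixes p :: "(3, 'k::comm_ring_1) mpoly"
  assumes "p \<in> forms n"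
  shows "subst cst (\<lambda>i. if i = 2 then var 2 else 0) p = cst (ev 0 0 1 p) * (var 2 ^ n :: (3, 'k) mpoly)"
proof -
  have "subst cst (\<lambda>i. cst (if i = 2 then 1 else 0)) p = (cst (ev 0 0 1 p) :: (3, 'k) mpoly)"
  proof (rule ring_map_eqI[OF subst_cst_map ring_map_comp[OF ev_ring_map ring_map_cst]])
    show "subst cst (\<lambda>i. cst (if i = 2 then 1 else 0)) (var v) = (cst (ev 0 0 1 (var v)) :: (3, 'k) mpoly)" for v :: 3
      unfolding subst_cst_var subst_id_var using exhaust_3[of v] by (elim disjE) simp_all
  qed simp
  moreover have "(\<lambda>i::3. if i = 2 then var 2 else 0) = (\<lambda>i. var (2::3) * cst (if i = 2 then 1 else 0 :: 'k))"
    by (auto simp: cst.maps)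
  moreover have "subst cst (\<lambda>i::3. var (2::3) * cst (if i = 2 then 1 else 0 :: 'k)) p =
      var (2::3) ^ n * subst cst (\<lambda>i. cst (if i = 2 then 1 else 0)) p"
    by (rule subst_forms_scale[OF assms])
  ultimately show ?thesis by (simp only: mult.commute)
qed

lemma ev_vertex_xy: "p \<in> xy_ideal \<Longrightarrow> ev 0 0 w p = 0"
  by (auto simp: ideal3_def ring_map.maps[OF ev_ring_map])

text \<open>
  In degree \<open>n\<close> the line spanned by \<open>z\<^sup>n\<close> is a complement.
\<close>

lemma dim_xy_forms: "mp.dim (xy_ideal \<inter> forms n :: (3, 'k::field) mpoly set) + 1 = card (mons n)"
proof -
  let ?z = "var 2 ^ n :: (3, 'k) mpoly"
  let ?U = "xy_ideal \<inter> forms n :: (3, 'k) mpoly set" and ?W = "mp.span {?z}"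
  have z: "?z \<in> forms n" using forms_power[OF forms_var[of 2], of n] by simp
  have U: "mp.subspace ?U"
    by (intro mp.subspace_inter subspace_ideal is_ideal_ideal3 subspace_forms)
  have W: "?W \<subseteq> forms n" by (rule mp.span_minimal) (use z subspace_forms in auto)
  have W_eq: "?W = {cst c * ?z | c. True}" by (auto simp: mp.span_singleton)
  have "{u + w | u w. u \<in> ?U \<and> w \<in> ?W} = forms n"
  proof (intro equalityI subsetI)
    fix p :: "(3, 'k) mpoly" assume p: "p \<in> forms n"
    have "cst (ev 0 0 1 p) * ?z \<in> ?W" by (auto simp: W_eq)
    moreover have "p - cst (ev 0 0 1 p) * ?z \<in> ?U"
      using subst_at_vertex[of p] subst_at_vertex_form[OF p] p z by (auto intro: forms_diff forms_cst_mult)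
    moreover have "p = (p - cst (ev 0 0 1 p) * ?z) + cst (ev 0 0 1 p) * ?z" by simp
    ultimately show "p \<in> {u + w | u w. u \<in> ?U \<and> w \<in> ?W}" by blast
  qed (use W in \<open>auto intro: forms_add\<close>)
  moreover have "?U \<inter> ?W = {0}"
  proof (intro equalityI subsetI)
    fix p assume "p \<in> ?U \<inter> ?W"
    then obtain c where c: "p = cst c * ?z" "p \<in> xy_ideal" by (auto simp: W_eq)
    then have "ev 0 0 1 (cst c * ?z) = 0" using ev_vertex_xy by auto
    then have "c = 0" by (simp add: ring_map.maps[OF ev_ring_map])
    with c show "p \<in> {0}" by (simp add: cst.zero)
  qed (use U mp.span_zero in \<open>auto simp: mp.subspace_def\<close>)
  moreover have "mp.dim ?W = 1"
    by (simp add: mp.dim_eq_card_independent)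
  moreover have "mp.dim {0 :: (3, 'k) mpoly} = 0"
    by (rule mp.dim_unique[of "{}"]) (simp_all add: mp.independent_empty)
  moreover have "mp.dim {u + w | u w. u \<in> ?U \<and> w \<in> ?W} + mp.dim (?U \<inter> ?W) = mp.dim ?U + mp.dim ?W"
  proof (rule mp.dim_sum_Int[OF U mp.subspace_span])
    show "finite ((\<lambda>m. Poly_Mapping.single m (1::'k)) ` mons n)" using finite_mons by blast
    show "?U \<subseteq> mp.span ((\<lambda>m. Poly_Mapping.single m 1) ` mons n)" using forms_span[of n] by blast
    show "?W \<subseteq> mp.span ((\<lambda>m. Poly_Mapping.single m 1) ` mons n)" using forms_span[of n] W by blast
  qed
  ultimately show ?thesis by (simp only: dim_forms)
qed

lemma hilbert_poly_eventually_const: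
  assumes "\<And>n. N \<le> n \<Longrightarrow> hilbert_function I n = c"
  shows "hilbert_poly I = [:of_nat c:]"
  unfolding hilbert_poly_def
proof (rule the_equality)
  show "\<forall>\<^sub>F n in sequentially. poly [:of_nat c:] (of_nat n :: rat) = of_nat (hilbert_function I n)"
    using assms by (auto simp: eventually_sequentially)
next
  fix P :: "rat poly"
  assume "\<forall>\<^sub>F n in sequentially. poly P (of_nat n) = of_nat (hilbert_function I n)"
  then obtain N' where N': "\<And>n. N' \<le> n \<Longrightarrow> poly P (of_nat n) = of_nat (hilbert_function I n)"
    by (auto simp: eventually_sequentially)
  have "poly (P - [:of_nat c:]) (of_nat n) = 0" if "max N N' \<le> n" for n
    using that N' assms by simp
  then have "of_nat ` {max N N'..} \<subseteq> {x::rat. poly (P - [:of_nat c:]) x = 0}" by auto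
  moreover have "infinite (of_nat ` {max N N'..} :: rat set)"
    by (subst finite_image_iff) (auto simp: inj_on_def infinite_Ici)
  ultimately have "P - [:of_nat c:] = 0" using poly_roots_finite finite_subset by blast
  then show "P = [:of_nat c:]" by simp
qed

lemma quotient_degree_const:
  assumes "\<And>n. N \<le> n \<Longrightarrow> hilbert_function I n = c" "c \<noteq> 0"
  shows "quotient_degree I = of_nat c"
  using hilbert_poly_eventually_const[OF assms(1)] assms(2) by (simp add: quotient_degree_def Let_def)

context normal_form
begin

lemma bf_Suc_xy: "bf (Suc k) c \<in> xy_ideal" for c :: "nat \<Rightarrow> 'k"
proof -
  have "bf (Suc k) c = (cst (c (Suc k)) * var 0 ^ k) * var 0 + bf k c * var 1 + 0 * (0 :: (3, 'k) mpoly)"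
    by (simp add: hev_Suc)
  then show ?thesis unfolding ideal3_def by blast
qed

lemma f_xy: "f \<in> xy_ideal"
  unfolding f_eq by (intro is_ideal_add is_ideal_mult bf_Suc_xy is_ideal_ideal3)

lemma f_nz: "f \<noteq> 0"
proof
  assume "f = 0"
  then have "q dvd 1" using coprime[of q] by simp
  then obtain w where "q * w = 1" by (metis dvdE)
  then have "q * w \<in> forms 0" "q * w \<noteq> 0" using forms_cst[of "1::'k"] by (simp_all add: cst.one)
  then obtain i where "i \<le> 0" "q \<in> forms i" by (rule forms_factor)
  then show False using forms_unique[OF q_forms \<open>q \<in> forms i\<close> q_nz] by simp
qed

lemma I_eq: "I = {q * u + f * w | u w. u \<in> xy_ideal}"
proof (intro equalityI subsetI)
  fix p assume "p \<in> I"
  then obtain r s t where "p = r * (var 0 * q) + s * (var 1 * q) + t * f" unfolding I_def ideal3_def by blast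
  then have "p = q * (r * var 0 + s * var 1 + 0 * 0) + f * t" by (simp add: algebra_simps)
  moreover have "r * var 0 + s * var 1 + 0 * 0 \<in> xy_ideal" unfolding ideal3_def by blast
  ultimately show "p \<in> {q * u + f * w | u w. u \<in> xy_ideal}" by blast
next
  fix p assume "p \<in> {q * u + f * w | u w. u \<in> xy_ideal}"
  then obtain r s w where "p = q * (r * var 0 + s * var 1) + f * w" unfolding ideal3_def by auto
  then have "p = r * (var 0 * q) + s * (var 1 * q) + w * f" by (simp add: algebra_simps)
  then show "p \<in> I" unfolding I_def ideal3_def by blast
qed

lemma I_forms:
  "I \<inter> forms (n + Suc (Suc m)) =
     {u + w | u w. u \<in> (*) q ` (xy_ideal \<inter> forms (Suc n)) \<and> w \<in> (*) f ` forms n}"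
proof (intro equalityI subsetI)
  fix p assume p: "p \<in> I \<inter> forms (n + Suc (Suc m))"
  then obtain r s w where eq: "p = q * (r * var 0 + s * var 1) + f * w" by (auto simp: I_eq ideal3_def)
  have "p = hcomp (n + Suc (Suc m)) p" using p hcomp_of_forms[of p "n + Suc (Suc m)" "n + Suc (Suc m)"] by auto
  also have "\<dots> = q * hcomp (Suc n) (r * var 0 + s * var 1) + f * hcomp n w"
    unfolding eq by (simp add: hcomp_add hcomp_mult_forms[OF q_forms] hcomp_mult_forms[OF f_forms] Suc_diff_le)
  finally have p_eq: "p = q * hcomp (Suc n) (r * var 0 + s * var 1) + f * hcomp n w" .
  have "hcomp (Suc n) (r * var 0 + s * var 1) = hcomp n r * var 0 + hcomp n s * var 1 + 0 * 0"
    by (simp add: hcomp_add mult.commute[of _ "var _"] hcomp_mult_forms[OF forms_var])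
  then have "hcomp (Suc n) (r * var 0 + s * var 1) \<in> xy_ideal" unfolding ideal3_def by blast
  then show "p \<in> {u + w | u w. u \<in> (*) q ` (xy_ideal \<inter> forms (Suc n)) \<and> w \<in> (*) f ` forms n}"
    using p_eq hcomp_forms by blast
next
  fix p assume "p \<in> {u + w | u w. u \<in> (*) q ` (xy_ideal \<inter> forms (Suc n)) \<and> w \<in> (*) f ` forms n}"
  then obtain u w where uw: "p = q * u + f * w" "u \<in> xy_ideal" "u \<in> forms (Suc n)" "w \<in> forms n" by blast
  have "q * u \<in> forms (n + Suc (Suc m))" "f * w \<in> forms (n + Suc (Suc m))"
    using forms_mult[OF q_forms uw(3)] forms_mult[OF f_forms uw(4)] by (simp_all add: add.commute)
  then show "p \<in> I \<inter> forms (n + Suc (Suc m))" using uw by (auto simp: I_eq intro: forms_add)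
qed

text \<open>
  If \<open>q u = f w\<close>, then \<open>q\<close> divides \<open>w\<close>. Conversely the multiples of \<open>q f\<close> are of both kinds because
  \<open>f\<close> vanishes at the vertex.
\<close>

lemma I_forms_Int:
  "(*) q ` (xy_ideal \<inter> forms (Suc (n + Suc m))) \<inter> (*) f ` forms (n + Suc m) = (*) (q * f) ` forms n"
proof (intro equalityI subsetI)
  fix p assume "p \<in> (*) q ` (xy_ideal \<inter> forms (Suc (n + Suc m))) \<inter> (*) f ` forms (n + Suc m)"
  then obtain u w where uw: "p = q * u" "p = f * w" "w \<in> forms (n + Suc m)" by blast
  then have "q dvd w * f" by (metis dvd_triv_left mult.commute)
  then have "q dvd w" by (rule q_dvd)
  then obtain v where v: "w = q * v" by (elim dvdE)
  show "p \<in> (*) (q * f) ` forms n"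
  proof (cases "w = 0")
    case True
    then show ?thesis using uw by (intro image_eqI[of _ _ 0]) auto
  next
    case False
    then obtain i where i: "i \<le> n + Suc m" "q \<in> forms i" "v \<in> forms (n + Suc m - i)"
      using uw(3) v by (metis forms_factor)
    then have "Suc m = i" using forms_unique[OF q_forms _ q_nz] by blast
    with i have "v \<in> forms n" by simp
    then show ?thesis using uw v by (intro image_eqI[of _ _ v]) (simp_all add: ac_simps)
  qed
next
  fix p assume "p \<in> (*) (q * f) ` forms n"
  then obtain v where v: "p = q * f * v" "v \<in> forms n" by blast
  have "f * v \<in> forms (Suc (n + Suc m))" "q * v \<in> forms (n + Suc m)"
    using forms_mult[OF f_forms v(2)] forms_mult[OF q_forms v(2)] by (simp_all add: add.commute)
  moreover have "f * v \<in> xy_ideal" by (rule is_ideal_mult2[OF is_ideal_ideal3 f_xy])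
  moreover have "p = q * (f * v)" "p = f * (q * v)" using v by (simp_all add: ac_simps)
  ultimately show "p \<in> (*) q ` (xy_ideal \<inter> forms (Suc (n + Suc m))) \<inter> (*) f ` forms (n + Suc m)" by blast
qed

text \<open>
  The dimension formula for the sum \<open>I_forms\<close> with intersection \<open>I_forms_Int\<close>. The argument
  ranges over all degrees from \<open>2 m + 3\<close> on, where every summand has nonnegative degree.
\<close>

lemma hilbert_function_eq: "hilbert_function I (n + Suc m + Suc (Suc m)) = Suc m * Suc (Suc m) + 1"
proof -
  let ?N = "n + Suc m + Suc (Suc m)"
  let ?U = "(*) q ` (xy_ideal \<inter> forms (Suc (n + Suc m)))" and ?W = "(*) f ` forms (n + Suc m)"
  have xy: "mp.subspace (xy_ideal \<inter> forms k :: (3, 'k) mpoly set)" for k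
    by (intro mp.subspace_inter subspace_ideal is_ideal_ideal3 subspace_forms)
  have "?U \<subseteq> forms ?N" using forms_mult[OF q_forms] by (fastforce simp: add.commute)
  moreover have "?W \<subseteq> forms ?N" using forms_mult[OF f_forms] by (fastforce simp: add.commute)
  ultimately have "mp.dim (I \<inter> forms ?N) + mp.dim (?U \<inter> ?W) = mp.dim ?U + mp.dim ?W"
    unfolding I_forms
    by (intro mp.dim_sum_Int[where D = "(\<lambda>m. Poly_Mapping.single m 1) ` mons ?N"] subspace_mult_image xy subspace_forms
        finite_imageI[OF finite_mons[of ?N]] order_trans[OF _ forms_span[of ?N]])
  then have "mp.dim (I \<inter> forms ?N) + card (mons n) + 1 = card (mons (Suc (n + Suc m))) + card (mons (n + Suc m))"
    unfolding I_forms_Int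
    using dim_xy_forms[of "Suc (n + Suc m)", where 'k = 'k] q_nz f_nz
    by (simp add: dim_mult_image subspace_forms xy dim_forms)
  moreover have "mp.dim (I \<inter> forms ?N) + hilbert_function I ?N = card (mons ?N)"
  proof -
    have "mp.dim (I \<inter> forms ?N) \<le> mp.dim (forms ?N :: (3, 'k) mpoly set)"
    proof -
      obtain B where B: "B \<subseteq> forms ?N" "mp.independent B" "(forms ?N :: (3, 'k) mpoly set) \<subseteq> mp.span B"
        by (rule mp.maximal_independent_subset)
      have "finite B" using mp.independent_span_bound[OF finite_imageI[OF finite_mons[of ?N]] B(2)] B(1) forms_span by blast
      then have "mp.dim (I \<inter> forms ?N) \<le> card B" by (intro mp.dim_le_card) (use B in auto)
      also have "card B = mp.dim (forms ?N :: (3, 'k) mpoly set)" using mp.dim_unique[OF B(1,3,2)] by simp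
      finally show ?thesis .
    qed
    then show ?thesis unfolding hilbert_function_def dim_forms by simp
  qed
  moreover have "x + c + 1 = a + b \<Longrightarrow> x + h = d \<Longrightarrow> 2 * (a + b + h) = 2 * (d + c + 1)" for x a b c d h :: nat
    by simp
  ultimately have "2 * (card (mons (Suc (n + Suc m))) + card (mons (n + Suc m)) + hilbert_function I ?N)
      = 2 * (card (mons ?N) + card (mons n) + 1)"
    by blast
  moreover note card_mons[of "Suc (n + Suc m)"] card_mons[of "n + Suc m"] card_mons[of ?N] card_mons[of n]
  ultimately show ?thesis by (simp add: algebra_simps)
qed

end

section \<open>A linear nonzerodivisor\<close>

lemma infinite_alg_closed: "infinite (UNIV :: 'k::alg_closed_field set)"
proof
  assume fin: "finite (UNIV :: 'k set)"
  let ?P = "\<Prod>a\<in>(UNIV :: 'k set). [:- a, 1:]"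
  have root: "poly ?P x = 0" for x
    unfolding poly_prod using fin by (auto intro: bexI[of _ x])
  have nz: "?P \<noteq> 0" by (simp add: prod_zero_iff[OF fin])
  have "Polynomial.degree (?P + 1) > 0"
  proof (rule ccontr)
    assume "\<not> Polynomial.degree (?P + 1) > 0"
    then obtain c where "?P + 1 = [:c:]" by (metis degree_eq_zeroE gr0I)
    then have "?P = [:c - 1:]" by (simp add: one_pCons eq_diff_eq[symmetric])
    then show False using root[of 0] nz by auto
  qed
  then obtain x where "poly (?P + 1) x = 0" using alg_closed_imp_poly_has_root by blast
  then show False using root by simp
qed

lemma mon_eval_forms:
  fixes g :: "'v::finite \<Rightarrow> ('w::finite, 'k::comm_ring_1) mpoly"
  assumes "\<And>i. g i \<in> forms 1"
  shows "mon_eval g m \<in> forms (weight UNIV m)"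
proof -
  have "(\<Prod>v\<in>A. g v ^ Poly_Mapping.lookup m v) \<in> forms (weight A m)" if "finite A" for A
    using that
  proof induction
    case empty
    show ?case using forms_cst[of "1::'k"] by (simp add: cst.one weight_def)
  next
    case (insert v A)
    have "g v ^ Poly_Mapping.lookup m v \<in> forms (Poly_Mapping.lookup m v)"
      using forms_power[OF assms, of v "Poly_Mapping.lookup m v"] by simp
    from forms_mult[OF this insert.IH] insert.hyps show ?case by (simp add: weight_def)
  qed
  from this[of UNIV] show ?thesis by (simp add: mon_eval_superset[of UNIV])
qed

lemma subst_forms:
  fixes g :: "'v::finite \<Rightarrow> ('w::finite, 'k::comm_ring_1) mpoly"
  assumes "\<And>i. g i \<in> forms 1" "p \<in> forms n"
  shows "subst cst g p \<in> forms n"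
  unfolding subst_alt
proof (intro forms_sum forms_cst_mult)
  fix m assume "m \<in> Poly_Mapping.keys p"
  then have "weight UNIV m = n" using assms(2) by (auto simp: forms_def tdeg_weight)
  then show "mon_eval g m \<in> forms n" using mon_eval_forms[of g m, OF assms(1)] by simp
qed

context normal_form
begin

text \<open>
  The point \<open>(s : t : w)\<close> is a common zero of \<open>q\<close> and \<open>f\<close>.
\<close>

definition "meets s t w \<longleftrightarrow> w * hev m q1 s t + hev (Suc m) q2 s t = 0 \<and>
  w * hev (Suc m) f1 s t + hev (Suc (Suc m)) f2 s t = 0"

lemma ev_q: "ev s t w q = w * hev m q1 s t + hev (Suc m) q2 s t"
  and ev_f: "ev s t w f = w * hev (Suc m) f1 s t + hev (Suc (Suc m)) f2 s t"
  unfolding q_eq f_eq by (simp_all add: ring_map.maps[OF ev_ring_map])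

lemma finite_meets:
  assumes "s \<noteq> 0 \<or> t \<noteq> 0" shows "finite {w. meets s t w}"
proof -
  have *: "finite {w. w * a + b = 0}" if "a \<noteq> 0" for a b :: 'k
    by (rule finite_subset[of _ "{- b / a}"]) (use that in \<open>auto simp: field_simps add_eq_0_iff\<close>)
  show ?thesis
  proof (cases "hev m q1 s t = 0 \<and> hev (Suc m) f1 s t = 0")
    case True
    then have "{w. meets s t w} = {}" using no_common_point[OF assms] by (auto simp: meets_def)
    then show ?thesis by simp
  next
    case False
    then show ?thesis
      using finite_subset[OF _ *[of "hev m q1 s t"], of "{w. meets s t w}"]
        finite_subset[OF _ *[of "hev (Suc m) f1 s t"], of "{w. meets s t w}"]
      by (auto simp: meets_def)
  qed
qed

text \<open>
  The resultant vanishes in the direction of every common zero. The direction \<open>(1 : 0)\<close> is left out.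
\<close>

lemma finite_meets_directions: "finite {s. \<exists>w. meets s 1 w}"
proof -
  obtain k c where c: "\<Delta> = bf k c" by (rule \<Delta>_binary)
  define h where "h = (\<Sum>i\<le>k. Polynomial.monom (c i) i)"
  have coeff_h: "coeff h i = (if i \<le> k then c i else 0)" for i
    by (simp add: h_def coeff_sum)
  have "h \<noteq> 0"
  proof
    assume "h = 0"
    then have "c i = 0" if "i \<le> k" for i using coeff_h[of i] that by simp
    then have "bf k c = 0" by (simp add: hev_def cst.zero)
    then show False using \<Delta>_nz c by simp
  qed
  moreover have "{s. \<exists>w. meets s 1 w} \<subseteq> {s. poly h s = 0}"
  proof clarify
    fix s w assume *: "meets s 1 w"
    have "poly h s = hev k c s 1" by (simp add: h_def poly_sum poly_monom hev_def)
    also have "\<dots> = ev s 1 w \<Delta>" by (simp add: c)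
    also have "\<dots> = 0" unfolding \<Delta>_eq using *
      by (simp add: ring_map.maps[OF ev_ring_map] ev_q ev_f meets_def)
    finally show "poly h s = 0" .
  qed
  ultimately show ?thesis using poly_roots_finite finite_subset by blast
qed

lemma meets_scale:
  assumes "meets (a * s) (a * t) (a * w)" "a \<noteq> 0" shows "meets s t w"
proof -
  have "a ^ Suc m * (w * hev m q1 s t + hev (Suc m) q2 s t) = a * w * hev m q1 (a * s) (a * t) + hev (Suc m) q2 (a * s) (a * t)"
    "a ^ Suc (Suc m) * (w * hev (Suc m) f1 s t + hev (Suc (Suc m)) f2 s t) = a * w * hev (Suc m) f1 (a * s) (a * t) + hev (Suc (Suc m)) f2 (a * s) (a * t)"
    unfolding hev_scale by (simp_all add: algebra_simps)
  then show ?thesis using assms by (auto simp: meets_def)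
qed

text \<open>
  The line \<open>w = \<alpha> s + \<beta> t\<close> has to avoid finitely many points other than the vertex. The choice of \<open>\<alpha>\<close>
  takes care of the points with \<open>t = 0\<close>, and then the choice of \<open>\<beta>\<close> of those with \<open>t = 1\<close>.
\<close>

lemma ex_line: "\<exists>\<alpha> \<beta>. \<forall>s t. (s \<noteq> 0 \<or> t \<noteq> 0) \<longrightarrow> \<not> meets s t (\<alpha> * s + \<beta> * t)"
proof -
  have fin: "finite {w. meets 1 0 w}" by (rule finite_meets) simp
  obtain \<alpha> where \<alpha>: "\<not> meets 1 0 \<alpha>"
    using ex_new_if_finite[OF infinite_alg_closed fin] by blast
  have fin: "finite (\<Union>s\<in>{s. \<exists>w. meets s 1 w}. (\<lambda>w. w - \<alpha> * s) ` {w. meets s 1 w})"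
    by (intro finite_UN_I finite_meets_directions finite_imageI finite_meets) simp
  obtain \<beta> where "\<beta> \<notin> (\<Union>s\<in>{s. \<exists>w. meets s 1 w}. (\<lambda>w. w - \<alpha> * s) ` {w. meets s 1 w})"
    using ex_new_if_finite[OF infinite_alg_closed fin] by blast
  then have \<beta>: "\<not> meets s 1 (\<alpha> * s + \<beta>)" for s
    by (auto simp: image_iff) (metis add_diff_cancel_left')
  have "\<not> meets s t (\<alpha> * s + \<beta> * t)" if "s \<noteq> 0 \<or> t \<noteq> 0" for s t
  proof
    assume *: "meets s t (\<alpha> * s + \<beta> * t)"
    show False
    proof (cases "t = 0")
      case True
      then have "meets (s * 1) (s * 0) (s * \<alpha>)" using * by (simp add: mult.commute)
      then have "meets 1 0 \<alpha>" by (rule meets_scale) (use that True in simp)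
      with \<alpha> show False by blast
    next
      case False
      then have "meets (t * (s / t)) (t * 1) (t * (\<alpha> * (s / t) + \<beta>))"
        using * by (simp add: algebra_simps)
      then have "meets (s / t) 1 (\<alpha> * (s / t) + \<beta>)" by (rule meets_scale) (rule False)
      with \<beta> show False by blast
    qed
  qed
  then show ?thesis by blast
qed

text \<open>
  Let \<open>l = z - b\<close> be the equation of a line without common zeros of \<open>q\<close> and \<open>f\<close>. Restriction to the line
  is the substitution \<open>\<kappa>\<close> of \<open>b\<close> for \<open>z\<close>, and \<open>\<kappa> q\<close>, \<open>\<kappa> f\<close> are binary forms without common root, hence
  coprime. If \<open>l u = q A + f B\<close>, then \<open>\<kappa> A = - \<kappa> f e\<close> and \<open>\<kappa> B = \<kappa> q e\<close> for some \<open>e\<close>, so \<open>(A, B)\<close> is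
  congruent to \<open>(- f e, q e)\<close> modulo \<open>l\<close>. Subtracting this trivial relation and cancelling \<open>l\<close> expresses
  \<open>u\<close> by \<open>q\<close> and \<open>f\<close>; the coefficient of \<open>q\<close> still vanishes at the vertex because \<open>l\<close> does not.
\<close>

theorem ex_linear_nonzerodivisor: "\<exists>l\<in>forms 1. \<forall>u. l * u \<in> I \<longrightarrow> u \<in> I"
proof -
  obtain \<alpha> \<beta> where avoid: "\<And>s t. s \<noteq> 0 \<or> t \<noteq> 0 \<Longrightarrow> \<not> meets s t (\<alpha> * s + \<beta> * t)"
    using ex_line by blast
  define b :: "(3, 'k) mpoly" where "b = cst \<alpha> * var 0 + cst \<beta> * var 1"
  define g where "g = (\<lambda>i::3. if i = 2 then b else var i)"
  define l where "l = var 2 - b"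
  define \<kappa> where "\<kappa> = subst cst g"
  interpret \<kappa>: ring_map \<kappa> unfolding \<kappa>_def by (rule subst_cst_map)
  have b_forms: "b \<in> forms 1" unfolding b_def by (intro forms_add forms_cst_mult forms_var)
  have l_forms: "l \<in> forms 1" unfolding l_def by (intro forms_diff b_forms forms_var)
  have \<kappa>_l: "\<kappa> l = 0"
    by (simp add: l_def \<kappa>.maps) (simp add: \<kappa>_def g_def b_def ring_map.maps[OF subst_cst_map])
  have l_dvd: "l dvd p - \<kappa> p" for p
    using dvd_diff_subst[of 2 g p] by (simp add: g_def l_def \<kappa>_def)
  have \<kappa>_forms: "\<kappa> p \<in> forms n" if "p \<in> forms n" for p n
    unfolding \<kappa>_def by (rule subst_forms[OF _ that]) (simp add: g_def b_forms[unfolded One_nat_def] forms_var[unfolded One_nat_def])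
  have \<kappa>_zdeg: "zdeg (\<kappa> p) = 0" for p
    unfolding \<kappa>_def
  proof (rule subst_zfree)
    have "zdeg b \<le> 0" unfolding b_def by (intro zdeg_add_le) (simp_all add: zdeg_free_mult zdeg_var)
    then show "zdeg (g i) = 0" for i by (simp add: g_def zdeg_var)
  qed
  have ev_\<kappa>: "ev s t w (\<kappa> p) = ev s t (\<alpha> * s + \<beta> * t) p" for s t w p
  proof (rule ring_map_eqI[OF ring_map_comp[OF \<kappa>.ring_map_axioms ev_ring_map] ev_ring_map])
    show "ev s t w (\<kappa> (cst c)) = ev s t (\<alpha> * s + \<beta> * t) (cst c)" for c by (simp add: \<kappa>_def)
    show "ev s t w (\<kappa> (var i)) = ev s t (\<alpha> * s + \<beta> * t) (var i)" for i
      using exhaust_3[of i] by (elim disjE) (simp_all add: \<kappa>_def g_def b_def ring_map.maps[OF ev_ring_map])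
  qed
  have no_root: False if "s \<noteq> 0 \<or> t \<noteq> 0" "ev s t 0 (\<kappa> q) = 0" "ev s t 0 (\<kappa> f) = 0" for s t
    using avoid[OF that(1)] that(2,3) by (simp add: ev_\<kappa> ev_q ev_f meets_def)
  have \<kappa>q_nz: "\<kappa> q \<noteq> 0"
  proof
    assume "\<kappa> q = 0"
    obtain c where c: "\<kappa> f = bf (Suc (Suc m)) c"
      using binary_form[OF \<kappa>_forms[OF f_forms] \<kappa>_zdeg] by blast
    obtain s t where st: "s \<noteq> 0 \<or> t \<noteq> 0" "hev (Suc (Suc m)) c s t = 0" by (rule hev_has_root)
    show False by (rule no_root[OF st(1)]) (simp_all add: \<open>\<kappa> q = 0\<close> c st(2) ring_map.zero[OF ev_ring_map])
  qed
  have \<kappa>_coprime: "h dvd 1" if h: "h dvd \<kappa> q" "h dvd \<kappa> f" for h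
  proof -
    obtain w where w: "\<kappa> q = h * w" using h(1) by (elim dvdE)
    then have nz: "h \<noteq> 0" "w \<noteq> 0" using \<kappa>q_nz by auto
    have "h * w \<in> forms (Suc m)" "h * w \<noteq> 0" using \<kappa>_forms[OF q_forms] \<kappa>q_nz w by simp_all
    then obtain k where k: "h \<in> forms k" by (rule forms_factor)
    have "zdeg h = 0" using zdeg_mult[OF nz] \<kappa>_zdeg[of q] w by simp
    then obtain c where c: "h = bf k c" using binary_form[OF k] by blast
    show ?thesis
    proof (cases k)
      case 0
      then have "h = cst (c 0)" "c 0 \<noteq> 0" using c nz by (auto simp: cst.zero)
      then have "h * cst (inverse (c 0)) = 1" by (simp add: cst.one flip: cst.mult)
      then show ?thesis by (metis dvd_triv_left)
    next
      case (Suc k')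
      obtain s t where st: "s \<noteq> 0 \<or> t \<noteq> 0" "hev (Suc k') c s t = 0" by (rule hev_has_root)
      have "ev s t 0 h = 0" by (simp add: c Suc st(2))
      then have "ev s t 0 (\<kappa> q) = 0" "ev s t 0 (\<kappa> f) = 0"
        using h by (auto elim!: dvdE simp: ring_map.mult[OF ev_ring_map])
      then show ?thesis using no_root[OF st(1)] by blast
    qed
  qed
  show ?thesis
  proof (intro bexI[of _ l] l_forms allI impI)
    fix u assume "l * u \<in> I"
    then obtain A B where A: "A \<in> xy_ideal" and lu: "l * u = q * A + f * B" by (auto simp: I_eq)
    have "\<kappa> (q * A + f * B) = 0" by (simp flip: lu add: \<kappa>.mult \<kappa>_l)
    then have eq: "\<kappa> q * \<kappa> A + \<kappa> f * \<kappa> B = 0" by (simp add: \<kappa>.maps)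
    then have "\<kappa> B * \<kappa> f = \<kappa> q * (- \<kappa> A)" by (simp add: add_eq_0_iff2 mult.commute)
    then have "\<kappa> q dvd \<kappa> B * \<kappa> f" by (rule dvdI)
    with \<kappa>q_nz \<kappa>_coprime have "\<kappa> q dvd \<kappa> B" by (rule no_common_factor_dvd)
    then obtain e where e: "\<kappa> B = \<kappa> q * e" by (elim dvdE)
    have "\<kappa> q * (\<kappa> A + \<kappa> f * e) = 0" using eq e by (simp add: algebra_simps)
    then have \<kappa>A: "\<kappa> A = - (\<kappa> f * e)" using \<kappa>q_nz by (simp add: add_eq_0_iff2)
    obtain a where a: "A = \<kappa> A + l * a" using l_dvd[of A] by (metis dvdE diff_eq_eq add.commute)
    obtain a' where a': "f = \<kappa> f + l * a'" using l_dvd[of f] by (metis dvdE diff_eq_eq add.commute)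
    obtain b' where b': "B = \<kappa> B + l * b'" using l_dvd[of B] by (metis dvdE diff_eq_eq add.commute)
    obtain c' where c': "q = \<kappa> q + l * c'" using l_dvd[of q] by (metis dvdE diff_eq_eq add.commute)
    define A2 where "A2 = a + a' * e"
    have A_eq: "A = - (f * e) + l * A2"
      by (subst a, subst \<kappa>A, subst a') (simp add: A2_def algebra_simps)
    have B_eq: "B = q * e + l * (b' - c' * e)"
      by (subst b', subst e, subst c') (simp add: algebra_simps)
    have "l * u = l * (q * A2 + f * (b' - c' * e))"
      unfolding lu by (subst A_eq, subst B_eq) (simp add: algebra_simps)
    moreover have l_nz: "l \<noteq> 0"
    proof
      assume "l = 0"
      then have "zdeg (var 2 :: (3, 'k) mpoly) = zdeg b" by (simp add: l_def)
      moreover have "zdeg b \<le> 0" unfolding b_def by (intro zdeg_add_le) (simp_all add: zdeg_free_mult zdeg_var)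
      ultimately show False by (simp add: zdeg_var)
    qed
    ultimately have u: "u = q * A2 + f * (b' - c' * e)" by simp
    let ?v = "subst cst (\<lambda>i::3. if i = 2 then var 2 else 0) :: (3, 'k) mpoly \<Rightarrow> (3, 'k) mpoly"
    interpret v: ring_map ?v by (rule subst_cst_map)
    have v_xy: "?v p = 0" if "p \<in> xy_ideal" for p
      using that by (auto simp: ideal3_def v.maps)
    have "l * A2 = A + e * f" by (subst A_eq) (simp add: algebra_simps)
    also have "\<dots> \<in> xy_ideal" by (intro is_ideal_add is_ideal_mult is_ideal_ideal3 A f_xy)
    finally have "?v l * ?v A2 = 0" using v_xy by (simp flip: v.mult)
    moreover have "?v l = var 2" by (simp add: l_def b_def v.maps)
    ultimately have "?v A2 = 0" by simp
    then have "A2 \<in> xy_ideal" using subst_at_vertex[of A2] by simp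
    then show "u \<in> I" using u by (auto simp: I_eq)
  qed
qed

end

section \<open>Hilbert's basis theorem\<close>

abbreviation gen :: "'a::comm_ring_1 set \<Rightarrow> 'a set" where
  "gen S \<equiv> Idl\<^bsub>ring_of_type_algebra\<^esub> S"

text \<open>
  The Noetherian property of a ring that is a whole type.
\<close>

definition all_fg :: "'a::comm_ring_1 itself \<Rightarrow> bool" where
  "all_fg _ \<longleftrightarrow> (\<forall>I::'a set. is_ideal I \<longrightarrow> (\<exists>S. finite S \<and> I = gen S))"

lemma gen_mono: "S \<subseteq> T \<Longrightarrow> gen S \<subseteq> gen T"
  by (rule genideal_type_minimal[OF is_ideal_genideal]) (rule order_trans[OF _ genideal_type_subset])

lemma gen_image_lessThan: "gen (a ` {..<N}) \<subseteq> {(\<Sum>i<N. c i * a i) | c. True}"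
  for a :: "nat \<Rightarrow> 'a::comm_ring_1"
proof (rule genideal_type_minimal)
  show "is_ideal {(\<Sum>i<N. c i * a i) | c. True}" unfolding is_ideal_def
  proof (intro conjI ballI allI)
    show "0 \<in> {(\<Sum>i<N. c i * a i) | c. True}" by (auto intro!: exI[of _ "\<lambda>_. 0"])
    show "x + y \<in> {(\<Sum>i<N. c i * a i) | c. True}"
      if xy: "x \<in> {(\<Sum>i<N. c i * a i) | c. True}" "y \<in> {(\<Sum>i<N. c i * a i) | c. True}" for x y
    proof -
      from xy obtain c c' where "x = (\<Sum>i<N. c i * a i)" "y = (\<Sum>i<N. c' i * a i)" by blast
      then have "x + y = (\<Sum>i<N. (c i + c' i) * a i)" by (simp add: distrib_right sum.distrib)
      then show ?thesis by (intro CollectI exI[of _ "\<lambda>i. c i + c' i"]) simp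
    qed
    show "r * x \<in> {(\<Sum>i<N. c i * a i) | c. True}" if x: "x \<in> {(\<Sum>i<N. c i * a i) | c. True}" for r x
    proof -
      from x obtain c where "x = (\<Sum>i<N. c i * a i)" by blast
      then have "r * x = (\<Sum>i<N. (r * c i) * a i)" by (simp add: sum_distrib_left mult.assoc)
      then show ?thesis by (intro CollectI exI[of _ "\<lambda>i. r * c i"]) simp
    qed
  qed
  show "a ` {..<N} \<subseteq> {(\<Sum>i<N. c i * a i) | c. True}"
  proof clarify
    fix j assume "j < N"
    then have "(\<Sum>i<N. if i = j then a i else 0) = a j" by (subst sum.delta) auto
    moreover have "(\<Sum>i<N. (if i = j then 1 else 0) * a i) = (\<Sum>i<N. if i = j then a i else 0)"
      by (rule sum.cong) auto
    ultimately have "a j = (\<Sum>i<N. (if i = j then 1 else 0) * a i)" by simp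
    then show "\<exists>c. a j = (\<Sum>i<N. c i * a i) \<and> True" by (intro exI[of _ "\<lambda>i. if i = j then 1 else 0"]) simp
  qed
qed

lemma all_fg_sequence:
  fixes a :: "nat \<Rightarrow> 'a::comm_ring_1"
  assumes "all_fg TYPE('a)"
  obtains N where "a N \<in> gen (a ` {..<N})"
proof -
  let ?U = "\<Union>N. gen (a ` {..<N})"
  have mono: "gen (a ` {..<N}) \<subseteq> gen (a ` {..<N'})" if "N \<le> N'" for N N'
    by (rule gen_mono) (use that in auto)
  have "is_ideal ?U" unfolding is_ideal_def
  proof (intro conjI ballI allI)
    show "0 \<in> ?U" using is_ideal_0[OF is_ideal_genideal] by blast
    show "x + y \<in> ?U" if xy: "x \<in> ?U" "y \<in> ?U" for x y
    proof -
      from xy obtain N N' where "x \<in> gen (a ` {..<N})" "y \<in> gen (a ` {..<N'})" by blast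
      then have "x \<in> gen (a ` {..<max N N'})" "y \<in> gen (a ` {..<max N N'})"
        using mono[of N "max N N'"] mono[of N' "max N N'"] by auto
      then show ?thesis using is_ideal_add[OF is_ideal_genideal] by blast
    qed
    show "r * x \<in> ?U" if "x \<in> ?U" for r x using that is_ideal_mult[OF is_ideal_genideal] by blast
  qed
  then obtain S where S: "finite S" "?U = gen S" using assms unfolding all_fg_def by blast
  have "\<exists>N. S' \<subseteq> gen (a ` {..<N})" if "finite S'" "S' \<subseteq> ?U" for S'
    using that
  proof induction
    case (insert x S')
    then obtain N N' where "S' \<subseteq> gen (a ` {..<N})" "x \<in> gen (a ` {..<N'})" by blast
    then show ?case using mono[of N "max N N'"] mono[of N' "max N N'"]
      by (intro exI[of _ "max N N'"]) auto
  qed auto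
  then obtain N where "S \<subseteq> gen (a ` {..<N})" using S genideal_type_subset by metis
  then have "?U \<subseteq> gen (a ` {..<N})" using S genideal_type_minimal[OF is_ideal_genideal] by metis
  moreover have "a N \<in> gen (a ` {..<Suc N})"
    using genideal_type_subset[of "a ` {..<Suc N}"] by auto
  then have "a N \<in> ?U" by (rule UN_I[OF UNIV_I])
  ultimately show ?thesis by (intro that[of N]) (rule subsetD)
qed

text \<open>
  If \<open>I\<close> is not finitely generated, choose \<open>h k\<close> of least degree in \<open>I\<close> outside the ideal generated by
  its predecessors. Some leading coefficient is a combination of earlier ones, and subtracting the
  corresponding combination of polynomials gives an element of smaller degree outside that ideal.
\<close>

theorem hilbert_basis:
  assumes fg: "all_fg TYPE('a::comm_ring_1)"
  shows "all_fg TYPE('a poly)"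
  unfolding all_fg_def
proof (intro allI impI)
  fix I :: "'a poly set" assume I: "is_ideal I"
  show "\<exists>S. finite S \<and> I = gen S"
  proof (rule ccontr)
    assume not_fg: "\<nexists>S. finite S \<and> I = gen S"
    define nxt where "nxt S = arg_min Polynomial.degree (\<lambda>p. p \<in> I - gen S)" for S
    define T where "T = rec_nat {} (\<lambda>_ S. insert (nxt S) S)"
    define h where "h k = nxt (T k)" for k
    have T_Suc: "T (Suc k) = insert (h k) (T k)" and T_0: "T 0 = {}" for k by (simp_all add: T_def h_def)
    have T_eq: "T k = h ` {..<k}" for k by (induction k) (simp_all add: T_0 T_Suc lessThan_Suc)
    have T_ne: "\<exists>p. p \<in> I - gen (T k)" if "T k \<subseteq> I" for k
    proof -
      have "gen (T k) \<subseteq> I" by (rule genideal_type_minimal[OF I that])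
      moreover have "finite (T k)" by (simp add: T_eq)
      ultimately show ?thesis using not_fg by blast
    qed
    have T_sub: "T k \<subseteq> I" for k
    proof (induction k)
      case (Suc k)
      then obtain p where "p \<in> I - gen (T k)" using T_ne by blast
      from arg_min_natI[of "\<lambda>p. p \<in> I - gen (T k)", OF this, of Polynomial.degree] have "h k \<in> I"
        by (simp add: h_def nxt_def)
      then show ?case using Suc by (simp add: T_Suc)
    qed (simp add: T_0)
    have h: "h k \<in> I - gen (T k)" for k
    proof -
      obtain p where "p \<in> I - gen (T k)" using T_ne[OF T_sub] by blast
      from arg_min_natI[of "\<lambda>p. p \<in> I - gen (T k)", OF this, of Polynomial.degree] show ?thesis
        by (simp add: h_def nxt_def)
    qed
    have h_min: "Polynomial.degree (h k) \<le> Polynomial.degree p" if "p \<in> I - gen (T k)" for k p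
      unfolding h_def nxt_def by (rule arg_min_nat_le) (rule that)
    have T_mono: "gen (T i) \<subseteq> gen (T k)" if "i \<le> k" for i k
      by (rule gen_mono) (use that in \<open>auto simp: T_eq\<close>)
    obtain N where "lead_coeff (h N) \<in> gen ((\<lambda>k. lead_coeff (h k)) ` {..<N})"
      using all_fg_sequence[OF fg, of "\<lambda>k. lead_coeff (h k)"] by blast
    then obtain c where c: "lead_coeff (h N) = (\<Sum>i<N. c i * lead_coeff (h i))"
      using gen_image_lessThan[of "\<lambda>k. lead_coeff (h k)" N] by blast
    define dg where "dg k = Polynomial.degree (h k)" for k
    have dg: "dg i \<le> dg N" if "i < N" for i
      unfolding dg_def by (rule h_min) (use h[of N] T_mono[of i N] that in auto)
    define g where "g = (\<Sum>i<N. Polynomial.monom (c i) (dg N - dg i) * h i)"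
    have g_gen: "g \<in> gen (T N)" unfolding g_def T_eq
      by (intro is_ideal_sum is_ideal_mult is_ideal_genideal)
        (use genideal_type_subset[of "h ` {..<N}"] in auto)
    have "coeff (Polynomial.monom (c i) (dg N - dg i) * h i) (dg N) = c i * lead_coeff (h i)" if "i < N" for i
      using dg[OF that] by (simp add: coeff_monom_mult dg_def)
    then have "coeff g (dg N) = lead_coeff (h N)" by (simp add: g_def coeff_sum c)
    then have coeff0: "coeff (h N - g) (dg N) = 0" by (simp add: dg_def)
    have "Polynomial.degree (Polynomial.monom (c i) (dg N - dg i) * h i) \<le> dg N" if "i < N" for i
      using dg[OF that] degree_mult_le[of "Polynomial.monom (c i) (dg N - dg i)" "h i"]
        degree_monom_le[of "c i" "dg N - dg i"] by (simp add: dg_def)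
    then have "Polynomial.degree g \<le> dg N" unfolding g_def by (intro degree_sum_le) auto
    then have deg_le: "Polynomial.degree (h N - g) \<le> dg N" by (intro degree_diff_le) (simp_all add: dg_def)
    have "h N - g \<notin> gen (T N)" using is_ideal_add[OF is_ideal_genideal _ g_gen, of "h N - g"] h[of N] by auto
    moreover have "h N - g \<in> I"
      using h[of N] g_gen genideal_type_minimal[OF I T_sub] by (intro is_ideal_diff[OF I]) auto
    ultimately have "dg N \<le> Polynomial.degree (h N - g)" unfolding dg_def by (intro h_min) auto
    with deg_le have "Polynomial.degree (h N - g) = dg N" by (rule le_antisym)
    with coeff0 have "lead_coeff (h N - g) = 0" by (simp only:)
    then have "h N - g = 0" by (simp only: leading_coeff_0_iff)
    then show False using h[of N] g_gen by simp
  qed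
qed

lemma all_fg_field: "all_fg TYPE('k::field)"
  unfolding all_fg_def
proof (intro allI impI)
  fix I :: "'k set" assume I: "is_ideal I"
  show "\<exists>S. finite S \<and> I = gen S"
  proof (cases "I \<subseteq> {0}")
    case True
    then have "I = gen {}" using I genideal_type_minimal[OF I, of "{}"] is_ideal_0[OF is_ideal_genideal, of "{}"] is_ideal_0[OF I] by blast
    then show ?thesis by blast
  next
    case False
    then obtain a where "a \<in> I" "a \<noteq> 0" by blast
    then have "1 \<in> I" using is_ideal_mult[OF I, of a "inverse a"] by simp
    then have "gen {1} \<subseteq> I" by (intro genideal_type_minimal I) simp
    moreover have "r \<in> gen {1}" for r :: 'k
      using is_ideal_mult[OF is_ideal_genideal, of 1 "{1}" r] genideal_type_subset[of "{1::'k}"] by simp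
    ultimately have "I = gen {1}" by blast
    then show ?thesis by blast
  qed
qed

lemma all_fg_mpoly: "all_fg TYPE((3, 'k::field) mpoly)"
  unfolding all_fg_def
proof (intro allI impI)
  fix I :: "(3, 'k) mpoly set" assume I: "is_ideal I"
  interpret ring_map iterated by (rule ring_map_iterated)
  have image: "is_ideal (iterated ` J)" if J: "is_ideal J" for J :: "(3, 'k) mpoly set"
    unfolding is_ideal_def
  proof (intro conjI ballI allI)
    show "0 \<in> iterated ` J" using is_ideal_0[OF J] zero by force
    show "x + y \<in> iterated ` J" if xy: "x \<in> iterated ` J" "y \<in> iterated ` J" for x y
      using xy is_ideal_add[OF J] by (auto simp flip: add)
    show "r * x \<in> iterated ` J" if x: "x \<in> iterated ` J" for r x
    proof -
      obtain r' where "r = iterated r'" using surjD[OF surj_iterated] by blast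
      then show ?thesis using x is_ideal_mult[OF J] by (auto simp flip: mult)
    qed
  qed
  have "all_fg TYPE('k field_copy poly poly poly)"
    by (intro hilbert_basis all_fg_field)
  then obtain S where S: "finite S" "iterated ` I = gen S"
    using image[OF I] unfolding all_fg_def by blast
  then have "S \<subseteq> iterated ` I" using genideal_type_subset by blast
  then obtain S' where S': "S' \<subseteq> I" "finite S'" "S = iterated ` S'"
    using finite_subset_image[OF S(1)] by blast
  have "gen S \<subseteq> iterated ` gen S'"
    unfolding S'(3) by (intro genideal_type_minimal image is_ideal_genideal image_mono genideal_type_subset)
  then have "iterated ` I \<subseteq> iterated ` gen S'" using S(2) by simp
  then have "I \<subseteq> gen S'" by (simp only: inj_image_subset_iff[OF inj_iterated])
  then have "I = gen S'" using genideal_type_minimal[OF I S'(1)] by (rule equalityI)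
  then show "\<exists>S. finite S \<and> I = gen S" using S'(2) by (intro exI conjI)
qed

section \<open>Primes avoiding a nonzerodivisor\<close>

text \<open>
  A nonzerodivisor modulo \<open>J\<close> lies in no minimal prime of \<open>J\<close>, and this remains true after localizing at
  \<open>M\<close>. Localization is avoided: an ideal over \<open>J\<close> that is maximal among those disjoint from the
  multiplicative set \<open>T\<close> generated by \<open>r\<close> and the complement of \<open>M\<close> is prime. Applied repeatedly, this
  turns a regular sequence in \<open>M\<close> into a chain of primes.
\<close>

lemma prime_avoiding_nonzerodivisor:
  fixes M J :: "'a::comm_ring_1 set"
  assumes M: "is_prime M" and J: "is_ideal J" "J \<subseteq> M" and r: "\<And>b. r * b \<in> J \<Longrightarrow> b \<in> J"
  obtains P where "is_prime P" "J \<subseteq> P" "P \<subseteq> M" "r \<notin> P"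
proof -
  define T where "T = {r ^ i * s | i s. s \<notin> M}"
  have T_mult: "x * y \<in> T" if "x \<in> T" "y \<in> T" for x y
  proof -
    from that obtain i s j t where "x = r ^ i * s" "s \<notin> M" "y = r ^ j * t" "t \<notin> M" unfolding T_def by blast
    then have "x * y = r ^ (i + j) * (s * t)" "s * t \<notin> M"
      using is_prime_mult[OF M, of s t] by (auto simp: power_add ac_simps)
    then show ?thesis unfolding T_def by blast
  qed
  have T_M: "s \<in> T" if "s \<notin> M" for s 
  proof -
    have "s = r ^ 0 * s" by simp
    with that show ?thesis unfolding T_def by blast
  qed
  have T_r: "r \<in> T"
  proof -
    have "r = r ^ 1 * 1" by simp
    with is_prime_1[OF M] show ?thesis unfolding T_def by blast
  qed
  have pow: "b \<in> J" if "r ^ i * b \<in> J" for i b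
    using that by (induction i) (auto simp: mult.assoc dest: r)
  define \<F> where "\<F> = {N. is_ideal N \<and> J \<subseteq> N \<and> N \<inter> T = {}}"
  have J_mem: "J \<in> \<F>" unfolding \<F>_def T_def using J pow by blast
  have "\<exists>P\<in>\<F>. \<forall>N\<in>\<F>. P \<subseteq> N \<longrightarrow> N = P"
  proof (rule subset_Zorn_nonempty)
    show "\<F> \<noteq> {}" using J_mem by blast
    fix C assume C: "C \<noteq> {}" "subset.chain \<F> C"
    have sub: "N \<in> \<F>" if "N \<in> C" for N using C(2) that by (auto simp: subset.chain_def)
    have "is_ideal (\<Union>C)" unfolding is_ideal_def
    proof (intro conjI ballI allI)
      show "0 \<in> \<Union>C" using C(1) sub is_ideal_0 unfolding \<F>_def by blast
      show "x + y \<in> \<Union>C" if xy: "x \<in> \<Union>C" "y \<in> \<Union>C" for x y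
      proof -
        from xy obtain N N' where N: "N \<in> C" "N' \<in> C" "x \<in> N" "y \<in> N'" by blast
        then have "N \<subseteq> N' \<or> N' \<subseteq> N" using C(2) by (auto simp: subset_chain_def)
        then have "\<exists>N\<in>C. x \<in> N \<and> y \<in> N" using N by blast
        then show ?thesis using sub is_ideal_add unfolding \<F>_def by blast
      qed
      show "a * x \<in> \<Union>C" if x: "x \<in> \<Union>C" for a x
        using x sub is_ideal_mult unfolding \<F>_def by blast
    qed
    then show "\<Union>C \<in> \<F>" using C(1) sub unfolding \<F>_def by blast
  qed
  then obtain P where P: "P \<in> \<F>" and max: "\<And>N. N \<in> \<F> \<Longrightarrow> P \<subseteq> N \<Longrightarrow> N = P" by blast
  have iP: "is_ideal P" "J \<subseteq> P" "P \<inter> T = {}" using P unfolding \<F>_def by auto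
  have meet: "\<exists>p\<in>P. \<exists>x. p + a * x \<in> T" if "a \<notin> P" for a
  proof (rule ccontr)
    assume no: "\<not> (\<exists>p\<in>P. \<exists>x. p + a * x \<in> T)"
    let ?Z = "{p + a * x | p x. p \<in> P}"
    have Z: "is_ideal ?Z" unfolding is_ideal_def
    proof (intro conjI ballI allI)
      have "0 = 0 + a * 0" by simp
      then show "0 \<in> ?Z" using is_ideal_0[OF iP(1)] by blast
      show "u + v \<in> ?Z" if uv: "u \<in> ?Z" "v \<in> ?Z" for u v
      proof -
        from uv obtain p x p' x' where "u = p + a * x" "v = p' + a * x'" "p \<in> P" "p' \<in> P" by blast
        then have "u + v = (p + p') + a * (x + x')" "p + p' \<in> P"
          using is_ideal_add[OF iP(1)] by (auto simp: algebra_simps)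
        then show ?thesis by blast
      qed
      show "c * u \<in> ?Z" if u: "u \<in> ?Z" for c u
      proof -
        from u obtain p x where "u = p + a * x" "p \<in> P" by blast
        then have "c * u = c * p + a * (c * x)" "c * p \<in> P"
          using is_ideal_mult[OF iP(1)] by (simp_all add: distrib_left mult.left_commute)
        then show ?thesis by blast
      qed
    qed
    have PX: "P \<subseteq> ?Z"
    proof
      fix p assume "p \<in> P"
      moreover have "p = p + a * 0" by simp
      ultimately show "p \<in> ?Z" by blast
    qed
    have "?Z \<in> \<F>" unfolding \<F>_def using Z PX iP(2) no by blast
    from max[OF this PX] have "?Z = P" .
    moreover have "a = 0 + a * 1" by simp
    then have "a \<in> ?Z" using is_ideal_0[OF iP(1)] by blast
    ultimately show False using that by simp
  qed
  show ?thesis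
  proof (rule that)
    show "J \<subseteq> P" by fact
    show "P \<subseteq> M" using iP(3) T_M by blast
    show "r \<notin> P" using iP(3) T_r by blast
    show "is_prime P" unfolding is_prime_def
    proof (intro conjI allI impI iP(1))
      show "1 \<notin> P" using iP(3) T_M[OF is_prime_1[OF M]] by blast
      fix a b assume ab: "a * b \<in> P"
      show "a \<in> P \<or> b \<in> P"
      proof (rule ccontr)
        assume "\<not> (a \<in> P \<or> b \<in> P)"
        then obtain p x p' y where T: "p \<in> P" "p + a * x \<in> T" "p' \<in> P" "p' + b * y \<in> T"
          using meet[of a] meet[of b] by blast
        have "(p + a * x) * (p' + b * y) = (p' + b * y) * p + (a * x) * p' + (x * y) * (a * b)"
          by (simp add: algebra_simps)
        also have "\<dots> \<in> P" by (intro is_ideal_add is_ideal_mult iP(1) T ab)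
        finally show False using T_mult[OF T(2,4)] iP(3) by blast
      qed
    qed
  qed
qed

section \<open>Cohen--Macaulay quotients of dimension one\<close>

locale quotient_by =
  fixes I :: "'a::comm_ring_1 set"
  assumes I: "is_ideal I"
begin

abbreviation "A \<equiv> ring_of_type_algebra Quot I"

abbreviation cls :: "'a \<Rightarrow> 'a set" where
  "cls r \<equiv> I +>\<^bsub>ring_of_type_algebra\<^esub> r"

lemma idealI: "ideal I ring_of_type_algebra" using I by (simp add: ideal_type_iff)

lemma cring_A: "cring A"
  by (rule ideal.quotient_is_cring[OF idealI type_ring_cring])

lemma cls_eq: "cls r = {i + r | i. i \<in> I}"
  by (auto simp: a_r_coset_def r_coset_def)

lemma cls_eq_iff: "cls r = cls s \<longleftrightarrow> r - s \<in> I"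
proof
  assume "cls r = cls s"
  moreover have "r = 0 + r" by simp
  then have "r \<in> cls r" unfolding cls_eq using is_ideal_0[OF I] by blast
  ultimately obtain i where "i \<in> I" "r = i + s" unfolding cls_eq by blast
  then show "r - s \<in> I" by simp
next
  have sub: "cls r \<subseteq> cls s" if "r - s \<in> I" for r s
  proof
    fix x assume "x \<in> cls r"
    then obtain i where "i \<in> I" "x = i + r" unfolding cls_eq by blast
    then have "x = (i + (r - s)) + s" "i + (r - s) \<in> I" using is_ideal_add[OF I] that by auto
    then show "x \<in> cls s" unfolding cls_eq by blast
  qed
  assume "r - s \<in> I"
  then show "cls r = cls s" using sub[of r s] sub[of s r] is_ideal_uminus[OF I, of "r - s"] by auto
qed

lemma carrier_A: "carrier A = range cls"
  by (auto simp: FactRing_def A_RCOSETS_def RCOSETS_def a_r_coset_def)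

lemma cls_hom: "cls \<in> ring_hom ring_of_type_algebra A"
  using ideal.rcos_ring_hom[OF idealI] .

lemma cls_mult: "cls r \<otimes>\<^bsub>A\<^esub> cls s = cls (r * s)"
  and cls_add: "cls r \<oplus>\<^bsub>A\<^esub> cls s = cls (r + s)"
  and cls_one: "\<one>\<^bsub>A\<^esub> = cls 1"
  using ring_hom_mult[OF cls_hom, of r s] ring_hom_add[OF cls_hom, of r s] ring_hom_one[OF cls_hom] by simp_all

lemma cls_zero: "\<zero>\<^bsub>A\<^esub> = cls 0"
proof -
  have "\<zero>\<^bsub>A\<^esub> = I" by (simp add: FactRing_def)
  also have "I = cls 0" by (simp add: cls_eq)
  finally show ?thesis .
qed

text \<open>
  Ideals of the quotient ring are studied through their inverse images, which are ideals over \<open>I\<close>.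
\<close>

definition pull :: "'a set set \<Rightarrow> 'a set" where "pull Q = {r. cls r \<in> Q}"

lemma mem_pull: "r \<in> pull Q \<longleftrightarrow> cls r \<in> Q" by (simp add: pull_def)

lemma cls_pull: "Q \<subseteq> carrier A \<Longrightarrow> cls ` pull Q = Q"
  unfolding carrier_A pull_def by auto

lemma ideal_subset_A: "ideal Q A \<Longrightarrow> Q \<subseteq> carrier A"
  using additive_subgroup.a_subset[OF ideal.axioms(1)] .

lemma pull_ideal:
  assumes "ideal Q A" shows "is_ideal (pull Q)" "I \<subseteq> pull Q"
proof -
  interpret Q: ideal Q A by fact
  have zero: "cls 0 \<in> Q" using additive_subgroup.zero_closed[OF Q.is_additive_subgroup] by (simp add: cls_zero)
  show "is_ideal (pull Q)" unfolding is_ideal_def mem_pull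
  proof (intro conjI ballI allI zero)
    show "cls (a + b) \<in> Q" if "a \<in> pull Q" "b \<in> pull Q" for a b
      using additive_subgroup.a_closed[OF Q.is_additive_subgroup] that by (simp add: mem_pull flip: cls_add)
    show "cls (r * a) \<in> Q" if "a \<in> pull Q" for r a
      using Q.I_l_closed[of "cls a" "cls r"] that by (simp add: mem_pull carrier_A cls_mult)
  qed
  show "I \<subseteq> pull Q"
  proof
    fix i assume "i \<in> I"
    then have "cls i = cls 0" by (simp add: cls_eq_iff)
    then show "i \<in> pull Q" using zero by (simp add: mem_pull)
  qed
qed

lemma push_ideal:
  assumes "is_ideal N" shows "ideal (cls ` N) A"
proof -
  interpret A: cring A by (rule cring_A)
  have neg: "\<ominus>\<^bsub>A\<^esub> cls a = cls (- a)" for a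
    by (rule A.minus_equality) (auto simp: cls_add cls_zero carrier_A)
  have inv: "inv\<^bsub>add_monoid A\<^esub> cls a = cls (- a)" for a
    using neg[of a] by (simp only: a_inv_def)
  show ?thesis
  proof (intro Ideal.idealI A.ring_axioms)
    show "subgroup (cls ` N) (add_monoid A)"
    proof (rule subgroup.intro)
      show "cls ` N \<subseteq> carrier (add_monoid A)" by (auto simp: carrier_A)
      show "x \<otimes>\<^bsub>add_monoid A\<^esub> y \<in> cls ` N" if "x \<in> cls ` N" "y \<in> cls ` N" for x y
        using that is_ideal_add[OF assms] by (auto simp: cls_add)
      show "\<one>\<^bsub>add_monoid A\<^esub> \<in> cls ` N" using is_ideal_0[OF assms] by (simp add: cls_zero)
      show "inv\<^bsub>add_monoid A\<^esub> x \<in> cls ` N" if "x \<in> cls ` N" for x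
        using that is_ideal_uminus[OF assms] by (auto simp only: inv)
    qed
    show "x \<otimes>\<^bsub>A\<^esub> a \<in> cls ` N" "a \<otimes>\<^bsub>A\<^esub> x \<in> cls ` N" if "a \<in> cls ` N" "x \<in> carrier A" for a x
      using that is_ideal_mult[OF assms] is_ideal_mult2[OF assms] by (auto simp: carrier_A cls_mult)
  qed
qed

lemma pull_push: "is_ideal N \<Longrightarrow> I \<subseteq> N \<Longrightarrow> pull (cls ` N) = N"
proof (intro equalityI subsetI)
  assume N: "is_ideal N" "I \<subseteq> N"
  show "r \<in> N" if "r \<in> pull (cls ` N)" for r
  proof -
    from that obtain s where "s \<in> N" "r - s \<in> I" by (auto simp: mem_pull cls_eq_iff)
    then show ?thesis using cong_mem[OF N(1)] N(2) by blast
  qed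
qed (simp add: mem_pull)

lemma pull_prime: "primeideal Q A \<Longrightarrow> is_prime (pull Q)"
proof -
  assume Q: "primeideal Q A"
  interpret Q: primeideal Q A by fact
  have "cls 1 \<notin> Q" using Q.I_notcarr Q.one_imp_carrier by (auto simp: cls_one)
  moreover have "cls a \<in> Q \<or> cls b \<in> Q" if "cls (a * b) \<in> Q" for a b
    using Q.I_prime[of "cls a" "cls b"] that by (auto simp: carrier_A cls_mult)
  ultimately show ?thesis using pull_ideal(1)[OF Q.is_ideal] by (auto simp: is_prime_def mem_pull)
qed

lemma push_prime: "is_prime P \<Longrightarrow> I \<subseteq> P \<Longrightarrow> primeideal (cls ` P) A"
proof -
  assume P: "is_prime P" "I \<subseteq> P"
  note pp = pull_push[OF is_prime_ideal[OF P(1)] P(2)]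
  show ?thesis
  proof (rule primeidealI[OF push_ideal[OF is_prime_ideal[OF P(1)]] cring_A])
    show "carrier A \<noteq> cls ` P"
    proof
      assume "carrier A = cls ` P"
      then have "cls 1 \<in> cls ` P" by (auto simp: carrier_A)
      then show False using pp is_prime_1[OF P(1)] mem_pull by blast
    qed
    fix a b assume ab: "a \<in> carrier A" "b \<in> carrier A" "a \<otimes>\<^bsub>A\<^esub> b \<in> cls ` P"
    then obtain r s where rs: "a = cls r" "b = cls s" by (auto simp: carrier_A)
    then have "r * s \<in> P" using ab(3) pp by (simp add: cls_mult flip: mem_pull)
    then show "a \<in> cls ` P \<or> b \<in> cls ` P" using is_prime_mult[OF P(1)] rs by blast
  qed
qed

lemma pull_mono_strict: "Q \<subset> Q' \<Longrightarrow> Q' \<subseteq> carrier A \<Longrightarrow> pull Q \<subset> pull Q'"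
proof
  assume Q: "Q \<subset> Q'" "Q' \<subseteq> carrier A"
  then show "pull Q \<subseteq> pull Q'" by (auto simp: pull_def)
  obtain x where x: "x \<in> Q'" "x \<notin> Q" using Q(1) by blast
  then obtain r where "x = cls r" using Q(2) by (auto simp: carrier_A)
  then have "r \<in> pull Q'" "r \<notin> pull Q" using x by (simp_all add: mem_pull)
  then show "pull Q \<noteq> pull Q'" by blast
qed

lemma noetherian_A: "all_fg TYPE('a) \<Longrightarrow> noetherian_ring A"
proof -
  assume fg: "all_fg TYPE('a)"
  interpret A: cring A by (rule cring_A)
  show ?thesis
  proof (rule A.noetherian_ringI)
    fix Q assume Q: "ideal Q A"
    obtain S where S: "finite S" "pull Q = gen S"
      using fg pull_ideal(1)[OF Q] unfolding all_fg_def by blast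
    have SA: "cls ` S \<subseteq> carrier A" by (auto simp: carrier_A)
    have "S \<subseteq> pull Q" unfolding S(2) by (rule genideal_type_subset)
    then have "cls ` S \<subseteq> Q" by (auto simp: mem_pull)
    then have 1: "Idl\<^bsub>A\<^esub> (cls ` S) \<subseteq> Q" by (rule A.genideal_minimal[OF Q])
    have id: "ideal (Idl\<^bsub>A\<^esub> (cls ` S)) A" by (rule A.genideal_ideal[OF SA])
    have "S \<subseteq> pull (Idl\<^bsub>A\<^esub> (cls ` S))" using A.genideal_self[OF SA] by (auto simp: mem_pull)
    then have "pull Q \<subseteq> pull (Idl\<^bsub>A\<^esub> (cls ` S))" unfolding S(2)
      by (rule genideal_type_minimal[OF pull_ideal(1)[OF id]])
    then have "cls ` pull Q \<subseteq> cls ` pull (Idl\<^bsub>A\<^esub> (cls ` S))" by (rule image_mono)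
    then have "Q \<subseteq> Idl\<^bsub>A\<^esub> (cls ` S)"
      by (simp only: cls_pull[OF ideal_subset_A[OF Q]] cls_pull[OF ideal_subset_A[OF id]])
    with 1 have "Q = Idl\<^bsub>A\<^esub> (cls ` S)" by simp
    with SA S(1) show "\<exists>B\<subseteq>carrier A. finite B \<and> Q = Idl\<^bsub>A\<^esub> B"
      by (intro exI[of _ "cls ` S"]) simp
  qed
qed

text \<open>
  Every maximal ideal has depth and height one. The nonzerodivisor \<open>r\<close> is a regular sequence of length
  one, and a prime over \<open>I\<close> that avoids it shows that the height is positive. Chains of three primes are
  excluded by hypothesis, and a regular sequence of length two would produce one by two applications of
  \<open>prime_avoiding_nonzerodivisor\<close>.
\<close>

theorem cohen_macaulay_dim_1:
  assumes fg: "all_fg TYPE('a)"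
    and dim: "\<And>P0 P1 P2. is_prime P0 \<Longrightarrow> is_prime P1 \<Longrightarrow> is_prime P2 \<Longrightarrow> I \<subseteq> P0 \<Longrightarrow> P0 \<subset> P1 \<Longrightarrow> P1 \<subset> P2 \<Longrightarrow> False"
    and depth: "\<And>M. is_prime M \<Longrightarrow> I \<subseteq> M \<Longrightarrow> (\<And>N. is_ideal N \<Longrightarrow> M \<subseteq> N \<Longrightarrow> 1 \<notin> N \<Longrightarrow> N = M) \<Longrightarrow>
      \<exists>r\<in>M. \<forall>b. r * b \<in> I \<longrightarrow> b \<in> I"
  shows "cohen_macaulay A"
  unfolding cohen_macaulay_def
proof (intro conjI allI impI cring_A noetherian_A fg)
  interpret A: cring A by (rule cring_A)
  fix M assume M: "maximalideal M A"
  interpret M: maximalideal M A by fact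
  have prime_M: "primeideal M A" by (rule A.maximalideal_prime[OF M])
  let ?M = "pull M"
  note pM = pull_prime[OF prime_M] and IM = pull_ideal(2)[OF M.is_ideal]
  have max: "N = ?M" if N: "is_ideal N" "?M \<subseteq> N" "1 \<notin> N" for N
  proof -
    have IN: "I \<subseteq> N" using IM N(2) by blast
    have "M = cls ` ?M" using cls_pull[OF ideal_subset_A[OF M.is_ideal]] by simp
    then have "M \<subseteq> cls ` N" using N(2) by blast
    moreover have "cls ` N \<subseteq> carrier A" by (auto simp: carrier_A)
    ultimately have "cls ` N = M \<or> cls ` N = carrier A" by (rule M.I_maximal[OF push_ideal[OF N(1)]])
    moreover have "cls ` N \<noteq> carrier A"
    proof
      assume "cls ` N = carrier A"
      then have "cls 1 \<in> cls ` N" by (simp add: carrier_A)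
      then show False using N(3) pull_push[OF N(1) IN] mem_pull by blast
    qed
    ultimately have "pull (cls ` N) = ?M" by simp
    then show ?thesis using pull_push[OF N(1) IN] by simp
  qed
  obtain r where r: "r \<in> ?M" "\<And>b. r * b \<in> I \<Longrightarrow> b \<in> I"
    using depth[OF pM IM max] by blast
  have Idl_empty: "cls b \<in> Idl\<^bsub>A\<^esub> {} \<longleftrightarrow> b \<in> I" for b
  proof -
    have "Idl\<^bsub>A\<^esub> {} = {\<zero>\<^bsub>A\<^esub>}"
      using A.genideal_minimal[OF A.zeroideal, of "{}"]
        additive_subgroup.zero_closed[OF ideal.axioms(1)[OF A.genideal_ideal[of "{}"]]] by auto
    then show ?thesis by (simp add: cls_zero cls_eq_iff)
  qed
  have height: "prime_height A M = 1"
  proof (rule antisym)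
    show "prime_height A M \<le> 1" unfolding prime_height_def
    proof (rule Sup_least)
      fix x assume "x \<in> {enat n |n. \<exists>Q :: nat \<Rightarrow> 'a set set.
        (\<forall>i\<le>n. primeideal (Q i) A) \<and> (\<forall>i<n. Q i \<subset> Q (Suc i)) \<and> Q n = M}"
      then obtain n and Q :: "nat \<Rightarrow> 'a set set" where
        Q: "\<forall>i\<le>n. primeideal (Q i) A" "\<forall>i<n. Q i \<subset> Q (Suc i)" and x: "x = enat n" by blast
      show "x \<le> 1" unfolding x
      proof (rule ccontr)
        assume "\<not> enat n \<le> 1"
        then have n: "2 \<le> n" by (simp add: one_enat_def)
        have carr: "Q i \<subseteq> carrier A" if "i \<le> n" for i
          using Q(1) that ideal_subset_A primeideal.axioms(1) by blast
        have 1: "pull (Q 0) \<subset> pull (Q 1)" using Q(2) carr[of 1] n by (intro pull_mono_strict) auto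
        have 2: "pull (Q 1) \<subset> pull (Q 2)"
          using Q(2)[rule_format, of 1] carr[of 2] n by (intro pull_mono_strict) (auto simp: numeral_2_eq_2)
        have "I \<subseteq> pull (Q 0)" using Q(1) pull_ideal(2) primeideal.axioms(1) by blast
        then show False
          using dim[of "pull (Q 0)" "pull (Q 1)" "pull (Q 2)"] 1 2 Q(1) n pull_prime by (meson le0 one_le_numeral order_trans)
      qed
    qed
    obtain P where P: "is_prime P" "I \<subseteq> P" "P \<subseteq> ?M" "r \<notin> P"
      by (rule prime_avoiding_nonzerodivisor[OF pM I IM r(2)])
    have "cls ` P \<subset> M"
    proof
      show "cls ` P \<subseteq> M" using P(3) by (auto simp: mem_pull)
      show "cls ` P \<noteq> M"
        using r(1) P(4) pull_push[OF is_prime_ideal[OF P(1)] P(2)] mem_pull by blast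
    qed
    then have "\<exists>Q. (\<forall>i\<le>1. primeideal (Q i) A) \<and> (\<forall>i<1. Q i \<subset> Q (Suc i)) \<and> Q 1 = M"
      using push_prime[OF P(1,2)] prime_M
      by (intro exI[of _ "\<lambda>i. if i = 0 then cls ` P else M"]) (auto simp: le_Suc_eq)
    then have "enat 1 \<le> prime_height A M" unfolding prime_height_def by (intro Sup_upper) blast
    then show "1 \<le> prime_height A M" by (simp add: one_enat_def)
  qed
  have "ideal_depth A M = 1"
  proof (rule antisym)
    have "regular_sequence A [cls r]" unfolding regular_sequence_def
    proof (intro conjI allI impI ballI)
      show "set [cls r] \<subseteq> carrier A" by (simp add: carrier_A)
      have "Idl\<^bsub>A\<^esub> (set [cls r]) \<subseteq> M"
        by (rule A.genideal_minimal[OF M.is_ideal]) (use r(1) in \<open>simp add: mem_pull\<close>)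
      then show "Idl\<^bsub>A\<^esub> (set [cls r]) \<noteq> carrier A"
        using M.I_notcarr ideal_subset_A[OF M.is_ideal] by auto
      fix i b assume "i < length [cls r]" "b \<in> carrier A" "[cls r] ! i \<otimes>\<^bsub>A\<^esub> b \<in> Idl\<^bsub>A\<^esub> (set (take i [cls r]))"
      then show "b \<in> Idl\<^bsub>A\<^esub> (set (take i [cls r]))"
        using r(2) by (auto simp: carrier_A cls_mult Idl_empty)
    qed
    moreover have "set [cls r] \<subseteq> M" using r(1) by (simp add: mem_pull)
    ultimately have "enat (length [cls r]) \<le> ideal_depth A M" unfolding ideal_depth_def
      by (intro Sup_upper) blast
    then show "1 \<le> ideal_depth A M" by (simp add: one_enat_def)
    show "ideal_depth A M \<le> 1" unfolding ideal_depth_def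
    proof (rule Sup_least)
      fix x assume "x \<in> {enat (length xs) |xs. regular_sequence A xs \<and> set xs \<subseteq> M}"
      then obtain xs where xs: "regular_sequence A xs" "set xs \<subseteq> M" and x: "x = enat (length xs)" by blast
      show "x \<le> 1" unfolding x
      proof (rule ccontr)
        assume "\<not> enat (length xs) \<le> 1"
        then have len: "2 \<le> length xs" by (simp add: one_enat_def)
        then obtain x0 x1 ys where xs_eq: "xs = x0 # x1 # ys"
          by (metis Suc_le_length_iff numeral_2_eq_2)
        then obtain r0 r1 where rr: "x0 = cls r0" "x1 = cls r1"
          using xs(1) by (auto simp: regular_sequence_def carrier_A)
        have rM: "r0 \<in> ?M" "r1 \<in> ?M" using xs(2) by (simp_all add: xs_eq rr mem_pull)
        have reg: "xs ! i \<otimes>\<^bsub>A\<^esub> b \<in> Idl\<^bsub>A\<^esub> (set (take i xs)) \<Longrightarrow> b \<in> Idl\<^bsub>A\<^esub> (set (take i xs))"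
          if "i < length xs" "b \<in> carrier A" for i b
          using xs(1) that unfolding regular_sequence_def by blast
        have nz0: "b \<in> I" if "r0 * b \<in> I" for b
          using reg[of 0 "cls b"] that by (simp add: xs_eq rr carrier_A cls_mult Idl_empty)
        let ?J = "Idl\<^bsub>A\<^esub> {cls r0}"
        have J: "ideal ?J A" by (rule A.genideal_ideal) (simp add: carrier_A)
        have nz1: "b \<in> pull ?J" if "r1 * b \<in> pull ?J" for b
          using reg[of 1 "cls b"] that by (simp add: xs_eq rr carrier_A cls_mult mem_pull)
        have "cls r0 \<in> ?J" using A.genideal_self[of "{cls r0}"] by (simp add: carrier_A)
        then have r0J: "r0 \<in> pull ?J" by (simp add: mem_pull)
        have "?J \<subseteq> M" by (rule A.genideal_minimal[OF M.is_ideal]) (use rM in \<open>simp add: mem_pull\<close>)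
        then have JM: "pull ?J \<subseteq> ?M" by (auto simp: mem_pull)
        obtain P1 where P1: "is_prime P1" "pull ?J \<subseteq> P1" "P1 \<subseteq> ?M" "r1 \<notin> P1"
          by (rule prime_avoiding_nonzerodivisor[OF pM pull_ideal(1)[OF J] JM nz1])
        have IP1: "I \<subseteq> P1" using pull_ideal(2)[OF J] P1(2) by blast
        obtain P0 where P0: "is_prime P0" "I \<subseteq> P0" "P0 \<subseteq> P1" "r0 \<notin> P0"
          by (rule prime_avoiding_nonzerodivisor[OF P1(1) I IP1 nz0])
        have "P0 \<subset> P1" using P0 r0J P1(2) by blast
        moreover have "P1 \<subset> ?M" using P1 rM by blast
        ultimately show False using dim[OF P0(1) P1(1) pM P0(2)] by blast
      qed
    qed
  qed
  with height show "ideal_depth A M = prime_height A M" by simp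
qed

end

section \<open>Symmetric and Rees algebras\<close>

text \<open>
  Throughout, \<open>C\<close> is the polynomial ring over \<open>R\<close> with one variable for every element of \<open>I\<close>, \<open>J\<close> is its
  ideal generated by the linear relations, and \<open>\<epsilon>\<close> is the map to \<open>R[t]\<close> that induces \<open>sym_to_rees\<close>.
\<close>

locale linear_type_setup =
  fixes I :: "'r::comm_ring_1 set"
  assumes I: "is_ideal I"
begin

abbreviation "C \<equiv> carrier (free_alg I)"
abbreviation "FA \<equiv> free_alg I"
abbreviation "J \<equiv> Idl\<^bsub>free_alg I\<^esub> (linear_relations I)"
definition \<epsilon> :: "('r, 'r) mpoly \<Rightarrow> 'r poly" where
  "\<epsilon> = subst (\<lambda>r. [:r:]) (\<lambda>a. Polynomial.monom a 1)"

lemma C_iff: "P \<in> C \<longleftrightarrow> (\<forall>m\<in>Poly_Mapping.keys P. Poly_Mapping.keys m \<subseteq> I)"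
  by (simp add: free_alg_def)

lemma FA_ops [simp]: "P \<otimes>\<^bsub>FA\<^esub> Q = P * Q" "P \<oplus>\<^bsub>FA\<^esub> Q = P + Q" "\<one>\<^bsub>FA\<^esub> = 1" "\<zero>\<^bsub>FA\<^esub> = 0"
  by (simp_all add: free_alg_def)

lemma C_add: "P \<in> C \<Longrightarrow> Q \<in> C \<Longrightarrow> P + Q \<in> C"
  unfolding C_iff using Poly_Mapping.keys_add[of P Q] by blast

lemma C_mult: "P \<in> C \<Longrightarrow> Q \<in> C \<Longrightarrow> P * Q \<in> C"
  unfolding C_iff
proof
  fix m assume PQ: "\<forall>m\<in>Poly_Mapping.keys P. Poly_Mapping.keys m \<subseteq> I" "\<forall>m\<in>Poly_Mapping.keys Q. Poly_Mapping.keys m \<subseteq> I"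
    and "m \<in> Poly_Mapping.keys (P * Q)"
  then obtain a b where "m = a + b" "a \<in> Poly_Mapping.keys P" "b \<in> Poly_Mapping.keys Q"
    using Poly_Mapping.keys_mult[of P Q] by blast
  then show "Poly_Mapping.keys m \<subseteq> I" using PQ Poly_Mapping.keys_add[of a b] by blast
qed

lemma C_cst: "cst c \<in> C"
  by (auto simp: C_iff cst_def split: if_splits)

lemma C_var: "a \<in> I \<Longrightarrow> var a \<in> C"
  by (auto simp: C_iff var_def split: if_splits)

lemma C_0: "0 \<in> C" and C_1: "1 \<in> C"
  using C_cst[of 0] C_cst[of 1] by (simp_all add: cst.zero cst.one)

lemma C_uminus: "P \<in> C \<Longrightarrow> - P \<in> C"
  using C_mult[OF C_cst[of "- 1"], of P] by (simp add: cst.maps)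

lemma C_diff: "P \<in> C \<Longrightarrow> Q \<in> C \<Longrightarrow> P - Q \<in> C"
  using C_add[of P "- Q"] by (simp add: C_uminus)

lemma C_power: "P \<in> C \<Longrightarrow> P ^ n \<in> C"
  by (induction n) (simp_all add: C_1 C_mult)

lemma C_sum: "(\<And>x. x \<in> A \<Longrightarrow> g x \<in> C) \<Longrightarrow> sum g A \<in> C"
  by (induction A rule: infinite_finite_induct) (simp_all add: C_0 C_add)

lemma C_induct [consumes 1, case_names cst var add mult]:
  assumes "P \<in> C" and cst: "\<And>c. \<Phi> (cst c)" and var: "\<And>a. a \<in> I \<Longrightarrow> \<Phi> (var a)"
    and add: "\<And>P Q. P \<in> C \<Longrightarrow> Q \<in> C \<Longrightarrow> \<Phi> P \<Longrightarrow> \<Phi> Q \<Longrightarrow> \<Phi> (P + Q)"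
    and mult: "\<And>P Q. P \<in> C \<Longrightarrow> Q \<in> C \<Longrightarrow> \<Phi> P \<Longrightarrow> \<Phi> Q \<Longrightarrow> \<Phi> (P * Q)"
  shows "\<Phi> P"
proof -
  have pow: "\<Phi> (var a ^ n) \<and> var a ^ n \<in> C" if "a \<in> I" for a n
    using cst[of 1] that by (induction n) (auto simp: mult var C_var C_1 C_mult cst.one)
  have pr: "\<Phi> (\<Prod>a\<in>A. var a ^ g a) \<and> (\<Prod>a\<in>A. var a ^ g a) \<in> C" if "finite A" "A \<subseteq> I" for A g
    using that cst[of 1] by (induction A) (auto simp: mult pow C_1 C_mult cst.one)
  have mono: "\<Phi> (Poly_Mapping.single m c) \<and> Poly_Mapping.single m c \<in> C" if "Poly_Mapping.keys m \<subseteq> I" for m c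
    unfolding single_eq_prod using pr[OF _ that] by (simp add: mult cst C_cst C_mult)
  have "\<Phi> (\<Sum>m\<in>A. Poly_Mapping.single m (g m)) \<and> (\<Sum>m\<in>A. Poly_Mapping.single m (g m)) \<in> C"
    if "finite A" "\<And>m. m \<in> A \<Longrightarrow> Poly_Mapping.keys m \<subseteq> I" for A g
    using that cst[of 0] by (induction A) (auto simp: add mono C_0 C_add cst.zero)
  from this[of "Poly_Mapping.keys P" "Poly_Mapping.lookup P"] show ?thesis
    using assms(1) poly_mapping_sum_single[of P] by (simp add: C_iff)
qed

lemma cring_FA: "cring FA"
proof -
  interpret T: cring "ring_of_type_algebra :: ('r, 'r) mpoly ring" by (rule type_ring_cring)
  have "subring C (ring_of_type_algebra :: ('r, 'r) mpoly ring)"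
    by (rule T.subringI) (auto simp: C_1 C_uminus C_mult C_add)
  then have "subcring C (ring_of_type_algebra :: ('r, 'r) mpoly ring)" by (rule T.subcringI')
  then show ?thesis using T.subcring_iff[of C] by (simp add: free_alg_def)
qed

lemma relations_C: "linear_relations I \<subseteq> C"
  unfolding linear_relations_def
  by (auto intro!: C_diff C_mult C_var C_cst is_ideal_add[OF I] is_ideal_mult[OF I])

lemma J_ideal: "ideal J FA"
proof -
  interpret cring FA by (rule cring_FA)
  show ?thesis by (rule genideal_ideal[OF relations_C])
qed

lemma J_add: "P \<in> J \<Longrightarrow> Q \<in> J \<Longrightarrow> P + Q \<in> J"
  using additive_subgroup.a_closed[OF ideal.axioms(1)[OF J_ideal], of P Q] by simp

lemma J_mult: "P \<in> J \<Longrightarrow> Q \<in> C \<Longrightarrow> Q * P \<in> J"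
  using ideal.I_l_closed[OF J_ideal, of P Q] by simp

lemma J_0: "0 \<in> J"
  using additive_subgroup.zero_closed[OF ideal.axioms(1)[OF J_ideal]] by simp

lemma J_uminus: "P \<in> J \<Longrightarrow> - P \<in> J"
  using J_mult[OF _ C_uminus[OF C_1], of P] by simp

lemma J_diff: "P \<in> J \<Longrightarrow> Q \<in> J \<Longrightarrow> P - Q \<in> J"
  using J_add[OF _ J_uminus, of P Q] by simp

lemma relations_J: "R \<in> linear_relations I \<Longrightarrow> R \<in> J"
proof -
  interpret cring FA by (rule cring_FA)
  show "R \<in> linear_relations I \<Longrightarrow> R \<in> J" using genideal_self[OF relations_C] by blast
qed

lemma J_rel_add: "a \<in> I \<Longrightarrow> b \<in> I \<Longrightarrow> var (a + b) - var a - var b \<in> J"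
  by (rule relations_J) (auto simp: linear_relations_def)

lemma J_rel_mult: "a \<in> I \<Longrightarrow> var (r * a) - cst r * var a \<in> J"
  by (rule relations_J) (unfold linear_relations_def, blast)

text \<open>A ring map on polynomials that kills the linear relations kills the ideal they generate.\<close>

lemma J_vanish:
  assumes \<psi>: "ring_map \<psi>" and rel: "\<And>R. R \<in> linear_relations I \<Longrightarrow> \<psi> R = 0" and "P \<in> J"
  shows "\<psi> P = 0"
proof -
  interpret \<psi>: ring_map \<psi> by fact
  interpret FA: cring FA by (rule cring_FA)
  let ?K = "{P \<in> C. \<psi> P = 0}"
  have neg: "\<ominus>\<^bsub>FA\<^esub> P = - P" if "P \<in> C" for P
    by (rule FA.minus_equality) (simp_all add: that C_uminus)
  have "ideal ?K FA"
  proof (intro Ideal.idealI FA.ring_axioms)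
    show "subgroup ?K (add_monoid FA)"
    proof (rule subgroup.intro)
      show "inv\<^bsub>add_monoid FA\<^esub> P \<in> ?K" if "P \<in> ?K" for P
        using neg[of P] that unfolding a_inv_def by (auto simp: C_uminus \<psi>.maps)
    qed (auto simp: C_add C_0 \<psi>.maps)
  qed (auto simp: C_mult \<psi>.maps)
  then have "J \<subseteq> ?K" by (rule FA.genideal_minimal) (use relations_C rel in auto)
  with \<open>P \<in> J\<close> show ?thesis by blast
qed

lemma ring_map_\<epsilon>: "ring_map \<epsilon>" unfolding \<epsilon>_def by (rule ring_map.ring_map_subst[OF ring_map_const_poly])

interpretation \<epsilon>: ring_map \<epsilon> by (rule ring_map_\<epsilon>)

lemma \<epsilon>_cst: "\<epsilon> (cst c) = [:c:]" unfolding \<epsilon>_def by (rule ring_map.subst_cst[OF ring_map_const_poly])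
lemma \<epsilon>_var: "\<epsilon> (var a) = Polynomial.monom a 1" unfolding \<epsilon>_def by (rule ring_map.subst_var[OF ring_map_const_poly])

lemma \<epsilon>_J: "P \<in> J \<Longrightarrow> \<epsilon> P = 0"
  by (rule J_vanish[OF ring_map_\<epsilon>])
    (auto simp: linear_relations_def \<epsilon>.maps \<epsilon>_var \<epsilon>_cst smult_monom simp flip: add_monom)

definition pw :: "nat \<Rightarrow> 'r set" where
  "pw n = I [^]\<^bsub>ideals_set ring_of_type_algebra\<^esub> n"

lemma pw_0: "pw 0 = UNIV" and pw_Suc: "pw (Suc n) = pw n \<cdot>\<^bsub>ring_of_type_algebra\<^esub> I"
  by (simp_all add: pw_def nat_pow_def ideals_set_def)

lemma pw_ideal: "is_ideal (pw n)"
proof (induction n)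
  case 0
  show ?case by (simp add: pw_0 is_ideal_def)
next
  case (Suc n)
  interpret T: cring "ring_of_type_algebra :: 'r ring" by (rule type_ring_cring)
  have "ideal (pw n) ring_of_type_algebra" "ideal I ring_of_type_algebra"
    using Suc I by (simp_all add: ideal_type_iff)
  then show ?case unfolding pw_Suc ideal_type_iff[symmetric] by (rule T.ideal_prod_is_ideal)
qed

lemma pw_Suc_mult: "a \<in> pw n \<Longrightarrow> b \<in> I \<Longrightarrow> a * b \<in> pw (Suc n)"
  unfolding pw_Suc using ideal_prod.prod[of a "pw n" b I "ring_of_type_algebra :: 'r ring"] by simp

lemma pw_Suc_induct [consumes 1, case_names prod sum]:
  assumes "c \<in> pw (Suc n)" "\<And>a b. a \<in> pw n \<Longrightarrow> b \<in> I \<Longrightarrow> \<Phi> (a * b)"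
    "\<And>a b. \<Phi> a \<Longrightarrow> \<Phi> b \<Longrightarrow> \<Phi> (a + b)"
  shows "\<Phi> c"
  using assms(1) unfolding pw_Suc by (induction rule: ideal_prod.induct) (auto simp: assms(2,3))

lemma pw_mult: "a \<in> pw i \<Longrightarrow> b \<in> pw j \<Longrightarrow> a * b \<in> pw (i + j)"
proof (induction j arbitrary: b)
  case 0
  then show ?case using is_ideal_mult2[OF pw_ideal] by simp
next
  case (Suc j)
  from Suc.prems(2) show ?case
  proof (induction rule: pw_Suc_induct)
    case (prod b c)
    then have "a * b * c \<in> pw (Suc (i + j))" by (intro pw_Suc_mult Suc.IH Suc.prems)
    then show ?case by (simp add: mult.assoc)
  next
    case (sum b c)
    then show ?case using is_ideal_add[OF pw_ideal] by (simp add: distrib_left)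
  qed
qed

abbreviation "RA \<equiv> rees_algebra I"

lemma RA_iff: "p \<in> carrier RA \<longleftrightarrow> (\<forall>n. coeff p n \<in> pw n)"
  by (simp add: rees_algebra_def pw_def)

lemma RA_ops [simp]: "p \<otimes>\<^bsub>RA\<^esub> r = p * r" "p \<oplus>\<^bsub>RA\<^esub> r = p + r" "\<one>\<^bsub>RA\<^esub> = 1"
  by (simp_all add: rees_algebra_def)

lemma \<epsilon>_RA: "P \<in> C \<Longrightarrow> \<epsilon> P \<in> carrier RA"
proof (induction rule: C_induct)
  case (cst c)
  show ?case by (auto simp: RA_iff \<epsilon>_cst pw_0 coeff_pCons is_ideal_0[OF pw_ideal] split: nat.splits)
next
  case (var a)
  then have "a \<in> pw 1" using pw_Suc_mult[of 1 0 a] by (simp add: pw_0)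
  then show ?case by (auto simp: RA_iff \<epsilon>_var is_ideal_0[OF pw_ideal])
next
  case (add P Q)
  then show ?case by (simp add: RA_iff \<epsilon>.add is_ideal_add[OF pw_ideal])
next
  case (mult P Q)
  have "(\<Sum>i\<le>n. coeff (\<epsilon> P) i * coeff (\<epsilon> Q) (n - i)) \<in> pw n" for n
  proof (rule is_ideal_sum[OF pw_ideal])
    fix i assume "i \<in> {..n}"
    then show "coeff (\<epsilon> P) i * coeff (\<epsilon> Q) (n - i) \<in> pw n"
      using pw_mult[of "coeff (\<epsilon> P) i" i "coeff (\<epsilon> Q) (n - i)" "n - i"] mult.IH by (simp add: RA_iff)
  qed
  then show ?case by (simp add: RA_iff \<epsilon>.mult coeff_mult)
qed

lemma \<epsilon>_surj: assumes "p \<in> carrier RA" shows "p \<in> \<epsilon> ` C"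
proof -
  have mon: "Polynomial.monom c n \<in> \<epsilon> ` C" if "c \<in> pw n" for c n
    using that
  proof (induction n arbitrary: c)
    case 0
    show ?case by (rule image_eqI[of _ _ "cst c"]) (simp_all add: \<epsilon>_cst C_cst monom_0)
  next
    case (Suc n)
    from Suc.prems show ?case
    proof (induction rule: pw_Suc_induct)
      case (prod a b)
      then obtain P where "P \<in> C" "Polynomial.monom a n = \<epsilon> P" using Suc.IH by blast
      then show ?case using prod(2)
        by (intro image_eqI[of _ _ "P * var b"]) (simp_all add: \<epsilon>.mult \<epsilon>_var C_mult C_var mult_monom flip: \<open>_ = \<epsilon> P\<close>)
    next
      case (sum a b)
      then obtain P Q where "P \<in> C" "Q \<in> C" "Polynomial.monom a (Suc n) = \<epsilon> P" "Polynomial.monom b (Suc n) = \<epsilon> Q" by blast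
      then show ?case by (intro image_eqI[of _ _ "P + Q"]) (simp_all add: \<epsilon>.add C_add flip: add_monom)
    qed
  qed
  have "\<exists>P\<in>C. Polynomial.monom (coeff p n) n = \<epsilon> P" for n
    using mon[of "coeff p n" n] assms by (auto simp: RA_iff)
  then obtain P where P: "\<And>n. P n \<in> C" "\<And>n. Polynomial.monom (coeff p n) n = \<epsilon> (P n)" by metis
  have "p = \<epsilon> (\<Sum>n\<le>Polynomial.degree p. P n)"
    using poly_as_sum_of_monoms[of p] by (simp add: \<epsilon>.sum flip: P(2))
  then show ?thesis using C_sum[of "{..Polynomial.degree p}" P] P(1) by blast
qed

abbreviation "coset P \<equiv> J +>\<^bsub>FA\<^esub> P"

lemma coset_eq: "coset P = {j + P | j. j \<in> J}"
  by (auto simp: a_r_coset_def r_coset_def)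

lemma coset_eq_iff: "coset P = coset Q \<longleftrightarrow> P - Q \<in> J"
proof
  assume "coset P = coset Q"
  moreover have "P = 0 + P" by simp
  then have "P \<in> coset P" unfolding coset_eq using J_0 by blast
  ultimately obtain j where "j \<in> J" "P = j + Q" unfolding coset_eq by blast
  then show "P - Q \<in> J" by simp
next
  have sub: "coset P \<subseteq> coset Q" if "P - Q \<in> J" for P Q
  proof
    fix x assume "x \<in> coset P"
    then obtain j where "j \<in> J" "x = j + P" unfolding coset_eq by blast
    then have "x = (j + (P - Q)) + Q" "j + (P - Q) \<in> J" using J_add that by auto
    then show "x \<in> coset Q" unfolding coset_eq by blast
  qed
  assume "P - Q \<in> J"
  then show "coset P = coset Q" using sub[of P Q] sub[of Q P] J_uminus[of "P - Q"] by auto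
qed

lemma sym_to_rees_coset: "sym_to_rees (coset P) = \<epsilon> P"
proof -
  have "\<epsilon> x = \<epsilon> P" if "x \<in> coset P" for x
    using that \<epsilon>_J by (auto simp: coset_eq \<epsilon>.add)
  moreover have "P = 0 + P" by simp
  then have "P \<in> coset P" unfolding coset_eq using J_0 by blast
  ultimately have "\<epsilon> ` coset P = {\<epsilon> P}" by blast
  then show ?thesis unfolding sym_to_rees_def \<epsilon>_def[symmetric] by simp
qed

text \<open>
  The map to the Rees algebra is always surjective, as \<open>I\<^sup>n t\<^sup>n\<close> is spanned by products of elements
  \<open>a t\<close>; so only injectivity is a condition.
\<close>

theorem linear_type_iff: "linear_type I \<longleftrightarrow> (\<forall>P\<in>C. \<epsilon> P = 0 \<longrightarrow> P \<in> J)"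
proof
  have carr: "carrier (symmetric_algebra I) = coset ` C"
    by (auto simp: symmetric_algebra_def FactRing_def A_RCOSETS_def RCOSETS_def a_r_coset_def)
  have hom: "coset \<in> ring_hom FA (symmetric_algebra I)"
    unfolding symmetric_algebra_def by (rule ideal.rcos_ring_hom[OF J_ideal])
  {
    assume "linear_type I"
    then have inj: "inj_on sym_to_rees (coset ` C)"
      by (simp add: linear_type_def ring_iso_def bij_betw_def carr)
    show "\<forall>P\<in>C. \<epsilon> P = 0 \<longrightarrow> P \<in> J"
    proof (intro ballI impI)
      fix P assume "P \<in> C" "\<epsilon> P = 0"
      then have "coset P = coset 0"
        using C_0 by (intro inj_onD[OF inj]) (auto simp: sym_to_rees_coset \<epsilon>.zero)
      then show "P \<in> J" by (simp add: coset_eq_iff)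
    qed
  next
    assume ker: "\<forall>P\<in>C. \<epsilon> P = 0 \<longrightarrow> P \<in> J"
    have "sym_to_rees \<in> ring_hom (symmetric_algebra I) RA"
    proof (rule ring_hom_memI)
      show "sym_to_rees x \<in> carrier RA" if "x \<in> carrier (symmetric_algebra I)" for x
        using that by (auto simp: carr sym_to_rees_coset \<epsilon>_RA)
      show "sym_to_rees (x \<otimes>\<^bsub>symmetric_algebra I\<^esub> y) = sym_to_rees x \<otimes>\<^bsub>RA\<^esub> sym_to_rees y"
        "sym_to_rees (x \<oplus>\<^bsub>symmetric_algebra I\<^esub> y) = sym_to_rees x \<oplus>\<^bsub>RA\<^esub> sym_to_rees y"
        if xy: "x \<in> carrier (symmetric_algebra I)" "y \<in> carrier (symmetric_algebra I)" for x y
      proof -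
        from xy obtain P Q where PQ: "P \<in> C" "Q \<in> C" "x = coset P" "y = coset Q" by (auto simp: carr)
        have m: "coset P \<otimes>\<^bsub>symmetric_algebra I\<^esub> coset Q = coset (P * Q)"
          and a: "coset P \<oplus>\<^bsub>symmetric_algebra I\<^esub> coset Q = coset (P + Q)"
          using ring_hom_mult[OF hom PQ(1,2)] ring_hom_add[OF hom PQ(1,2)] by simp_all
        show "sym_to_rees (x \<otimes>\<^bsub>symmetric_algebra I\<^esub> y) = sym_to_rees x \<otimes>\<^bsub>RA\<^esub> sym_to_rees y"
          "sym_to_rees (x \<oplus>\<^bsub>symmetric_algebra I\<^esub> y) = sym_to_rees x \<oplus>\<^bsub>RA\<^esub> sym_to_rees y"
          unfolding PQ(3,4) m a by (simp_all add: sym_to_rees_coset \<epsilon>.maps)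
      qed
      show "sym_to_rees \<one>\<^bsub>symmetric_algebra I\<^esub> = \<one>\<^bsub>RA\<^esub>"
        using ring_hom_one[OF hom] by (simp add: sym_to_rees_coset \<epsilon>.maps flip: ring_hom_one[OF hom])
    qed
    moreover have "inj_on sym_to_rees (coset ` C)"
    proof (rule inj_onI)
      fix x y assume "x \<in> coset ` C" "y \<in> coset ` C" "sym_to_rees x = sym_to_rees y"
      then obtain P Q where PQ: "P \<in> C" "Q \<in> C" "x = coset P" "y = coset Q" "\<epsilon> P = \<epsilon> Q"
        by (auto simp: sym_to_rees_coset)
      then have "P - Q \<in> J" using ker C_diff[of P Q] by (simp add: \<epsilon>.diff)
      then show "x = y" using PQ coset_eq_iff by simp
    qed
    moreover have "sym_to_rees ` (coset ` C) = carrier RA"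
      using \<epsilon>_RA \<epsilon>_surj by (auto simp: sym_to_rees_coset image_image)
    ultimately show "linear_type I"
      by (simp add: linear_type_def ring_iso_def bij_betw_def carr)
  }
qed

end

section \<open>Ideals with three generators\<close>

locale three_generators =
  fixes e0 e1 e2 :: "'r::comm_ring_1"
begin

sublocale linear_type_setup "ideal3 e0 e1 e2"
  by unfold_locales (rule is_ideal_ideal3)

lemma e_mem: "e0 \<in> ideal3 e0 e1 e2" "e1 \<in> ideal3 e0 e1 e2" "e2 \<in> ideal3 e0 e1 e2"
  by (rule ideal3_gens)+

lemma E_C: "var e0 \<in> C" "var e1 \<in> C" "var e2 \<in> C"
  by (intro C_var e_mem)+

lemma combination_J: "var (r * e0 + s * e1 + t * e2) - (cst r * var e0 + cst s * var e1 + cst t * var e2) \<in> J"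
proof -
  note I = is_ideal_ideal3[of e0 e1 e2]
  note m = is_ideal_mult[OF I]
  have "(var (r * e0 + s * e1 + t * e2) - var (r * e0 + s * e1) - var (t * e2))
     + ((var (r * e0 + s * e1) - var (r * e0) - var (s * e1))
     + ((var (r * e0) - cst r * var e0) + ((var (s * e1) - cst s * var e1) + (var (t * e2) - cst t * var e2)))) \<in> J"
    by (intro J_add J_rel_add J_rel_mult is_ideal_add[OF I] m e_mem)
  then show ?thesis by (simp add: algebra_simps)
qed

lemma syzygy_J:
  assumes "r * e0 + s * e1 + t * e2 = 0"
  shows "cst r * var e0 + cst s * var e1 + cst t * var e2 \<in> J"
proof -
  have "var 0 - (cst 0 * var e0 + cst 0 * var e1 + cst 0 * var e2) \<in> J"
    using combination_J[of 0 0 0] by simp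
  then have "var 0 \<in> J" by (simp add: cst.zero)
  moreover have "var 0 - (cst r * var e0 + cst s * var e1 + cst t * var e2) \<in> J"
    using combination_J[of r s t] assms by simp
  ultimately show ?thesis using J_diff[of "var 0" "var 0 - (cst r * var e0 + cst s * var e1 + cst t * var e2)"] by (simp add: add.assoc)
qed

end

text \<open>If all syzygies vanish under a ring map to a field, the coordinates with respect to the generators
  become well-defined there, so the symmetric algebra maps to that field with arbitrary values on the generators.\<close>

lemma (in three_generators) value_in_field:
  fixes \<pi> :: "'r \<Rightarrow> 'k::field"
  assumes \<pi>: "ring_map \<pi>"
    and syz: "\<And>r s t. r * e0 + s * e1 + t * e2 = 0 \<Longrightarrow> \<pi> r = 0 \<and> \<pi> s = 0 \<and> \<pi> t = 0"
  obtains \<psi> :: "('r, 'r) mpoly \<Rightarrow> 'k" where "ring_map \<psi>" "\<And>P. P \<in> J \<Longrightarrow> \<psi> P = 0"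
    "\<And>c. \<psi> (cst c) = \<pi> c" "\<psi> (var e0) = a" "\<psi> (var e1) = b" "\<psi> (var e2) = c"
proof -
  interpret \<pi>: ring_map \<pi> by fact
  define Lam where "Lam p = (SOME v. \<exists>r s t. p = r * e0 + s * e1 + t * e2 \<and> v = \<pi> r * a + \<pi> s * b + \<pi> t * c)" for p
  have Lam: "Lam (r * e0 + s * e1 + t * e2) = \<pi> r * a + \<pi> s * b + \<pi> t * c" for r s t
    unfolding Lam_def
  proof (rule some_equality)
    fix v assume "\<exists>r' s' t'. r * e0 + s * e1 + t * e2 = r' * e0 + s' * e1 + t' * e2 \<and> v = \<pi> r' * a + \<pi> s' * b + \<pi> t' * c"
    then obtain r' s' t' where eq: "r * e0 + s * e1 + t * e2 = r' * e0 + s' * e1 + t' * e2" and v: "v = \<pi> r' * a + \<pi> s' * b + \<pi> t' * c"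
      by blast
    have "(r - r') * e0 + (s - s') * e1 + (t - t') * e2 = (r * e0 + s * e1 + t * e2) - (r' * e0 + s' * e1 + t' * e2)"
      by (simp add: algebra_simps)
    then have "(r - r') * e0 + (s - s') * e1 + (t - t') * e2 = 0" using eq by simp
    then have "\<pi> (r - r') = 0 \<and> \<pi> (s - s') = 0 \<and> \<pi> (t - t') = 0" by (rule syz)
    then show "v = \<pi> r * a + \<pi> s * b + \<pi> t * c" using v by (simp add: \<pi>.diff)
  qed blast
  have Lam_add: "Lam (p + p') = Lam p + Lam p'" if p: "p \<in> ideal3 e0 e1 e2" "p' \<in> ideal3 e0 e1 e2" for p p'
  proof -
    obtain r s t where 1: "p = r * e0 + s * e1 + t * e2" using p(1) unfolding ideal3_def by blast
    obtain r' s' t' where 2: "p' = r' * e0 + s' * e1 + t' * e2" using p(2) unfolding ideal3_def by blast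
    have "p + p' = (r + r') * e0 + (s + s') * e1 + (t + t') * e2" unfolding 1 2 by (simp add: algebra_simps)
    then have "Lam (p + p') = \<pi> (r + r') * a + \<pi> (s + s') * b + \<pi> (t + t') * c" by (simp only: Lam)
    moreover have "Lam p = \<pi> r * a + \<pi> s * b + \<pi> t * c" unfolding 1 by (rule Lam)
    moreover have "Lam p' = \<pi> r' * a + \<pi> s' * b + \<pi> t' * c" unfolding 2 by (rule Lam)
    ultimately show ?thesis by (simp add: \<pi>.add distrib_right)
  qed
  have Lam_mult: "Lam (u * p) = \<pi> u * Lam p" if p: "p \<in> ideal3 e0 e1 e2" for u p
  proof -
    obtain r s t where 1: "p = r * e0 + s * e1 + t * e2" using p unfolding ideal3_def by blast
    have "u * p = (u * r) * e0 + (u * s) * e1 + (u * t) * e2" unfolding 1 by (simp add: algebra_simps)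
    then have "Lam (u * p) = \<pi> (u * r) * a + \<pi> (u * s) * b + \<pi> (u * t) * c" by (simp only: Lam)
    moreover have "Lam p = \<pi> r * a + \<pi> s * b + \<pi> t * c" unfolding 1 by (rule Lam)
    ultimately show ?thesis by (simp add: \<pi>.mult distrib_left mult.assoc)
  qed
  show ?thesis
  proof (rule that)
    interpret \<psi>: ring_map "subst \<pi> Lam" by (rule \<pi>.ring_map_subst)
    show "ring_map (subst \<pi> Lam)" by (rule \<pi>.ring_map_subst)
    show "subst \<pi> Lam (cst c) = \<pi> c" for c by (rule \<pi>.subst_cst)
    show "subst \<pi> Lam (var e0) = a" "subst \<pi> Lam (var e1) = b" "subst \<pi> Lam (var e2) = c"
      using Lam[of 1 0 0] Lam[of 0 1 0] Lam[of 0 0 1] by (simp_all add: \<pi>.subst_var \<pi>.maps)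
    show "subst \<pi> Lam P = 0" if "P \<in> J" for P
    proof (rule J_vanish[OF \<psi>.ring_map_axioms _ that])
      fix R assume "R \<in> linear_relations (ideal3 e0 e1 e2)"
      then show "subst \<pi> Lam R = 0"
        unfolding linear_relations_def
        by (auto simp: \<psi>.maps \<pi>.subst_var \<pi>.subst_cst Lam_add Lam_mult)
    qed
  qed
qed

text \<open>
  Over an infinite field a nonzero form has a nonzero value, and its second argument can be normalized
  to 1 because the coefficients survive dehomogenization.
\<close>

lemma hev_nonvanishing:
  fixes c :: "nat \<Rightarrow> 'k::field"
  assumes "infinite (UNIV :: 'k set)" "i \<le> k" "c i \<noteq> 0"
  obtains s where "hev k c s 1 \<noteq> 0"
proof -
  define h where "h = (\<Sum>i\<le>k. Polynomial.monom (c i) i)"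
  have "coeff h i = c i" using assms(2) by (simp add: h_def coeff_sum)
  then have "h \<noteq> 0" using assms(3) by auto
  then have "finite {s. poly h s = 0}" by (rule poly_roots_finite)
  then obtain s where "poly h s \<noteq> 0" using ex_new_if_finite[OF assms(1)] by blast
  then show ?thesis by (intro that[of s]) (simp add: h_def poly_sum poly_monom hev_def)
qed

text \<open>
  For a form \<open>z a + b\<close> of degree \<open>k + 1\<close> in \<open>x\<close> and \<open>y\<close> with coefficients as in \<open>q\<close> and \<open>f\<close>, let
  \<open>Q k a b\<close> arise by replacing all factors \<open>x\<close> and \<open>y\<close> of \<open>a\<close>, and all but one of those of \<open>b\<close>, by
  \<open>T\<^sub>0\<close> and \<open>T\<^sub>1\<close>. Its image in the Rees algebra is \<open>q\<^sup>k (z a + b) t\<^sup>k\<close>. Hence \<open>T\<^sub>2 Q(q) - Q(f)\<close> maps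
  to \<open>f q\<^sup>m q - q\<^sup>m\<^sup>+\<^sup>1 f = 0\<close> in degree \<open>m + 1\<close>. On the other hand \<open>value_in_field\<close> gives maps that kill the
  linear relations and take arbitrary values on the \<open>T\<^sub>i\<close>; since \<open>x\<close>, \<open>y\<close> go to 0 and \<open>z\<close> to 1, the
  element goes to \<open>t\<^sub>2 a(t\<^sub>0, 1) - a'(t\<^sub>0, 1)\<close>, which is nonzero for suitable \<open>t\<^sub>0\<close> and \<open>t\<^sub>2\<close>.
\<close>

theorem not_linear_type:
  fixes x y z q f :: "'r::comm_ring_1" and m :: nat and a b a' b' :: "nat \<Rightarrow> 'r" and \<pi> :: "'r \<Rightarrow> 'k::field"
  assumes q: "q = z * hev m a x y + hev (Suc m) b x y"
    and f: "f = z * hev (Suc m) a' x y + hev (Suc (Suc m)) b' x y"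
    and inf: "infinite (UNIV :: 'k set)"
    and \<pi>: "ring_map \<pi>" "\<pi> x = 0" "\<pi> y = 0" "\<pi> z = 1"
    and syz: "\<And>r s t. r * (x * q) + s * (y * q) + t * f = 0 \<Longrightarrow> \<pi> r = 0 \<and> \<pi> s = 0 \<and> \<pi> t = 0"
    and nz: "(\<exists>i\<le>m. \<pi> (a i) \<noteq> 0) \<or> (\<exists>i\<le>Suc m. \<pi> (a' i) \<noteq> 0)"
  shows "\<not> linear_type (ideal3 (x * q) (y * q) f)"
proof
  interpret three_generators "x * q" "y * q" f .
  interpret \<epsilon>: ring_map \<epsilon> by (rule ring_map_\<epsilon>)
  interpret \<pi>: ring_map \<pi> by fact
  define Q where "Q k a b u v = cst z * hev k (\<lambda>i. cst (a i)) u v + cst y * hev k (\<lambda>i. cst (b i)) u v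
    + cst x * (cst (b (Suc k)) * u ^ k)" for k a b and u v :: "('r, 'r) mpoly"
  let ?E0 = "var (x * q)" and ?E1 = "var (y * q)" and ?E2 = "var f"
  define P where "P = ?E2 * Q m a b ?E0 ?E1 - Q (Suc m) a' b' ?E0 ?E1"
  have hev_C: "hev k (\<lambda>i. cst (c i)) ?E0 ?E1 \<in> C" for k c
    unfolding hev_def by (intro C_sum C_mult C_cst C_power E_C)
  have "P \<in> C" unfolding P_def Q_def
    by (intro C_diff C_mult C_add E_C C_cst C_power hev_C)
  have hev_monom: "hev k (\<lambda>i. [:c i:]) (Polynomial.monom (x * q) 1) (Polynomial.monom (y * q) 1) = Polynomial.monom (q ^ k * hev k c x y) k" for k c
  proof -
    have "hev k (\<lambda>i. [:c i:]) (Polynomial.monom (x * q) 1) (Polynomial.monom (y * q) 1)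
      = hev k (\<lambda>i. [:c i:]) (Polynomial.monom q 1 * [:x:]) (Polynomial.monom q 1 * [:y:])"
      by (simp add: mult.commute smult_monom)
    also have "\<dots> = Polynomial.monom q 1 ^ k * hev k (\<lambda>i. [:c i:]) [:x:] [:y:]" by (rule hev_scale)
    also have "hev k (\<lambda>i. [:c i:]) [:x:] [:y:] = [:hev k c x y:]"
      by (rule ring_map.map_hev[OF ring_map_const_poly, symmetric])
    finally show ?thesis by (simp add: monom_power smult_monom mult.commute)
  qed
  have \<epsilon>_Q: "\<epsilon> (Q k a b ?E0 ?E1) = Polynomial.monom (q ^ k * (z * hev k a x y + hev (Suc k) b x y)) k" for k a b
  proof -
    have A: "\<epsilon> (hev k (\<lambda>i. cst (c i)) ?E0 ?E1) = Polynomial.monom (q ^ k * hev k c x y) k" for c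
      by (simp only: \<epsilon>.map_hev \<epsilon>_cst \<epsilon>_var hev_monom)
    have B: "\<epsilon> (?E0 ^ k) = Polynomial.monom ((x * q) ^ k) k"
      by (simp add: \<epsilon>.power \<epsilon>_var monom_power)
    show ?thesis
      unfolding Q_def \<epsilon>.add \<epsilon>.mult \<epsilon>_cst A B hev_Suc
      by (simp add: smult_monom add_monom power_mult_distrib algebra_simps)
  qed
  have "\<epsilon> P = 0"
    unfolding P_def \<epsilon>.maps \<epsilon>_Q \<epsilon>_var q[symmetric] f[symmetric]
    by (simp add: mult_monom ac_simps)
  assume "linear_type (ideal3 (x * q) (y * q) f)"
  then have "P \<in> J" using \<open>P \<in> C\<close> \<open>\<epsilon> P = 0\<close> linear_type_iff by blast
  have "\<exists>t0 t2. t2 * hev m (\<lambda>i. \<pi> (a i)) t0 1 - hev (Suc m) (\<lambda>i. \<pi> (a' i)) t0 1 \<noteq> 0"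
  proof (cases "\<exists>i\<le>m. \<pi> (a i) \<noteq> 0")
    case True
    then obtain t0 where t0: "hev m (\<lambda>i. \<pi> (a i)) t0 1 \<noteq> 0" using hev_nonvanishing[OF inf] by metis
    show ?thesis
      by (rule exI[of _ t0], rule exI[of _ "(hev (Suc m) (\<lambda>i. \<pi> (a' i)) t0 1 + 1) / hev m (\<lambda>i. \<pi> (a i)) t0 1"])
        (use t0 in simp)
  next
    case False
    then obtain t0 where t0: "hev (Suc m) (\<lambda>i. \<pi> (a' i)) t0 1 \<noteq> 0" using hev_nonvanishing[OF inf] nz by metis
    show ?thesis by (rule exI[of _ t0], rule exI[of _ 0]) (use t0 in simp)
  qed
  then obtain t0 t2 where t: "t2 * hev m (\<lambda>i. \<pi> (a i)) t0 1 - hev (Suc m) (\<lambda>i. \<pi> (a' i)) t0 1 \<noteq> 0" by blast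
  obtain \<psi> :: "('r, 'r) mpoly \<Rightarrow> 'k" where \<psi>: "ring_map \<psi>" "\<And>P. P \<in> J \<Longrightarrow> \<psi> P = 0"
    "\<And>c. \<psi> (cst c) = \<pi> c" "\<psi> ?E0 = t0" "\<psi> ?E1 = 1" "\<psi> ?E2 = t2"
    using value_in_field[OF \<pi>(1) syz, where a = t0 and b = 1 and c = t2] by blast
  interpret \<psi>: ring_map \<psi> by fact
  have "\<psi> P = t2 * hev m (\<lambda>i. \<pi> (a i)) t0 1 - hev (Suc m) (\<lambda>i. \<pi> (a' i)) t0 1"
    by (simp add: P_def Q_def \<psi>.maps \<psi>.map_hev \<psi> \<pi>)
  then show False using \<psi>(2)[OF \<open>P \<in> J\<close>] t by simp
qed

section \<open>A criterion for linear type\<close>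

text \<open>
  Orders at 0 are additive.
\<close>

lemma monom_dvd_cancel:
  fixes a b :: "'b::idom poly"
  assumes "Polynomial.monom 1 (s + i) dvd a * b" "\<not> Polynomial.monom 1 (Suc s) dvd a"
  shows "Polynomial.monom 1 i dvd b"
proof (cases "b = 0")
  case False
  have "a \<noteq> 0" using assms(2) by auto
  with False have "s + i \<le> order 0 a + order 0 b" "order 0 a \<le> s"
    using assms monom_1_dvd_iff[of "a * b" "s + i"] monom_1_dvd_iff[of a "Suc s"] order_mult[of a b 0] by auto
  then show ?thesis using monom_1_dvd_iff[OF False] by simp
qed simp

lemma hev_mult_linear:
  "(p * x + s * y) * hev k c x y =
     hev (Suc k) (\<lambda>j. p * (if j = 0 then 0 else c (j - 1)) + s * (if j \<le> k then c j else 0)) x y"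
proof -
  have 1: "hev (Suc k) (\<lambda>j. if j = 0 then 0 else c (j - 1)) x y = x * hev k c x y"
    unfolding hev_def by (subst sum.atMost_Suc_shift) (simp add: sum_distrib_left ac_simps)
  have "hev k (\<lambda>j. if j \<le> k then c j else 0) x y = hev k c x y" by (rule hev_cong) simp
  then have 2: "hev (Suc k) (\<lambda>j. if j \<le> k then c j else 0) x y = y * hev k c x y" by (simp add: hev_Suc)
  have "hev (Suc k) (\<lambda>j. p * (if j = 0 then 0 else c (j - 1)) + s * (if j \<le> k then c j else 0)) x y
     = p * hev (Suc k) (\<lambda>j. if j = 0 then 0 else c (j - 1)) x y + s * hev (Suc k) (\<lambda>j. if j \<le> k then c j else 0) x y"
    by (simp only: hev_def sum_distrib_left distrib_right sum.distrib mult.assoc)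
  then show ?thesis by (simp only: 1 2 distrib_right mult.assoc)
qed

text \<open>
  The map \<open>\<beta>\<close> measures orders with respect to the ideal \<open>(x, y)\<close>, by \<open>pow\<close>. Decompose a relation of
  degree \<open>n\<close> as \<open>H = \<Sum> H\<^sub>i(T\<^sub>0, T\<^sub>1) T\<^sub>2\<^sup>n\<^sup>-\<^sup>i\<close> and let \<open>\<rho>\<^sub>i = H\<^sub>i(x, y)\<close>. Then
  \<open>\<Sum> \<rho>\<^sub>i q\<^sup>i f\<^sup>n\<^sup>-\<^sup>i = 0\<close>, and \<open>hev_root\<close> for the coprime elements \<open>q\<close> and \<open>f\<close> gives
  \<open>\<rho>\<^sub>j = f \<nu>\<^sub>j - q \<nu>\<^sub>j\<^sub>+\<^sub>1\<close>. As \<open>\<rho>\<^sub>j\<close> has order at least \<open>j\<close>, the hypothesis on \<open>q\<close> and \<open>f\<close> yields that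
  \<open>\<nu>\<^sub>j\<^sub>+\<^sub>1\<close> has order at least \<open>j\<close>, so it is the value at \<open>(x, y)\<close> of a form \<open>K\<^sub>j\<close> of degree \<open>j\<close>.
  Modulo the relation \<open>y T\<^sub>0 = x T\<^sub>1\<close> a form in \<open>T\<^sub>0\<close> and \<open>T\<^sub>1\<close> is determined by its value at \<open>(x, y)\<close>,
  again by \<open>hev_root\<close>, so \<open>H\<^sub>j\<close> is congruent to \<open>(p T\<^sub>0 + s T\<^sub>1) K\<^sub>j\<^sub>-\<^sub>1 - q K\<^sub>j\<close>. Modulo
  \<open>p T\<^sub>0 + s T\<^sub>1 = q T\<^sub>2\<close> the sum telescopes to zero.
\<close>

theorem is_linear_type:
  fixes x y q f p s :: "'r::idom" and \<beta> :: "'r \<Rightarrow> 'b::idom poly"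
  assumes f: "f = p * x + s * y" and nz: "y \<noteq> 0" "f \<noteq> 0"
    and cop_xy: "\<And>r. y dvd r * x \<Longrightarrow> y dvd r" and cop_qf: "\<And>r. f dvd r * q \<Longrightarrow> f dvd r"
    and \<beta>: "ring_map \<beta>"
    and pow: "\<And>i h. Polynomial.monom 1 i dvd \<beta> h \<longleftrightarrow> (\<exists>c. h = hev i c x y)"
    and mult: "\<not> Polynomial.monom 1 1 dvd \<beta> q \<or> \<not> Polynomial.monom 1 2 dvd \<beta> f"
  shows "linear_type (ideal3 (x * q) (y * q) f)"
proof -
  interpret three_generators "x * q" "y * q" f .
  interpret \<epsilon>: ring_map \<epsilon> by (rule ring_map_\<epsilon>)
  interpret \<beta>: ring_map \<beta> by fact
  define e where "e i = (if i = 0 then x * q else if i = 1 then y * q else f)" for i :: 3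
  define S where "S = (subst cst (\<lambda>i. var (e i)) :: (3, 'r) mpoly \<Rightarrow> ('r, 'r) mpoly)"
  interpret S: ring_map S unfolding S_def by (rule subst_cst_map)
  have S_cst: "S (cst c) = cst c" and S_var: "S (var i) = var (e i)" for c i by (simp_all add: S_def)
  have e_I: "e i \<in> ideal3 (x * q) (y * q) f" for i using e_mem by (simp add: e_def)
  have S_C: "S H \<in> C" for H
    by (induction H rule: mpoly_induct) (simp_all add: S_cst S_var S.maps C_cst C_add C_mult C_var e_I)
  define N where "N = {H. S H \<in> J}"
  have N: "is_ideal N"
    by (auto simp: is_ideal_def N_def S.maps J_0 J_add intro: J_mult S_C)
  let ?T0 = "var 0 :: (3, 'r) mpoly" and ?T1 = "var 1 :: (3, 'r) mpoly" and ?T2 = "var 2 :: (3, 'r) mpoly"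
  have L1: "cst y * ?T0 - cst x * ?T1 \<in> N"
    using syzygy_J[of y "- x" 0] by (simp add: N_def S.maps S_cst S_var e_def cst.maps ac_simps)
  have L2: "cst p * ?T0 + cst s * ?T1 - cst q * ?T2 \<in> N"
    using syzygy_J[of p s "- q"] by (simp add: N_def S.maps S_cst S_var e_def cst.maps f algebra_simps)
  \<comment> \<open>Forms in the first two variables with the same value at \<open>(x, y)\<close> agree modulo the first relation.\<close>
  have zero: "hev i (\<lambda>j. cst (c j)) ?T0 ?T1 \<in> N" if root: "hev i c x y = 0" for i c
  proof -
    obtain \<nu> where \<nu>: "\<nu> 0 = 0" "\<nu> (Suc i) = 0" "\<And>j. j \<le> i \<Longrightarrow> c j = y * \<nu> j - x * \<nu> (Suc j)"
      using hev_root[OF root nz(1) cop_xy] by metis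
    show ?thesis
    proof (cases i)
      case 0
      then show ?thesis using \<nu> by (simp add: cst.zero is_ideal_0[OF N])
    next
      case (Suc k)
      have "hev (Suc k) (\<lambda>j. cst (c j)) ?T0 ?T1 = hev (Suc k) (\<lambda>j. cst y * cst (\<nu> j) - cst x * cst (\<nu> (Suc j))) ?T0 ?T1"
        by (rule hev_cong) (simp add: \<nu>(3) Suc cst.maps)
      also have "\<dots> = (cst y * ?T0 - cst x * ?T1) * hev k (\<lambda>j. cst (\<nu> (Suc j))) ?T0 ?T1"
        by (rule hev_factor) (use \<nu> Suc in \<open>simp_all add: cst.zero\<close>)
      finally show ?thesis using is_ideal_mult2[OF N L1] by (simp add: Suc)
    qed
  qed
  have same: "hev i (\<lambda>j. cst (c j)) ?T0 ?T1 - hev i (\<lambda>j. cst (c' j)) ?T0 ?T1 \<in> N" if "hev i c x y = hev i c' x y" for i c c'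
  proof -
    have "hev i (\<lambda>j. c j - c' j) x y = 0" using that by (simp add: hev_def left_diff_distrib sum_subtractf)
    from zero[OF this] show ?thesis by (simp add: hev_def left_diff_distrib sum_subtractf cst.maps)
  qed
  have form: "H \<in> N" if H: "H \<in> forms n" "subst id e H = 0" for H n
  proof -
    interpret ev: ring_map "subst id e" by (rule subst_id_map)
    obtain c where c: "H = (\<Sum>i\<le>n. hev i (\<lambda>j. cst (c i j)) ?T0 ?T1 * ?T2 ^ (n - i))"
      by (rule that[of "\<lambda>i j. Poly_Mapping.lookup H (mon j (i - j) (n - i))"]) (rule forms_expand[OF H(1)])
    define \<rho> where "\<rho> i = hev i (c i) x y" for i
    have "subst id e H = (\<Sum>i\<le>n. hev i (c i) (q * x) (q * y) * f ^ (n - i))"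
      by (simp add: c ev.maps ev.map_hev e_def mult.commute)
    also have "\<dots> = hev n \<rho> q f"
      unfolding hev_scale by (simp add: hev_def[of n \<rho>] \<rho>_def mult.commute mult.left_commute)
    finally have "hev n \<rho> q f = 0" using H(2) by simp
    then obtain \<nu> where \<nu>: "\<nu> 0 = 0" "\<nu> (Suc n) = 0" "\<And>j. j \<le> n \<Longrightarrow> \<rho> j = f * \<nu> j - q * \<nu> (Suc j)"
      using hev_root[OF _ nz(2) cop_qf] by metis
    have \<rho>_V: "Polynomial.monom 1 j dvd \<beta> (\<rho> j)" for j unfolding pow \<rho>_def by blast
    have f_V: "Polynomial.monom 1 1 dvd \<beta> f"
      unfolding pow by (intro exI[of _ "\<lambda>i. if i = 0 then s else p"]) (simp add: hev_Suc f)
    have \<nu>_V: "Polynomial.monom 1 j dvd \<beta> (\<nu> (Suc j))" if "j \<le> n" for j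
    proof (cases "Polynomial.monom 1 1 dvd \<beta> q")
      case False
      \<comment> \<open>Here \<open>q\<close> has order zero, and one solves for the next coefficient.\<close>
      show ?thesis using that
      proof (induction j)
        case (Suc j)
        then have "Polynomial.monom 1 (1 + j) dvd \<beta> f * \<beta> (\<nu> (Suc j))"
          using mult_dvd_mono[OF f_V, of "Polynomial.monom 1 j"] by (simp add: mult_monom)
        then have "Polynomial.monom 1 (Suc j) dvd \<beta> f * \<beta> (\<nu> (Suc j)) - \<beta> (\<rho> (Suc j))"
          using \<rho>_V[of "Suc j"] by (intro dvd_diff) simp_all
        also have "\<beta> f * \<beta> (\<nu> (Suc j)) - \<beta> (\<rho> (Suc j)) = \<beta> q * \<beta> (\<nu> (Suc (Suc j)))"
          using \<nu>(3)[OF Suc.prems] by (simp add: \<beta>.maps)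
        finally have "Polynomial.monom 1 (0 + Suc j) dvd \<beta> q * \<beta> (\<nu> (Suc (Suc j)))" by (simp only: add_0)
        then show ?case by (rule monom_dvd_cancel) (use False in \<open>simp only: One_nat_def not_False_eq_True\<close>)
      qed simp
    next
      case True
      \<comment> \<open>Here \<open>f\<close> has order one, and one solves for the preceding coefficient.\<close>
      then have f2: "\<not> Polynomial.monom 1 (Suc 1) dvd \<beta> f" using mult by (simp add: numeral_2_eq_2)
      show ?thesis using that
      proof (induction j rule: inc_induct)
        case base
        show ?case using \<nu>(2) by (simp add: \<beta>.zero)
      next
        case (step j)
        have "Polynomial.monom 1 (Suc j) dvd \<beta> (\<rho> (Suc j)) + \<beta> q * \<beta> (\<nu> (Suc (Suc j)))"
          using \<rho>_V step.IH by (intro dvd_add dvd_mult) simp_all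
        also have "\<beta> (\<rho> (Suc j)) + \<beta> q * \<beta> (\<nu> (Suc (Suc j))) = \<beta> f * \<beta> (\<nu> (Suc j))"
          using \<nu>(3)[of "Suc j"] step.hyps by (simp add: \<beta>.maps)
        finally have "Polynomial.monom 1 (1 + j) dvd \<beta> f * \<beta> (\<nu> (Suc j))" by (simp only: plus_1_eq_Suc)
        then show ?case by (rule monom_dvd_cancel) (rule f2)
      qed
    qed
    have "\<exists>\<kappa>. \<forall>j\<le>n. \<nu> (Suc j) = hev j (\<kappa> j) x y" using \<nu>_V unfolding pow by metis
    then obtain \<kappa>' where \<kappa>': "\<And>j. j \<le> n \<Longrightarrow> \<nu> (Suc j) = hev j (\<kappa>' j) x y" by blast
    \<comment> \<open>Here \<open>\<nu> (Suc n) = 0\<close>, and the zero form is chosen for it, so that nothing remains at the end of the telescoping sum.\<close>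
    define \<kappa> where "\<kappa> j = (if j = n then (\<lambda>_. 0) else \<kappa>' j)" for j
    have \<kappa>: "\<nu> (Suc j) = hev j (\<kappa> j) x y" if "j \<le> n" for j
      using \<kappa>'[OF that] \<nu>(2) by (auto simp: \<kappa>_def hev_def)
    define K where "K j = hev j (\<lambda>i. cst (\<kappa> j i)) ?T0 ?T1" for j
    have K_n: "K n = 0" by (simp add: K_def \<kappa>_def hev_def cst.zero)
    let ?L = "cst p * ?T0 + cst s * ?T1"
    have qK: "hev i (\<lambda>j. cst (q * \<kappa> i j)) ?T0 ?T1 = cst q * K i" for i
      by (simp add: K_def hev_def cst.mult sum_distrib_left mult.assoc)
    have H0: "hev 0 (\<lambda>j. cst (c 0 j)) ?T0 ?T1 + cst q * K 0 \<in> N"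
    proof -
      have "c 0 0 = - (q * \<kappa> 0 0)" using \<nu>(3)[of 0] \<nu>(1) \<kappa>[of 0] by (simp add: \<rho>_def)
      then show ?thesis by (simp add: K_def cst.maps is_ideal_0[OF N])
    qed
    have HS: "hev (Suc i) (\<lambda>j. cst (c (Suc i) j)) ?T0 ?T1 - (?L * K i - cst q * K (Suc i)) \<in> N" if "Suc i \<le> n" for i
    proof -
      let ?d = "\<lambda>j. p * (if j = 0 then 0 else \<kappa> i (j - 1)) + s * (if j \<le> i then \<kappa> i j else 0)"
      let ?d' = "\<lambda>j. ?d j - q * \<kappa> (Suc i) j"
      have sub: "hev (Suc i) ?d' x y = hev (Suc i) ?d x y - q * hev (Suc i) (\<kappa> (Suc i)) x y"
        by (simp only: hev_def left_diff_distrib sum_subtractf sum_distrib_left mult.assoc)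
      have "hev (Suc i) (c (Suc i)) x y = hev (Suc i) ?d' x y"
        unfolding sub using \<nu>(3)[OF that] \<kappa>[of i] \<kappa>[OF that] that
        by (simp add: \<rho>_def f flip: hev_mult_linear)
      from same[OF this] have "hev (Suc i) (\<lambda>j. cst (c (Suc i) j)) ?T0 ?T1 - hev (Suc i) (\<lambda>j. cst (?d' j)) ?T0 ?T1 \<in> N" .
      moreover have "hev (Suc i) (\<lambda>j. cst (?d' j)) ?T0 ?T1 = hev (Suc i) (\<lambda>j. cst (?d j)) ?T0 ?T1 - hev (Suc i) (\<lambda>j. cst (q * \<kappa> (Suc i) j)) ?T0 ?T1"
        by (simp only: hev_def cst.diff left_diff_distrib sum_subtractf)
      moreover have "hev (Suc i) (\<lambda>j. cst (?d j)) ?T0 ?T1 = ?L * K i"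
      proof -
        have "(\<lambda>j. cst (?d j)) = (\<lambda>j. cst p * (if j = 0 then 0 else cst (\<kappa> i (j - 1))) + cst s * (if j \<le> i then cst (\<kappa> i j) else 0) :: (3, 'r) mpoly)"
          by (auto simp: cst.maps)
        then show ?thesis unfolding K_def hev_mult_linear by simp
      qed
      ultimately show ?thesis by (simp only: qK)
    qed
    have "(\<Sum>i\<le>k. hev i (\<lambda>j. cst (c i j)) ?T0 ?T1 * ?T2 ^ (n - i)) + cst q * K k * ?T2 ^ (n - k) \<in> N" if "k \<le> n" for k
      using that
    proof (induction k)
      case 0
      have "?T2 ^ n * (hev 0 (\<lambda>j. cst (c 0 j)) ?T0 ?T1 + cst q * K 0) \<in> N" by (rule is_ideal_mult[OF N H0])
      then show ?case by (simp add: algebra_simps)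
    next
      case (Suc k)
      have pw: "?T2 ^ (n - k) = ?T2 * ?T2 ^ (n - Suc k)" using Suc.prems by (simp add: Suc_diff_Suc flip: power_Suc)
      have 1: "?T2 ^ (n - Suc k) * (hev (Suc k) (\<lambda>j. cst (c (Suc k) j)) ?T0 ?T1 - (?L * K k - cst q * K (Suc k))) \<in> N"
        by (rule is_ideal_mult[OF N HS[OF Suc.prems]])
      have 2: "K k * ?T2 ^ (n - Suc k) * (?L - cst q * ?T2) \<in> N" by (rule is_ideal_mult[OF N L2])
      have 3: "(\<Sum>i\<le>k. hev i (\<lambda>j. cst (c i j)) ?T0 ?T1 * ?T2 ^ (n - i)) + cst q * K k * ?T2 ^ (n - k) \<in> N"
        using Suc by simp
      from is_ideal_add[OF N is_ideal_add[OF N 1 2] 3] show ?case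
        unfolding pw by (simp add: algebra_simps)
    qed
    from this[of n] show ?thesis by (simp add: K_n flip: c)
  qed
  \<comment> \<open>The homogeneous components of \<open>H\<close> correspond to the coefficients of its image in \<open>R[t]\<close>.\<close>
  have kernel: "H \<in> N" if "\<epsilon> (S H) = 0" for H
  proof -
    have ev_map: "ring_map (subst id e)" by (rule subst_id_map)
    have ws: "\<epsilon> (S H) = poly (map_poly (\<lambda>u. [:subst id e u:]) (grade UNIV H)) (Polynomial.monom 1 1)" for H
    proof (rule ring_map_eqI[OF ring_map_comp[OF S.ring_map_axioms ring_map_\<epsilon>]
          ring_map_comp[OF ring_map_grade map_poly_ring_map[OF ring_map_comp[OF ev_map ring_map_const_poly]]]])
      show "\<epsilon> (S (cst c)) = poly (map_poly (\<lambda>u. [:subst id e u:]) (grade UNIV (cst c))) (Polynomial.monom 1 1)" for c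
        by (simp add: S_cst \<epsilon>_cst grade_cst map_poly_pCons ring_map.zero[OF ev_map])
      show "\<epsilon> (S (var i)) = poly (map_poly (\<lambda>u. [:subst id e u:]) (grade UNIV (var i))) (Polynomial.monom 1 1)" for i
        by (simp add: S_var \<epsilon>_var grade_var map_poly_monom poly_monom ring_map.zero[OF ev_map] smult_monom)
    qed
    have co: "coeff (\<epsilon> (S H)) n = subst id e (hcomp n H)" for n
    proof -
      have "\<epsilon> (S H) = (\<Sum>i\<le>Polynomial.degree (map_poly (\<lambda>u. [:subst id e u:]) (grade UNIV H)).
          [:subst id e (hcomp i H):] * Polynomial.monom 1 i)"
        unfolding ws poly_altdef
        by (simp add: coeff_map_poly ring_map.zero[OF ev_map] hcomp_def monom_power)
      then have *: "coeff (\<epsilon> (S H)) n = (if n \<le> Polynomial.degree (map_poly (\<lambda>u. [:subst id e u:]) (grade UNIV H)) then subst id e (hcomp n H) else 0)"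
        by (simp add: coeff_sum smult_monom)
      have "subst id e (hcomp n H) = 0" if "n > Polynomial.degree (map_poly (\<lambda>u. [:subst id e u:]) (grade UNIV H))"
        using coeff_eq_0[OF that] by (simp add: coeff_map_poly ring_map.zero[OF ev_map] hcomp_def)
      then show ?thesis using * by auto
    qed
    have "hcomp n H \<in> N" for n
      by (rule form[OF hcomp_forms]) (use co[of n] that in simp)
    then have "(\<Sum>n\<le>Polynomial.degree (grade UNIV H). hcomp n H) \<in> N" by (intro is_ideal_sum[OF N]) simp
    then show ?thesis by (simp flip: hcomp_sum_all)
  qed
  have reduce: "\<exists>H. P - S H \<in> J" if "P \<in> C" for P
    using that
  proof (induction rule: C_induct)
    case (cst c)
    show ?case by (rule exI[of _ "cst c"]) (simp add: S_cst J_0)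
  next
    case (var a)
    then obtain r t u where a: "a = r * (x * q) + t * (y * q) + u * f" unfolding ideal3_def by blast
    show ?case unfolding a
      using combination_J[of r t u]
      by (intro exI[of _ "cst r * var 0 + cst t * var 1 + cst u * var 2"]) (simp add: S.maps S_cst S_var e_def)
  next
    case (add P Q)
    then obtain H H' where "P - S H \<in> J" "Q - S H' \<in> J" by blast
    from J_add[OF this] show ?case by (intro exI[of _ "H + H'"]) (simp add: S.add algebra_simps)
  next
    case (mult P Q)
    then obtain H H' where H: "P - S H \<in> J" "Q - S H' \<in> J" by blast
    have "P * (Q - S H') + S H' * (P - S H) \<in> J"
      by (intro J_add J_mult H S_C mult.hyps)
    then show ?case by (intro exI[of _ "H * H'"]) (simp add: S.mult algebra_simps)
  qed
  show ?thesis unfolding linear_type_iff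
  proof (intro ballI impI)
    fix P assume P: "P \<in> C" "\<epsilon> P = 0"
    then obtain H where H: "P - S H \<in> J" using reduce by blast
    then have "\<epsilon> (S H) = 0" using \<epsilon>_J[OF H] P by (simp add: \<epsilon>.diff)
    then have "S H \<in> J" using kernel by (simp add: N_def)
    from J_add[OF H this] show "P \<in> J" by simp
  qed
qed

section \<open>The linear type property of the normal form\<close>

lemma hev_add: "hev k c x y + hev k c' x y = hev k (\<lambda>i. c i + c' i) x y"
  by (simp add: hev_def distrib_right sum.distrib)

lemma hev_at_0: "k \<noteq> 0 \<Longrightarrow> hev k c 0 0 = 0"
  unfolding hev_def
proof (rule sum.neutral, intro ballI)
  fix i assume "k \<noteq> 0" "i \<in> {..k}"
  then show "c i * 0 ^ i * 0 ^ (k - i) = 0" by (cases "i = 0") (simp_all add: zero_power)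
qed

text \<open>
  Both sides say that \<open>h\<close> lies in the \<open>i\<close>-th power of the ideal \<open>(x, y)\<close>; the coefficients \<open>c\<close> are
  arbitrary polynomials.
\<close>

lemma power_of_xy_ideal:
  fixes h :: "(3, 'k::comm_ring_1) mpoly"
  shows "Polynomial.monom 1 i dvd grade {0, 1} h \<longleftrightarrow> (\<exists>c. h = hev i c (var 0) (var 1))"
proof
  assume "\<exists>c. h = hev i c (var 0) (var 1)"
  then obtain c where c: "h = hev i c (var 0) (var 1)" by blast
  have "grade {0, 1} h = hev i (\<lambda>j. grade {0, 1} (c j)) (Polynomial.monom 1 1 * [:var 0:]) (Polynomial.monom 1 1 * [:var 1:])"
    by (simp add: c grade.map_hev grade_var smult_monom)
  then show "Polynomial.monom 1 i dvd grade {0, 1} h"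
    unfolding hev_scale by (simp add: monom_power)
next
  assume dvd: "Polynomial.monom 1 i dvd grade {0, 1} h"
  have keys: "i \<le> Poly_Mapping.lookup m 0 + Poly_Mapping.lookup m 1" if "m \<in> Poly_Mapping.keys h" for m
  proof (rule ccontr)
    assume "\<not> ?thesis"
    then have "weight {0, 1} m < i" by (simp add: weight_def)
    then have "coeff (grade {0, 1} h) (weight {0, 1} m) = 0" using dvd monom_1_dvd_iff' by metis
    then have "Poly_Mapping.lookup h m = 0" using lookup_coeff_grade[of "{0, 1}" h "weight {0, 1} m" m] by simp
    then show False using that by (simp add: in_keys_iff)
  qed
  have mono: "\<exists>c. Poly_Mapping.single m r = hev i c (var 0) (var 1)"
    if "i \<le> Poly_Mapping.lookup m 0 + Poly_Mapping.lookup m 1" for m :: "3 \<Rightarrow>\<^sub>0 nat" and r :: 'k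
  proof -
    let ?a = "Poly_Mapping.lookup m 0" and ?b = "Poly_Mapping.lookup m 1" and ?c = "Poly_Mapping.lookup m 2"
    define j where "j = min ?a i"
    have j: "j \<le> i" "j \<le> ?a" "i - j \<le> ?b" using that by (auto simp: j_def)
    let ?r = "cst r * var 0 ^ (?a - j) * var 1 ^ (?b - (i - j)) * var 2 ^ ?c :: (3, 'k) mpoly"
    have "hev i (\<lambda>l. if l = j then ?r else 0) (var 0) (var 1) = (\<Sum>l\<le>i. if l = j then ?r * var 0 ^ j * var 1 ^ (i - j) else 0)"
      unfolding hev_def by (rule sum.cong) auto
    also have "\<dots> = ?r * var 0 ^ j * var 1 ^ (i - j)" using j by simp
    also have "\<dots> = cst r * (var 0 ^ (?a - j) * var 0 ^ j) * (var 1 ^ (?b - (i - j)) * var 1 ^ (i - j)) * var 2 ^ ?c"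
      by (simp only: ac_simps)
    also have "\<dots> = cst r * var 0 ^ ?a * var 1 ^ ?b * var 2 ^ ?c"
      using j by (simp flip: power_add)
    also have "\<dots> = Poly_Mapping.single m r"
      using single_mon[of ?a ?b ?c r] mon_cases[of m] by simp
    finally show ?thesis by (intro exI) (rule sym)
  qed
  have "\<exists>c. (\<Sum>m\<in>A. Poly_Mapping.single m (g m)) = hev i c (var 0) (var 1)"
    if "finite A" "\<And>m. m \<in> A \<Longrightarrow> i \<le> Poly_Mapping.lookup m 0 + Poly_Mapping.lookup m 1" for A :: "(3 \<Rightarrow>\<^sub>0 nat) set" and g :: "(3 \<Rightarrow>\<^sub>0 nat) \<Rightarrow> 'k"
    using that
  proof induction
    case empty
    show ?case by (rule exI[of _ "\<lambda>_. 0"]) (simp add: hev_def)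
  next
    case (insert m A)
    then obtain c where c: "(\<Sum>m\<in>A. Poly_Mapping.single m (g m)) = hev i c (var 0) (var 1)" by blast
    obtain c' where c': "Poly_Mapping.single m (g m) = hev i c' (var 0) (var 1)"
      using mono[of m "g m"] insert.prems by blast
    have "(\<Sum>m\<in>insert m A. Poly_Mapping.single m (g m)) = hev i (\<lambda>j. c' j + c j) (var 0) (var 1)"
      unfolding sum.insert[OF insert.hyps] c c' by (rule hev_add)
    then show ?case by blast
  qed
  from this[of "Poly_Mapping.keys h" "Poly_Mapping.lookup h", OF finite_keys keys]
  show "\<exists>c. h = hev i c (var 0) (var 1)" by (simp only: poly_mapping_sum_single[of h, symmetric])
qed

text \<open>Restriction to the line through the vertex in direction \<open>(a : b)\<close>, parametrized by \<open>t \<mapsto> (a t, b t, 1)\<close>.\<close>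

definition restrict :: "'k::comm_ring_1 \<Rightarrow> 'k \<Rightarrow> (3, 'k) mpoly \<Rightarrow> 'k poly" where
  "restrict a b = subst (\<lambda>c. [:c:]) (\<lambda>i. if i = 0 then [:0, a:] else if i = 1 then [:0, b:] else 1)"

lemma restrict_map: "ring_map (restrict a b)"
  unfolding restrict_def by (rule ring_map.ring_map_subst[OF ring_map_const_poly])

interpretation restrict: ring_map "restrict a b" for a b by (rule restrict_map)

lemma restrict_cst: "restrict a b (cst c) = [:c:]"
  unfolding restrict_def by (rule ring_map.subst_cst[OF ring_map_const_poly])

lemma restrict_var: "restrict a b (var i) = (if i = 0 then [:0, a:] else if i = 1 then [:0, b:] else 1)"
  unfolding restrict_def by (rule ring_map.subst_var[OF ring_map_const_poly])

lemma restrict_hev: "Polynomial.monom 1 k dvd restrict a b (hev k c (var 0) (var 1))"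
proof -
  have "restrict a b (hev k c (var 0) (var 1)) = hev k (\<lambda>i. restrict a b (c i)) (Polynomial.monom 1 1 * [:a:]) (Polynomial.monom 1 1 * [:b:])"
    by (simp add: restrict.map_hev restrict_var monom_Suc)
  then show ?thesis unfolding hev_scale by (simp add: monom_power)
qed

lemma restrict_bf: "restrict a b (bf k c) = Polynomial.monom (hev k c a b) k"
proof -
  have "restrict a b (bf k c) = hev k (\<lambda>i. [:c i:]) (Polynomial.monom 1 1 * [:a:]) (Polynomial.monom 1 1 * [:b:])"
    by (simp add: restrict.map_hev restrict_var restrict_cst monom_Suc)
  also have "\<dots> = Polynomial.monom 1 1 ^ k * hev k (\<lambda>i. [:c i:]) [:a:] [:b:]" by (rule hev_scale)
  also have "hev k (\<lambda>i. [:c i:]) [:a:] [:b:] = [:hev k c a b:]"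
    by (rule ring_map.map_hev[OF ring_map_const_poly, symmetric])
  finally show ?thesis by (simp add: monom_power smult_monom)
qed

lemma restrict_at_0: "coeff (restrict a b p) 0 = ev 0 0 1 p"
proof -
  have "ring_map (\<lambda>h::'a poly. poly h 0)" by unfold_locales simp_all
  from ring_map_eqI[OF ring_map_comp[OF restrict_map this] ev_ring_map]
  have "poly (restrict a b p) 0 = ev 0 0 1 p"
    by (simp add: restrict_cst restrict_var)
  then show ?thesis by (simp add: poly_0_coeff_0)
qed

context normal_form
begin

lemma leading_nz: "(\<exists>i\<le>m. q1 i \<noteq> 0) \<or> (\<exists>i\<le>Suc m. f1 i \<noteq> 0)"
proof (rule ccontr)
  assume "\<not> ?thesis"
  then have "bf m q1 = 0" "bf (Suc m) f1 = 0" by (auto simp: hev_def cst.zero)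
  then have "zdeg q = 0" "zdeg f = 0" by (simp_all add: q_eq f_eq zdeg_hev)
  then show False using depends by simp
qed

lemma restrict_f: "restrict a b f = Polynomial.monom (hev (Suc m) f1 a b) (Suc m) + Polynomial.monom (hev (Suc (Suc m)) f2 a b) (Suc (Suc m))"
  by (simp add: f_eq restrict.maps restrict_bf restrict_var)

text \<open>
  Since \<open>q\<close> divides \<open>t f\<close>, it divides \<open>t\<close>, and \<open>q\<close> vanishes at the vertex. Dividing the syzygy by \<open>q\<close>
  gives \<open>r x + s y + u f = 0\<close>, where \<open>f\<close> has order at least two at the vertex; so the linear terms of
  \<open>r x + s y\<close>, whose coefficients are the values of \<open>r\<close> and \<open>s\<close>, vanish.
\<close>

lemma syzygies_vanish:
  assumes "m \<noteq> 0" "r * (var 0 * q) + s * (var 1 * q) + t * f = 0"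
  shows "ev 0 0 1 r = 0 \<and> ev 0 0 1 s = 0 \<and> ev 0 0 1 t = 0"
proof -
  have "t * f = q * (- (r * var 0 + s * var 1))"
  proof -
    have "t * f = - (r * (var 0 * q) + s * (var 1 * q))" using assms(2) by (simp only: add_eq_0_iff)
    then show ?thesis by (simp add: algebra_simps)
  qed
  then have "q dvd t * f" by (rule dvdI)
  then have "q dvd t" by (rule q_dvd)
  then obtain u where u: "t = q * u" by (elim dvdE)
  have "ev 0 0 1 q = 0" using assms(1) by (simp add: ev_q hev_at_0)
  then have t: "ev 0 0 1 t = 0" by (simp add: u ring_map.mult[OF ev_ring_map])
  have "q * (r * var 0 + s * var 1 + u * f) = 0" using assms(2) u by (simp add: algebra_simps)
  then have eq: "r * var 0 + s * var 1 + u * f = 0" using q_nz by simp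
  have "a * ev 0 0 1 r + b * ev 0 0 1 s = 0" for a b
  proof -
    have "restrict a b (r * var 0 + s * var 1 + u * f) = 0" by (simp add: eq restrict.zero)
    then have "coeff (restrict a b r * [:0, a:] + restrict a b s * [:0, b:] + restrict a b u * restrict a b f) 1 = 0"
      by (simp add: restrict.maps restrict_var)
    moreover have "coeff (restrict a b f) 0 = 0" "coeff (restrict a b f) 1 = 0"
      using assms(1) by (simp_all add: restrict_f)
    then have "coeff (restrict a b u * restrict a b f) 1 = 0" by (simp add: coeff_mult)
    ultimately show ?thesis
      by (simp add: coeff_mult restrict_at_0 mult.commute)
  qed
  from this[of 1 0] this[of 0 1] t show ?thesis by simp
qed

text \<open>
  In degree two the coefficients of \<open>z\<close> are a constant and a linear form, and one of them is not zero.
\<close>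

lemma multiplicities_m0:
  assumes "m = 0"
  shows "\<not> Polynomial.monom 1 1 dvd grade {0, 1} q \<or> \<not> Polynomial.monom 1 2 dvd grade {0, 1} f"
proof (rule ccontr)
  assume "\<not> ?thesis"
  then obtain c c' where c: "q = hev 1 c (var 0) (var 1)" and c': "f = hev 2 c' (var 0) (var 1)"
    unfolding power_of_xy_ideal by blast
  have "ev 0 0 1 q = 0" unfolding c by (simp add: ring_map.map_hev[OF ev_ring_map] hev_at_0)
  then have q1: "q1 0 = 0" using assms by (simp add: ev_q hev_at_0)
  have "hev 1 f1 a b = 0" for a b
  proof -
    have "Polynomial.monom 1 2 dvd restrict a b f" unfolding c' by (rule restrict_hev)
    then have "coeff (restrict a b f) 1 = 0" unfolding monom_1_dvd_iff' by simp
    then show ?thesis by (simp add: restrict_f assms)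
  qed
  from this[of 1 0] this[of 0 1] have "f1 0 = 0" "f1 1 = 0" by (simp_all add: hev_Suc)
  then have "f1 i = 0" if "i \<le> 1" for i using that by (cases i) auto
  with q1 leading_nz assms show False by auto
qed

end

section \<open>Monogenic residue rings\<close>

definition monogenic :: "(3, 'k::field) mpoly set \<Rightarrow> bool" where
  "monogenic P \<longleftrightarrow> (\<exists>N. \<forall>r. \<exists>h. r - poly (map_poly cst h) N \<in> P)"

text \<open>
  Over an algebraically closed field an equation for \<open>N\<close> splits into linear factors.
\<close>

lemma root_in_prime:
  fixes h :: "'k::alg_closed_field poly"
  assumes P: "is_prime P" and "h \<noteq> 0" "poly (map_poly cst h) N \<in> P"
  shows "\<exists>c. N - cst c \<in> P"
  using assms(2,3)
proof (induction "Polynomial.degree h" arbitrary: h rule: less_induct)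
  case less
  interpret pe: ring_map "\<lambda>h. poly (map_poly cst h) N" by (rule map_poly_ring_map[OF ring_map_cst])
  show ?case
  proof (cases "Polynomial.degree h = 0")
    case True
    then obtain c where c: "h = [:c:]" by (metis degree_eq_zeroE)
    then have "c = 0" using less.prems cst_in_prime[OF P] by (simp add: map_poly_pCons cst.zero)
    then show ?thesis using less.prems c by simp
  next
    case False
    then obtain c where "poly h c = 0" using alg_closed_imp_poly_has_root by blast
    then obtain h' where h': "h = [:- c, 1:] * h'" by (metis poly_eq_0_iff_dvd dvdE)
    then have nz: "h' \<noteq> 0" using less.prems by auto
    have "poly (map_poly cst h) N = (N - cst c) * poly (map_poly cst h') N"
      unfolding h' pe.mult by (simp add: map_poly_pCons cst.maps)
    then have "N - cst c \<in> P \<or> poly (map_poly cst h') N \<in> P"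
      using is_prime_mult[OF P] less.prems(2) by simp
    moreover have "Polynomial.degree h' < Polynomial.degree h"
      using nz unfolding h' by (subst degree_mult_eq) auto
    ultimately show ?thesis using less.hyps nz by blast
  qed
qed

lemma residue_constant:
  fixes P :: "(3, 'k::field) mpoly set"
  assumes P: "is_ideal P" and N: "\<And>r. \<exists>h. r - poly (map_poly cst h) N \<in> P" "N - cst c \<in> P"
  shows "\<exists>c. r - cst c \<in> P"
proof -
  have "poly (map_poly cst h) N - cst (poly h c) \<in> P" for h
  proof (induction h)
    case (pCons a h)
    have "N * poly (map_poly cst h) N - cst c * cst (poly h c) \<in> P"
      by (rule cong_mult[OF P N(2) pCons.IH])
    then show ?case by (simp add: map_poly_pCons cst.maps)
  qed (simp add: is_ideal_0[OF P] cst.zero)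
  then show ?thesis using N(1)[of r] cong_trans[OF P] by blast
qed

text \<open>
  A residue ring generated by one element \<open>N\<close> over \<open>k\<close> has dimension at most one: a nonzero prime of it
  contains some \<open>N - c\<close> and is maximal.
\<close>

lemma no_chain_of_monogenic:
  fixes P0 P1 P2 :: "(3, 'k::alg_closed_field) mpoly set"
  assumes P: "is_prime P1" "is_prime P2" and mono: "monogenic P0"
    and sub: "P0 \<subset> P1" "P1 \<subset> P2" and P0: "is_ideal P0"
  shows False
proof -
  note i1 = is_prime_ideal[OF P(1)] and i2 = is_prime_ideal[OF P(2)]
  obtain N where N: "\<And>r. \<exists>h. r - poly (map_poly cst h) N \<in> P0" using mono unfolding monogenic_def by blast
  obtain g where g: "g \<in> P1" "g \<notin> P0" using sub by blast
  obtain h where h: "g - poly (map_poly cst h) N \<in> P0" using N by blast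
  then have "h \<noteq> 0" using g(2) by auto
  moreover have "poly (map_poly cst h) N \<in> P1"
    using cong_mem[OF i1, of g] g(1) h sub(1) by blast
  ultimately obtain c where c: "N - cst c \<in> P1" using root_in_prime[OF P(1)] by blast
  have N1: "\<And>r. \<exists>h. r - poly (map_poly cst h) N \<in> P1" using N sub(1) by blast
  obtain s where s: "s \<in> P2" "s \<notin> P1" using sub by blast
  obtain c' where c': "s - cst c' \<in> P1" using residue_constant[OF i1 N1 c] by blast
  then have "cst c' \<in> P2" using cong_mem[OF i2] s(1) sub(2) by blast
  then have "c' = 0" by (rule cst_in_prime[OF P(2)])
  then show False using c' s(2) by (simp add: cst.zero)
qed

text \<open>
  If \<open>N\<close> is not in \<open>M\<close>, it is invertible modulo \<open>M\<close>, and its inverse is a polynomial in \<open>N\<close>. This is an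
  algebraic equation for \<open>N\<close>, so \<open>N\<close> is congruent to a constant.
\<close>

lemma maximal_residue_constant:
  fixes M :: "(3, 'k::alg_closed_field) mpoly set"
  assumes M: "is_prime M" and max: "\<And>N. is_ideal N \<Longrightarrow> M \<subseteq> N \<Longrightarrow> 1 \<notin> N \<Longrightarrow> N = M" and mono: "monogenic M"
  shows "\<exists>c. r - cst c \<in> M"
proof -
  note iM = is_prime_ideal[OF M]
  obtain N where N: "\<And>r. \<exists>h. r - poly (map_poly cst h) N \<in> M" using mono unfolding monogenic_def by blast
  have "\<exists>c. N - cst c \<in> M"
  proof (cases "N \<in> M")
    case True
    then show ?thesis by (intro exI[of _ 0]) (simp add: cst.zero)
  next
    case False
    have ideal: "is_ideal {a. \<exists>b. a - b * N \<in> M}" unfolding is_ideal_def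
    proof (intro conjI ballI allI)
      show "0 \<in> {a. \<exists>b. a - b * N \<in> M}" 
      proof -
        have "0 - 0 * N \<in> M" using is_ideal_0[OF iM] by simp
        then show ?thesis by blast
      qed
      show "u + v \<in> {a. \<exists>b. a - b * N \<in> M}"
        if uv: "u \<in> {a. \<exists>b. a - b * N \<in> M}" "v \<in> {a. \<exists>b. a - b * N \<in> M}" for u v
      proof -
        from uv obtain b b' where "u - b * N \<in> M" "v - b' * N \<in> M" by blast
        from is_ideal_add[OF iM this] have "(u + v) - (b + b') * N \<in> M" by (simp add: algebra_simps)
        then show ?thesis by blast
      qed
      show "w * u \<in> {a. \<exists>b. a - b * N \<in> M}" if u: "u \<in> {a. \<exists>b. a - b * N \<in> M}" for w u
      proof -
        from u obtain b where "u - b * N \<in> M" by blast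
        from is_ideal_mult[OF iM this, of w] have "w * u - (w * b) * N \<in> M" by (simp add: algebra_simps)
        then show ?thesis by blast
      qed
    qed
    have sub: "M \<subseteq> {a. \<exists>b. a - b * N \<in> M}"
    proof
      fix a assume "a \<in> M"
      then have "a - 0 * N \<in> M" by simp
      then show "a \<in> {a. \<exists>b. a - b * N \<in> M}" by blast
    qed
    have "N - 1 * N \<in> M" using is_ideal_0[OF iM] by simp
    then have "N \<in> {a. \<exists>b. a - b * N \<in> M}" by blast
    then have "1 \<in> {a. \<exists>b. a - b * N \<in> M}" using max[OF ideal sub] False by blast
    then obtain b where b: "1 - b * N \<in> M" by blast
    obtain h where h: "b - poly (map_poly cst h) N \<in> M" using N by blast
    \<comment> \<open>The polynomial \<open>1 - X h\<close>: modulo \<open>M\<close> its value at \<open>N\<close> is \<open>1 - N b\<close>.\<close>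
    let ?h = "1 - pCons 0 h"
    interpret pe: ring_map "\<lambda>h. poly (map_poly cst h) N" by (rule map_poly_ring_map[OF ring_map_cst])
    have "poly (map_poly cst ?h) N = (1 - b * N) + N * (b - poly (map_poly cst h) N)"
      by (simp add: pe.diff pe.one map_poly_pCons cst.zero algebra_simps)
    also have "\<dots> \<in> M" by (intro is_ideal_add is_ideal_mult iM b h)
    finally have "poly (map_poly cst ?h) N \<in> M" .
    moreover have "?h \<noteq> 0"
    proof
      assume "?h = 0"
      then have "coeff ?h 0 = 0" by (simp only: coeff_0)
      then show False by simp
    qed
    ultimately show ?thesis using root_in_prime[OF M] by blast
  qed
  then show ?thesis using residue_constant[OF iM N] by blast
qed

text \<open>
  A maximal ideal over a homogeneous ideal need not be homogeneous, and contains \<open>l - c\<close> rather than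
  \<open>l\<close>. For \<open>c \<noteq> 0\<close> the homogeneous components of \<open>u\<close> are in \<open>I\<close> by induction, starting from the lowest.
\<close>

lemma shifted_nonzerodivisor:
  fixes I :: "('v::finite, 'k::field) mpoly set"
  assumes I: "is_ideal I" and hom: "\<And>u n. u \<in> I \<Longrightarrow> hcomp n u \<in> I"
    and l: "l \<in> forms 1" "\<And>u. l * u \<in> I \<Longrightarrow> u \<in> I" and u: "(l - cst c) * u \<in> I"
  shows "u \<in> I"
proof (cases "c = 0")
  case True
  then show ?thesis using l u by (simp add: cst.zero)
next
  case False
  have "hcomp n u \<in> I" for n
  proof (induction n)
    case 0
    have "hcomp 0 ((l - cst c) * u) = - (cst c * hcomp 0 u)"
      by (simp add: left_diff_distrib hcomp_diff hcomp_mult_forms[OF l(1)] hcomp_mult_forms[OF forms_cst])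
    then have "cst c * hcomp 0 u \<in> I" using is_ideal_uminus[OF I hom[OF u, of 0]] by simp
    then show ?case by (rule cst_in_ideal[OF I _ False])
  next
    case (Suc n)
    have "hcomp (Suc n) ((l - cst c) * u) = l * hcomp n u - cst c * hcomp (Suc n) u"
      by (simp add: left_diff_distrib hcomp_diff hcomp_mult_forms[OF l(1)] hcomp_mult_forms[OF forms_cst])
    then have "cst c * hcomp (Suc n) u = l * hcomp n u - hcomp (Suc n) ((l - cst c) * u)" by simp
    also have "\<dots> \<in> I" by (intro is_ideal_diff is_ideal_mult I Suc hom u)
    finally show ?case by (rule cst_in_ideal[OF I _ False])
  qed
  then show ?thesis by (subst hcomp_sum_all) (intro is_ideal_sum I)
qed

section \<open>Multiplicities of infinitely near points\<close>

lemma UNIV_2: "(UNIV :: 2 set) = {0, 1}"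
proof -
  have "x = 0 \<or> x = 1" for x :: 2
  proof (induct x)
    case (of_int z)
    then have "0 \<le> z" "z < 2" by simp_all
    then have "z = 0 \<or> z = 1" by arith
    then show ?case by auto
  qed
  then show ?thesis by (intro UNIV_eq_I) blast
qed

lemma neq_2 [simp]: "(0::2) \<noteq> 1" "(1::2) \<noteq> 0" by simp_all

lemma mon_eval_2: "mon_eval g m = g 0 ^ Poly_Mapping.lookup m 0 * g 1 ^ Poly_Mapping.lookup m 1" for g :: "2 \<Rightarrow> 'a::comm_ring_1"
proof -
  have "mon_eval g m = (\<Prod>v\<in>{0, 1}. g v ^ Poly_Mapping.lookup m v)"
  proof (rule mon_eval_superset)
    show "Poly_Mapping.keys m \<subseteq> {0, 1}" unfolding UNIV_2[symmetric] by simp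
  qed simp
  then show ?thesis by simp
qed

lemma tdeg_2: "tdeg m = Poly_Mapping.lookup m 0 + Poly_Mapping.lookup m (1::2)"
  unfolding tdeg_weight weight_def UNIV_2 by simp

lemma Inf_enat_mem:
  fixes A :: "enat set"
  assumes "A \<noteq> {}" shows "Inf A \<in> A"
proof -
  obtain x where "x \<in> A" using assms by blast
  then have "(LEAST x. x \<in> A) \<in> A" by (rule LeastI)
  then show ?thesis using assms by (simp only: Inf_enat_def if_False)
qed

lemma ord_origin_le: "m \<in> Poly_Mapping.keys f \<Longrightarrow> ord_origin f \<le> enat (tdeg m)"
  unfolding ord_origin_def by (rule INF_lower)

lemma ord_origin_eq_enat:
  assumes "ord_origin f = enat n"
  shows "\<And>m. m \<in> Poly_Mapping.keys f \<Longrightarrow> n \<le> tdeg m" "\<exists>m\<in>Poly_Mapping.keys f. tdeg m = n"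
proof -
  show "n \<le> tdeg m" if "m \<in> Poly_Mapping.keys f" for m
    using ord_origin_le[OF that] assms by simp
  let ?A = "(\<lambda>m. enat (tdeg m)) ` Poly_Mapping.keys f"
  have "?A \<noteq> {}"
  proof
    assume "?A = {}"
    then have "ord_origin f = \<infinity>" by (simp add: ord_origin_def top_enat_def)
    then show False using assms by simp
  qed
  then have "Inf ?A \<in> ?A" by (rule Inf_enat_mem)
  then show "\<exists>m\<in>Poly_Mapping.keys f. tdeg m = n" using assms by (auto simp: ord_origin_def)
qed

text \<open>
  What is left of the blowdown after the equation of the exceptional curve has been split off.
\<close>

fun blowdown_factor :: "'k::field option \<Rightarrow> 2 \<Rightarrow> (2, 'k) mpoly" where
  "blowdown_factor (Some c) = (\<lambda>j. if j = 0 then 1 else var 1 + cst c)"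
| "blowdown_factor None = (\<lambda>j. if j = 0 then var 0 else 1)"

lemma blowdown_eq: "blowdown t j = exceptional t * blowdown_factor t j"
  by (cases t) (auto simp: mult.commute)

text \<open>
  The chart, as the ring of polynomials in the exceptional equation (the outer indeterminate) over the
  polynomials in the slope (the inner one). The slope is not shifted, so the point of the exceptional
  curve is its point with slope \<open>centre t\<close>.
\<close>

fun chart :: "'k::field option \<Rightarrow> 2 \<Rightarrow> 'k poly poly" where
  "chart (Some c) = (\<lambda>j. if j = 0 then [:0, 1:] else [:[:- c, 1:]:])"
| "chart None = (\<lambda>j. if j = 0 then [:[:0, 1:]:] else [:0, 1:])"

fun centre :: "'k::field option \<Rightarrow> 'k" where
  "centre (Some c) = c" | "centre None = 0"

text \<open>
  The variable whose exponent is the exponent of the slope in the pullback of a monomial.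
\<close>

fun slope_index :: "'k::field option \<Rightarrow> 2" where
  "slope_index (Some c) = 1" | "slope_index None = 0"

lemma ring_map_const2: "ring_map (\<lambda>c::'k::comm_ring_1. [:[:c:]:])"
  by (rule ring_map_comp[OF ring_map_const_poly ring_map_const_poly])

definition pull_chart :: "'k::field option \<Rightarrow> (2, 'k) mpoly \<Rightarrow> 'k poly poly" where
  "pull_chart t = subst (\<lambda>c. [:[:c:]:]) (chart t)"

lemma pull_chart_map: "ring_map (pull_chart t)"
  unfolding pull_chart_def by (rule ring_map.ring_map_subst[OF ring_map_const2])

interpretation pull_chart: ring_map "pull_chart t" for t by (rule pull_chart_map)

lemma pull_chart_cst: "pull_chart t (cst c) = [:[:c:]:]"
  unfolding pull_chart_def by (rule ring_map.subst_cst[OF ring_map_const2])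

lemma pull_chart_var: "pull_chart t (var j) = chart t j"
  unfolding pull_chart_def by (rule ring_map.subst_var[OF ring_map_const2])

lemma pull_chart_exceptional: "pull_chart t (exceptional t) = [:0, 1:]"
  by (cases t) (simp_all add: pull_chart_var)

lemma pull_chart_factor:
  "pull_chart t (mon_eval (blowdown_factor t) m) = [:Polynomial.monom 1 (Poly_Mapping.lookup m (slope_index t)):]"
proof -
  have "[:[:0, 1:]:] ^ k = [:Polynomial.monom 1 k:]" for k :: nat
    by (simp add: poly_const_pow monom_altdef)
  then show ?thesis
    by (cases t) (simp_all add: mon_eval_2 pull_chart.maps pull_chart_var pull_chart_cst)
qed

text \<open>
  Restricted to the exceptional curve, the equation of the proper transform is the initial form of \<open>f\<close>,
  dehomogenized: a nonzero polynomial \<open>H\<close> of degree at most \<open>n\<close> in the slope. Its order at the point in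
  question is at most its degree, and the order of the proper transform is at most this.
\<close>

lemma ord_proper_transform_le:
  fixes f :: "(2, 'k::field) mpoly"
  assumes f: "ord_origin f = enat n"
  shows "ord_origin (proper_transform t f) \<le> enat n"
proof -
  let ?u = "exceptional t" and ?r = "blowdown_factor t"
  let ?B = "pull_chart t"
  have u_nz: "?u \<noteq> 0" by (cases t) simp_all
  have mono: "mon_eval (blowdown t) m = ?u ^ tdeg m * mon_eval ?r m" for m
    by (simp add: mon_eval_2 blowdown_eq tdeg_2 power_mult_distrib power_add ac_simps)
  have pullback: "subst cst (blowdown t) f = (\<Sum>m\<in>Poly_Mapping.keys f. cst (Poly_Mapping.lookup f m) * (?u ^ tdeg m * mon_eval ?r m))"
    by (simp add: subst_alt mono)
  have "?u ^ n dvd subst cst (blowdown t) f"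
    unfolding pullback using ord_origin_eq_enat(1)[OF f]
    by (intro dvd_sum dvd_mult dvd_mult2 le_imp_power_dvd)
  then obtain g where g: "subst cst (blowdown t) f = ?u ^ n * g" by (elim dvdE)
  have pt: "proper_transform t f = g"
    unfolding proper_transform_def using f g u_nz by (intro the_equality) simp_all
  define H where "H = (\<Sum>m\<in>{m\<in>Poly_Mapping.keys f. tdeg m = n}. Polynomial.monom (Poly_Mapping.lookup f m) (Poly_Mapping.lookup m (slope_index t)))"
  have "?B (subst cst (blowdown t) f) = (\<Sum>m\<in>Poly_Mapping.keys f.
      Polynomial.monom (Polynomial.monom (Poly_Mapping.lookup f m) (Poly_Mapping.lookup m (slope_index t))) (tdeg m))"
    unfolding pullback
    by (simp add: pull_chart.maps pull_chart_cst pull_chart_exceptional pull_chart_factor monom_altdef[of _ "tdeg _"] smult_monom mult.commute)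
  then have "coeff (?B (subst cst (blowdown t) f)) n = H"
    by (simp add: coeff_sum H_def sum.If_cases Int_def if_distrib[of "\<lambda>x. coeff x _"] conj_commute)
  moreover have "coeff (?B (subst cst (blowdown t) f)) n = coeff (?B g) 0"
  proof -
    have "?B (subst cst (blowdown t) f) = Polynomial.monom 1 n * ?B g"
      by (simp add: g pull_chart.maps pull_chart_exceptional monom_altdef)
    then show ?thesis by (simp add: coeff_monom_mult)
  qed
  ultimately have H: "H = coeff (?B g) 0" by simp
  have inj: "k = m" if "tdeg k = tdeg m" "Poly_Mapping.lookup k (slope_index t) = Poly_Mapping.lookup m (slope_index t)" for k m :: "2 \<Rightarrow>\<^sub>0 nat"
  proof (rule poly_mapping_eqI)
    fix j :: 2
    have "j \<in> {0, 1}" unfolding UNIV_2[symmetric] by simp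
    then show "Poly_Mapping.lookup k j = Poly_Mapping.lookup m j"
      using that by (cases t) (auto simp: tdeg_2)
  qed
  have "H \<noteq> 0"
  proof -
    obtain m where m: "m \<in> Poly_Mapping.keys f" "tdeg m = n" using ord_origin_eq_enat(2)[OF f] by blast
    have "coeff H (Poly_Mapping.lookup m (slope_index t)) = (\<Sum>k\<in>{k\<in>Poly_Mapping.keys f. tdeg k = n}. if k = m then Poly_Mapping.lookup f m else 0)"
      unfolding H_def coeff_sum using inj m(2) by (intro sum.cong refl) auto
    also have "\<dots> = Poly_Mapping.lookup f m" using m by simp
    finally show ?thesis using m(1) by (auto simp: in_keys_iff)
  qed
  have deg_H: "Polynomial.degree H \<le> n"
    unfolding H_def
  proof (rule degree_sum_le)
    fix m assume "m \<in> {m \<in> Poly_Mapping.keys f. tdeg m = n}"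
    then have "Poly_Mapping.lookup m (slope_index t) \<le> n" by (cases t) (auto simp: tdeg_2)
    then show "Polynomial.degree (Polynomial.monom (Poly_Mapping.lookup f m) (Poly_Mapping.lookup m (slope_index t))) \<le> n"
      by (meson degree_monom_le order_trans)
  qed simp
  show ?thesis
  proof (rule ccontr)
    assume "\<not> ord_origin (proper_transform t f) \<le> enat n"
    then have big: "n < tdeg m" if "m \<in> Poly_Mapping.keys g" for m
      using ord_origin_le[OF that] unfolding pt by (metis enat_ord_simps(2) not_le order_less_le_trans)
    have c0: "ring_map (\<lambda>p::'k poly poly. coeff p 0)"
      by unfold_locales (simp_all add: coeff_mult)
    interpret c0: ring_map "\<lambda>p::'k poly poly. coeff p 0" by (rule c0)
    have "[:- centre t, 1:] ^ Suc n dvd coeff (?B g) 0"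
      unfolding pull_chart_def subst_alt c0.sum
    proof (rule dvd_sum)
      fix m assume "m \<in> Poly_Mapping.keys g"
      then have m: "Suc n \<le> tdeg m" using big by fastforce
      have "coeff (mon_eval (chart t) m) 0 = 0 \<or> coeff (mon_eval (chart t) m) 0 = [:- centre t, 1:] ^ tdeg m"
      proof (cases t)
        case None
        then show ?thesis by (cases "Poly_Mapping.lookup m 1") (simp_all add: mon_eval_2 c0.maps tdeg_2)
      next
        case (Some c)
        then show ?thesis by (cases "Poly_Mapping.lookup m 0") (simp_all add: mon_eval_2 c0.maps tdeg_2)
      qed
      then have "[:- centre t, 1:] ^ Suc n dvd coeff (mon_eval (chart t) m) 0"
        using le_imp_power_dvd[OF m, of "[:- centre t, 1:]"] by (elim disjE) (simp_all only: dvd_0_right)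
      then show "[:- centre t, 1:] ^ Suc n dvd coeff ([:[:Poly_Mapping.lookup g m:]:] * mon_eval (chart t) m) 0"
        by (simp add: c0.mult dvd_smult)
    qed
    then have "[:- centre t, 1:] ^ Suc n dvd H" by (simp add: H)
    from dvd_imp_degree_le[OF this \<open>H \<noteq> 0\<close>] have "Suc n \<le> Polynomial.degree H"
      by (simp only: degree_linear_power)
    then show False using deg_H by simp
  qed
qed

lemma min_ord_proper_transform_le:
  fixes S :: "(2, 'k::field) mpoly set"
  shows "min_ord (proper_transform t ` min_members S) \<le> min_ord S"
proof (cases "min_ord S")
  case (enat n)
  have "ord_origin ` S \<noteq> {}" using enat by (auto simp: min_ord_def top_enat_def)
  then have "Inf (ord_origin ` S) \<in> ord_origin ` S" by (rule Inf_enat_mem)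
  then obtain f where f: "f \<in> S" "ord_origin f = min_ord S" by (auto simp: min_ord_def)
  then have "f \<in> min_members S" by (simp add: min_members_def)
  then have "min_ord (proper_transform t ` min_members S) \<le> ord_origin (proper_transform t f)"
    unfolding min_ord_def by (intro INF_lower) simp
  also have "\<dots> \<le> min_ord S" using ord_proper_transform_le[of f n t] f enat by simp
  finally show ?thesis .
qed simp

lemma base_point_proper:
  assumes "(p, ts) \<in> base_points I d"
  shows "p \<in> proj_plane \<and> min_ord (local_system I d (p, ts)) \<le> min_ord (local_system I d (p, []))"
  using assms
proof (induction p ts rule: base_points.induct)
  case (infinitely_near p ts t)
  have "local_system I d (p, ts @ [t]) = proper_transform t ` min_members (local_system I d (p, ts))" by simp
  then have "min_ord (local_system I d (p, ts @ [t])) \<le> min_ord (local_system I d (p, ts))"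
    using min_ord_proper_transform_le by simp
  with infinitely_near show ?case by auto
qed simp

section \<open>Linear changes of coordinates\<close>

text \<open>
  Mutually inverse graded automorphisms of the polynomial ring over \<open>k\<close>.
\<close>

locale coordinate_change =
  fixes \<tau> \<sigma> :: "(3, 'k::field) mpoly \<Rightarrow> (3, 'k) mpoly"
  assumes ring_map_\<tau>: "ring_map \<tau>" and ring_map_\<sigma>: "ring_map \<sigma>"
    and \<tau>_cst [simp]: "\<tau> (cst c) = cst c" and \<sigma>_cst [simp]: "\<sigma> (cst c) = cst c"
    and \<tau>\<sigma> [simp]: "\<tau> (\<sigma> p) = p" and \<sigma>\<tau> [simp]: "\<sigma> (\<tau> p) = p"
    and \<tau>_forms: "p \<in> forms n \<Longrightarrow> \<tau> p \<in> forms n" and \<sigma>_forms: "p \<in> forms n \<Longrightarrow> \<sigma> p \<in> forms n"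
begin

sublocale \<tau>: ring_map \<tau> by (rule ring_map_\<tau>)
sublocale \<sigma>: ring_map \<sigma> by (rule ring_map_\<sigma>)

lemma inj_\<tau>: "inj \<tau>" by (rule inj_on_inverseI[of _ \<sigma>]) simp

lemma \<tau>_image_iff: "r \<in> \<tau> ` K \<longleftrightarrow> \<sigma> r \<in> K"
proof
  assume "\<sigma> r \<in> K"
  then have "\<tau> (\<sigma> r) \<in> \<tau> ` K" by (rule imageI)
  then show "r \<in> \<tau> ` K" by simp
qed auto

lemma \<tau>_ideal3: "\<tau> ` ideal3 a b c = ideal3 (\<tau> a) (\<tau> b) (\<tau> c)"
proof (intro equalityI subsetI)
  fix u assume "u \<in> \<tau> ` ideal3 a b c"
  then obtain r s t where "u = \<tau> (r * a + s * b + t * c)" by (auto simp: ideal3_def)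
  then have "u = \<tau> r * \<tau> a + \<tau> s * \<tau> b + \<tau> t * \<tau> c" by (simp add: \<tau>.maps)
  then show "u \<in> ideal3 (\<tau> a) (\<tau> b) (\<tau> c)" unfolding ideal3_def by blast
next
  fix u assume "u \<in> ideal3 (\<tau> a) (\<tau> b) (\<tau> c)"
  then obtain r s t where "u = r * \<tau> a + s * \<tau> b + t * \<tau> c" by (auto simp: ideal3_def)
  then have "\<sigma> u = \<sigma> r * a + \<sigma> s * b + \<sigma> t * c" by (simp add: \<sigma>.maps)
  then have "\<sigma> u \<in> ideal3 a b c" unfolding ideal3_def by blast
  then show "u \<in> \<tau> ` ideal3 a b c" by (simp add: \<tau>_image_iff)
qed

lemma \<tau>_dvd_iff: "\<tau> a dvd b \<longleftrightarrow> a dvd \<sigma> b"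
proof
  assume "\<tau> a dvd b"
  from \<sigma>.dvd[OF this] show "a dvd \<sigma> b" by simp
next
  assume "a dvd \<sigma> b"
  from \<tau>.dvd[OF this] show "\<tau> a dvd b" by simp
qed

lemma \<tau>_poly_cst: "\<tau> (poly (map_poly cst h) N) = poly (map_poly cst h) (\<tau> N)"
  by (induction h) (simp_all add: map_poly_pCons cst.zero \<tau>.maps)

lemma hilbert_function_\<tau>:
  assumes "is_ideal K"
  shows "hilbert_function (\<tau> ` K) n = hilbert_function K n"
proof -
  have "\<tau> ` K \<inter> forms n = \<tau> ` (K \<inter> forms n)"
    using \<tau>_forms[of _ n] \<sigma>_forms[of _ n] by (auto simp: \<tau>_image_iff) (metis \<sigma>\<tau>)
  moreover have "mp.dim (\<tau> ` (K \<inter> forms n)) = mp.dim (K \<inter> forms n)"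
    by (intro dim_injective_image inj_\<tau> mp.subspace_inter subspace_ideal subspace_forms assms)
      (simp_all add: \<tau>.maps)
  ultimately show ?thesis by (simp add: hilbert_function_def)
qed

text \<open>
  A change of coordinates in the source is compensated by the inverse change after \<open>G\<close>.
\<close>

lemma monoidal_map_\<sigma>:
  assumes F: "\<And>i. F i \<in> forms (Suc n)" "\<And>i. zdeg (\<sigma> (F i)) \<le> 1" and G: "\<And>i. G i \<in> forms e"
    and nz: "D \<noteq> 0" "E \<noteq> 0"
    and GF: "\<And>i. subst cst F (G i) = D * var i" and FG: "\<And>i. subst cst G (F i) = E * var i"
  shows "monoidal_map (\<lambda>i. \<sigma> (F i)) (\<lambda>j. subst cst G (\<tau> (var j))) n e (\<sigma> D) E"
proof
  interpret sF: ring_map "subst cst F" by (rule subst_cst_map)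
  interpret sG: ring_map "subst cst G" by (rule subst_cst_map)
  have lin: "subst cst G l \<in> forms e \<and> subst cst F (subst cst G l) = D * l" if "l \<in> forms 1" for l :: "(3, 'k) mpoly"
  proof -
    obtain a where a: "l = (\<Sum>i\<in>UNIV. cst (a i) * var i)" using linear_form_3[OF \<open>l \<in> forms 1\<close>] .
    have "subst cst G l = (\<Sum>i\<in>UNIV. cst (a i) * G i)" by (simp add: a sG.sum sG.mult)
    moreover have "(\<Sum>i\<in>UNIV. cst (a i) * G i) \<in> forms e" by (intro forms_sum forms_cst_mult G)
    moreover have "subst cst F (\<Sum>i\<in>UNIV. cst (a i) * G i) = D * l"
      by (simp add: a sF.sum sF.mult GF sum_distrib_left mult.left_commute)
    ultimately show ?thesis by simp
  qed
  have F': "subst cst (\<lambda>i. \<sigma> (F i)) p = \<sigma> (subst cst F p)" for p :: "(3, 'k) mpoly"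
    by (rule ring_map_eqI[OF subst_cst_map ring_map_comp[OF subst_cst_map ring_map_\<sigma>]]) simp_all
  have G': "subst cst (\<lambda>j. subst cst G (\<tau> (var j))) p = subst cst G (\<tau> p)" for p :: "(3, 'k) mpoly"
    by (rule ring_map_eqI[OF subst_cst_map ring_map_comp[OF ring_map_\<tau> subst_cst_map]]) simp_all
  show "subst cst (\<lambda>i. \<sigma> (F i)) (subst cst G (\<tau> (var i))) = \<sigma> D * var i" for i
    using lin[OF \<tau>_forms[OF forms_var[of i]]] by (simp add: F' \<sigma>.mult)
  show "subst cst (\<lambda>j. subst cst G (\<tau> (var j))) (\<sigma> (F i)) = E * var i" for i
    by (simp add: G' FG)
  show "subst cst G (\<tau> (var i)) \<in> forms e" for i using lin[OF \<tau>_forms[OF forms_var[of i]]] ..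
  show "\<sigma> D \<noteq> 0" using nz(1) \<tau>\<sigma>[of D] by (metis \<tau>.zero)
qed (use assms \<sigma>_forms in auto)

end

text \<open>
  Setting \<open>z = 1\<close> is injective on the monomials of a fixed degree, and turns \<open>x\<^sup>a y\<^sup>b z\<^sup>c\<close> of degree
  \<open>n + 1\<close> into a monomial of degree \<open>n + 1 - c\<close>.
\<close>

lemma order_bounds_zdeg:
  fixes h :: "(3, 'k::field) mpoly"
  assumes h: "h \<in> forms (Suc n)"
    and ord: "enat n \<le> ord_origin (subst cst (\<lambda>j. if j = 0 then var 0 else if j = 1 then var 1 else 1) h :: (2, 'k) mpoly)"
  shows "zdeg h \<le> 1"
proof -
  let ?g = "\<lambda>j::3. if j = 0 then var 0 else if j = 1 then var 1 else 1 :: (2, 'k) mpoly"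
  define \<phi> :: "(3 \<Rightarrow>\<^sub>0 nat) \<Rightarrow> 2 \<Rightarrow>\<^sub>0 nat" where
    "\<phi> m = Poly_Mapping.single 0 (Poly_Mapping.lookup m 0) + Poly_Mapping.single 1 (Poly_Mapping.lookup m 1)" for m
  have \<phi>: "Poly_Mapping.lookup (\<phi> m) 0 = Poly_Mapping.lookup m 0" "Poly_Mapping.lookup (\<phi> m) 1 = Poly_Mapping.lookup m 1" for m
    by (simp_all add: \<phi>_def lookup_add lookup_single)
  have pow: "var i ^ k = Poly_Mapping.single (Poly_Mapping.single i k) (1::'k)" for i :: 2 and k
    by (induction k) (simp_all add: var_def mult_single flip: single_add)
  have ev: "mon_eval ?g m = Poly_Mapping.single (\<phi> m) 1" for m
  proof -
    have "mon_eval ?g m = (\<Prod>v\<in>{0, 1, 2}. ?g v ^ Poly_Mapping.lookup m v)"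
      by (rule mon_eval_superset) (simp_all flip: UNIV_3)
    then show ?thesis by (simp add: pow \<phi>_def mult_single)
  qed
  have "subst cst ?g h = (\<Sum>m\<in>Poly_Mapping.keys h. Poly_Mapping.single (\<phi> m) (Poly_Mapping.lookup h m))"
    by (simp add: subst_alt ev cst_def mult_single)
  then have eq: "Poly_Mapping.lookup (subst cst ?g h) k = (\<Sum>m\<in>Poly_Mapping.keys h. if \<phi> m = k then Poly_Mapping.lookup h m else 0)" for k
    by (simp add: lookup_sum lookup_single when_def)
  have tdeg: "Poly_Mapping.lookup m 0 + Poly_Mapping.lookup m 1 + Poly_Mapping.lookup m 2 = Suc n" if "m \<in> Poly_Mapping.keys h" for m
    using h that by (auto simp: forms_def tdeg_weight weight_UNIV_3)
  have inj: "\<phi> m = \<phi> m' \<longleftrightarrow> m = m'" if m: "m \<in> Poly_Mapping.keys h" "m' \<in> Poly_Mapping.keys h" for m m'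
  proof
    assume "\<phi> m = \<phi> m'"
    then have "Poly_Mapping.lookup m 0 = Poly_Mapping.lookup m' 0" "Poly_Mapping.lookup m 1 = Poly_Mapping.lookup m' 1"
      using \<phi> by metis+
    moreover from this have "Poly_Mapping.lookup m 2 = Poly_Mapping.lookup m' 2" using tdeg[OF m(1)] tdeg[OF m(2)] by simp
    ultimately show "m = m'" by (intro poly_mapping_eqI, rule all_3)
  qed simp
  have small: "Poly_Mapping.lookup m 2 \<le> 1" if m: "m \<in> Poly_Mapping.keys h" for m
  proof -
    have "Poly_Mapping.lookup (subst cst ?g h) (\<phi> m) = (\<Sum>k\<in>Poly_Mapping.keys h. if k = m then Poly_Mapping.lookup h m else 0)"
      unfolding eq by (intro sum.cong refl) (auto simp: inj m)
    also have "\<dots> = Poly_Mapping.lookup h m" using m by simp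
    finally have "\<phi> m \<in> Poly_Mapping.keys (subst cst ?g h)" using m by (simp add: in_keys_iff)
    from order_trans[OF ord ord_origin_le[OF this]] have "n \<le> tdeg (\<phi> m)" by simp
    then show ?thesis using tdeg[OF m] by (simp add: tdeg_2 \<phi>)
  qed
  show ?thesis unfolding zdeg_def
  proof (rule degree_le, intro allI impI)
    fix i :: nat assume "1 < i"
    show "coeff (grade {2} h) i = 0"
    proof (rule poly_mapping_eqI)
      fix m show "Poly_Mapping.lookup (coeff (grade {2} h) i) m = Poly_Mapping.lookup 0 m"
      proof (cases "m \<in> Poly_Mapping.keys h")
        case True
        then show ?thesis using small[of m] \<open>1 < i\<close> by (simp add: lookup_coeff_grade weight_def)
      qed (simp add: lookup_coeff_grade in_keys_iff)
    qed
  qed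
qed

lemma neq_succ_3: "c + 1 \<noteq> c" "c + 2 \<noteq> c" "c + 1 \<noteq> c + 2" for c :: 3
  by simp_all

lemma exhaust_succ_3: "i = c \<or> i = c + 1 \<or> i = c + 2" for i c :: 3
  using exhaust_3[of i] exhaust_3[of c] by (elim disjE) simp_all

text \<open>
  If \<open>c\<close> is the pivot of \<open>p\<close>, the new coordinates are \<open>x\<^sub>c\<^sub>+\<^sub>1 - p\<^sub>c\<^sub>+\<^sub>1 x\<^sub>c\<close>, \<open>x\<^sub>c\<^sub>+\<^sub>2 - p\<^sub>c\<^sub>+\<^sub>2 x\<^sub>c\<close> and
  \<open>x\<^sub>c\<close>. Setting the last one to 1 yields the local equation at \<open>p\<close>.
\<close>

lemma coordinates_at_point:
  fixes p :: "3 \<Rightarrow> 'k::field"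
  assumes p: "p \<in> proj_plane"
  obtains \<tau> \<sigma> :: "(3, 'k) mpoly \<Rightarrow> (3, 'k) mpoly" where "coordinate_change \<tau> \<sigma>"
    "\<And>n h. h \<in> forms (Suc n) \<Longrightarrow> enat n \<le> ord_origin (local_eq p h) \<Longrightarrow> zdeg (\<sigma> h) \<le> 1"
proof -
  define c where "c = pivot p"
  have pc: "p c = 1" using p by (simp add: proj_plane_def c_def)
  define t :: "3 \<Rightarrow> (3, 'k) mpoly" where
    "t j = (if j = 0 then var (c + 1) - cst (p (c + 1)) * var c else if j = 1 then var (c + 2) - cst (p (c + 2)) * var c else var c)" for j
  define s :: "3 \<Rightarrow> (3, 'k) mpoly" where
    "s j = cst (p j) * var 2 + (if j = c + 1 then var 0 else if j = c + 2 then var 1 else 0)" for j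
  have t: "t 0 = var (c + 1) - cst (p (c + 1)) * var c" "t 1 = var (c + 2) - cst (p (c + 2)) * var c" "t 2 = var c"
    by (simp_all add: t_def)
  have s: "s c = var 2" "s (c + 1) = cst (p (c + 1)) * var 2 + var 0" "s (c + 2) = cst (p (c + 2)) * var 2 + var 1"
    using neq_succ_3[of c] by (simp_all add: s_def pc cst.one del: add_left_cancel)
  interpret t: ring_map "subst cst t" by (rule subst_cst_map)
  interpret s: ring_map "subst cst s" by (rule subst_cst_map)
  have f1: "cst a * var i \<in> forms 1" for a :: 'k and i :: 3 by (intro forms_cst_mult forms_var)
  have tf: "t j \<in> forms 1" for j
    by (rule all_3[of _ j]) (simp_all only: t forms_var forms_diff f1)
  have sf: "s j \<in> forms 1" for j
    using exhaust_succ_3[of j c] by (elim disjE) (simp_all only: s forms_var forms_add f1)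
  have "subst cst t (s j) = var j" for j
    using exhaust_succ_3[of j c] by (elim disjE) (simp_all add: s t t.maps)
  then have ts: "subst cst t (subst cst s h) = h" for h
    using ring_map_eqI[OF ring_map_comp[OF subst_cst_map subst_cst_map] ring_map_id(2), of t s h] by simp
  have "subst cst s (t j) = var j" for j
    by (rule all_3[of _ j]) (simp_all add: s t s.maps)
  then have st: "subst cst s (subst cst t h) = h" for h
    using ring_map_eqI[OF ring_map_comp[OF subst_cst_map subst_cst_map] ring_map_id(2), of s t h] by simp
  have "coordinate_change (subst cst t) (subst cst s)"
    by unfold_locales (simp_all add: t.maps s.maps ts st subst_forms[OF tf] subst_forms[OF sf])
  moreover have "zdeg (subst cst s h) \<le> 1" if h: "h \<in> forms (Suc n)" "enat n \<le> ord_origin (local_eq p h)" for n h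
  proof (rule order_bounds_zdeg[OF subst_forms[OF sf h(1)]])
    let ?d = "subst cst (\<lambda>j. if j = 0 then var 0 else if j = 1 then var 1 else 1) :: (3, 'k) mpoly \<Rightarrow> (2, 'k) mpoly"
    interpret d: ring_map ?d by (rule subst_cst_map)
    have "?d (s j) = cst (p j) + (if j = c + 1 then var 0 else if j = c + 2 then var 1 else 0)" for j
      by (simp add: s_def d.maps)
    moreover have "?d (subst cst s h) = subst cst (\<lambda>j. ?d (s j)) h"
      by (rule ring_map_eqI[where \<phi> = "\<lambda>h. ?d (subst cst s h)" and \<psi> = "subst cst (\<lambda>j. ?d (s j))"])
        (simp_all add: subst_cst_map ring_map_comp[OF subst_cst_map subst_cst_map])
    ultimately have "?d (subst cst s h) = local_eq p h" unfolding local_eq_def c_def[symmetric] by (simp only:)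
    then show "enat n \<le> ord_origin (?d (subst cst s h))" using h(2) by simp
  qed
  ultimately show ?thesis by (rule that)
qed

section \<open>De Jonquieres maps\<close>

text \<open>
  The normal form in the original coordinates. The claims concern an ideal of a fixed polynomial ring, so
  they are transported along the automorphism \<open>\<tau>\<close>.
\<close>

locale moved_normal_form = coordinate_change \<tau> \<sigma> + normal_form q f q1 q2 f1 f2 m
  for \<tau> \<sigma> :: "(3, 'k::alg_closed_field) mpoly \<Rightarrow> (3, 'k) mpoly"
    and q f :: "(3, 'k) mpoly" and q1 q2 f1 f2 :: "nat \<Rightarrow> 'k" and m
begin

abbreviation "T \<equiv> \<tau> ` I"

lemma T_eq: "T = ideal3 (\<tau> (var 0) * \<tau> q) (\<tau> (var 1) * \<tau> q) (\<tau> f)"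
  by (simp add: I_def \<tau>_ideal3 \<tau>.mult)

lemma ideal_T: "is_ideal T" unfolding T_eq by (rule is_ideal_ideal3)

lemma homogeneous_T: "u \<in> T \<Longrightarrow> hcomp k u \<in> T"
proof -
  assume "u \<in> T"
  then obtain r s t where u: "u = (\<tau> (var 0) * \<tau> q) * r + (\<tau> (var 1) * \<tau> q) * s + \<tau> f * t"
    unfolding T_eq ideal3_def by (auto simp: ac_simps)
  have gens: "\<tau> (var 0) * \<tau> q \<in> T" "\<tau> (var 1) * \<tau> q \<in> T" "\<tau> f \<in> T"
    unfolding T_eq by (rule ideal3_gens)+
  have forms: "\<tau> (var 0) * \<tau> q \<in> forms (1 + Suc m)" "\<tau> (var 1) * \<tau> q \<in> forms (1 + Suc m)" "\<tau> f \<in> forms (Suc (Suc m))"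
    by (intro forms_mult \<tau>_forms forms_var q_forms f_forms)+
  show "hcomp k u \<in> T"
    unfolding u hcomp_add hcomp_mult_forms[OF forms(1)] hcomp_mult_forms[OF forms(2)] hcomp_mult_forms[OF forms(3)]
    using gens by (intro is_ideal_add ideal_T) (simp_all add: is_ideal_mult2[OF ideal_T] is_ideal_0[OF ideal_T])
qed

lemma prime_over_T_monogenic:
  assumes P: "is_prime P" "T \<subseteq> P"
  shows "monogenic P"
proof -
  have "is_prime {r. \<tau> r \<in> P}"
    using P(1) unfolding is_prime_def is_ideal_def by (auto simp: \<tau>.maps)
  moreover have "I \<subseteq> {r. \<tau> r \<in> P}" using P(2) by auto
  ultimately obtain N where N: "\<And>r. \<exists>h. r - poly (map_poly cst h) N \<in> {r. \<tau> r \<in> P}"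
    using prime_monogenic by meson
  have "\<exists>h. r - poly (map_poly cst h) (\<tau> N) \<in> P" for r
    using N[of "\<sigma> r"] by (simp add: \<tau>.diff \<tau>_poly_cst)
  then show ?thesis unfolding monogenic_def by blast
qed

lemma linear_nonzerodivisor_T: obtains l where "l \<in> forms 1" "\<And>u. l * u \<in> T \<Longrightarrow> u \<in> T"
proof -
  obtain l where l: "l \<in> forms 1" "\<And>u. l * u \<in> I \<Longrightarrow> u \<in> I" using ex_linear_nonzerodivisor by blast
  have "u \<in> T" if "\<tau> l * u \<in> T" for u
    using that l(2)[of "\<sigma> u"] by (simp add: \<tau>_image_iff \<sigma>.mult)
  then show ?thesis using that \<tau>_forms[OF l(1)] by blast
qed

theorem cohen_macaulay_T: "cohen_macaulay (ring_of_type_algebra Quot T)"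
proof -
  interpret T: quotient_by T by unfold_locales (rule ideal_T)
  obtain l where l: "l \<in> forms 1" "\<And>u. l * u \<in> T \<Longrightarrow> u \<in> T" using linear_nonzerodivisor_T by blast
  show ?thesis
  proof (rule T.cohen_macaulay_dim_1[OF all_fg_mpoly])
    fix P0 P1 P2 assume P: "is_prime P0" "is_prime P1" "is_prime P2" "T \<subseteq> P0" "P0 \<subset> P1" "P1 \<subset> P2"
    show False
      by (rule no_chain_of_monogenic[OF P(2,3) prime_over_T_monogenic[OF P(1,4)] P(5,6) is_prime_ideal[OF P(1)]])
  next
    fix M assume M: "is_prime M" "T \<subseteq> M" "\<And>N. is_ideal N \<Longrightarrow> M \<subseteq> N \<Longrightarrow> 1 \<notin> N \<Longrightarrow> N = M"
    obtain c where "l - cst c \<in> M"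
      using maximal_residue_constant[OF M(1) M(3) prime_over_T_monogenic[OF M(1,2)]] by blast
    moreover have "b \<in> T" if "(l - cst c) * b \<in> T" for b
      by (rule shifted_nonzerodivisor[OF ideal_T homogeneous_T l that])
    ultimately show "\<exists>r\<in>M. \<forall>b. r * b \<in> T \<longrightarrow> b \<in> T" by blast
  qed
qed

text \<open>
  A power of the linear nonzerodivisor \<open>l\<close> lies in the corresponding power of the irrelevant ideal, and
  can be cancelled modulo \<open>T\<close>.
\<close>

theorem saturated_T: "T = saturation T"
proof (intro equalityI subsetI)
  interpret m: linear_type_setup "Idl\<^bsub>ring_of_type_algebra\<^esub> (range var) :: (3, 'k) mpoly set"
    by unfold_locales (rule is_ideal_genideal)
  {
    fix u assume "u \<in> T"
    then have "\<forall>g\<in>m.pw 0. g * u \<in> T" by (simp add: is_ideal_mult[OF ideal_T])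
    then show "u \<in> saturation T" unfolding saturation_def m.pw_def by blast
  next
    fix u assume "u \<in> saturation T"
    then obtain n where n: "\<And>g. g \<in> m.pw n \<Longrightarrow> g * u \<in> T" unfolding saturation_def m.pw_def by blast
    obtain l where l: "l \<in> forms 1" "\<And>u. l * u \<in> T \<Longrightarrow> u \<in> T" using linear_nonzerodivisor_T by blast
    obtain a where a: "l = (\<Sum>i\<in>UNIV. cst (a i) * var i)" using linear_form_3[OF l(1)] .
    have "l \<in> Idl\<^bsub>ring_of_type_algebra\<^esub> (range var)"
      unfolding a using genideal_type_subset[of "range var"]
      by (intro is_ideal_sum is_ideal_mult is_ideal_genideal) auto
    then have "l ^ k \<in> m.pw k" for k
      by (induction k) (simp_all add: m.pw_0 m.pw_Suc_mult mult.commute[of l])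
    then have "l ^ n * u \<in> T" by (rule n)
    then show "u \<in> T"
      by (induction n) (simp_all add: l(2) mult.assoc)
  }
qed

theorem quotient_degree_T: "quotient_degree T = of_nat (Suc m * Suc (Suc m) + 1)"
proof (rule quotient_degree_const)
  fix n assume "Suc m + Suc (Suc m) \<le> n"
  then obtain n' where "n = n' + Suc m + Suc (Suc m)" by (metis add.assoc add.commute le_Suc_ex)
  then show "hilbert_function T n = Suc m * Suc (Suc m) + 1"
    by (simp only: hilbert_function_\<tau>[OF ideal_I] hilbert_function_eq)
qed simp

theorem linear_type_T: "linear_type T \<longleftrightarrow> m = 0"
proof (cases "m = 0")
  case True
  obtain p s t where "f = p * var 0 + s * var 1 + t * 0" using f_xy unfolding ideal3_def by blast
  then have f: "\<tau> f = \<tau> p * \<tau> (var 0) + \<tau> s * \<tau> (var 1)" by (simp flip: \<tau>.mult \<tau>.add)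
  have nz: "\<tau> r \<noteq> 0" if "r \<noteq> 0" for r using that \<sigma>\<tau>[of r] by (metis \<sigma>.zero)
  have "linear_type T" unfolding T_eq
  proof (rule is_linear_type[OF f])
    show "\<tau> (var 1) \<noteq> 0" "\<tau> f \<noteq> 0" by (simp_all add: nz f_nz)
    show "\<tau> (var 1) dvd r" if "\<tau> (var 1) dvd r * \<tau> (var 0)" for r
      using that var_dvd_var_mult[of 1 0 "\<sigma> r"] by (simp add: \<tau>_dvd_iff \<sigma>.mult mult.commute)
    show "\<tau> f dvd r" if "\<tau> f dvd r * \<tau> q" for r
      using that no_common_factor_dvd[OF f_nz coprime[rotated], of q "\<sigma> r"] by (simp add: \<tau>_dvd_iff \<sigma>.mult)
    show "ring_map (\<lambda>r. grade {0, 1} (\<sigma> r))" by (rule ring_map_comp[OF ring_map_\<sigma> ring_map_grade])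
    show "Polynomial.monom 1 i dvd grade {0, 1} (\<sigma> h) \<longleftrightarrow> (\<exists>c. h = hev i c (\<tau> (var 0)) (\<tau> (var 1)))" for i h
    proof -
      have "(\<exists>c. \<sigma> h = hev i c (var 0) (var 1)) \<longleftrightarrow> (\<exists>c. h = hev i c (\<tau> (var 0)) (\<tau> (var 1)))"
      proof
        assume "\<exists>c. \<sigma> h = hev i c (var 0) (var 1)"
        then obtain c where "\<sigma> h = hev i c (var 0) (var 1)" ..
        from arg_cong[OF this, of \<tau>] show "\<exists>c. h = hev i c (\<tau> (var 0)) (\<tau> (var 1))"
          by (auto simp: \<tau>.map_hev)
      next
        assume "\<exists>c. h = hev i c (\<tau> (var 0)) (\<tau> (var 1))"
        then obtain c where "h = hev i c (\<tau> (var 0)) (\<tau> (var 1))" ..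
        from arg_cong[OF this, of \<sigma>] show "\<exists>c. \<sigma> h = hev i c (var 0) (var 1)"
          by (auto simp: \<sigma>.map_hev)
      qed
      then show ?thesis by (simp only: power_of_xy_ideal)
    qed
    show "\<not> Polynomial.monom 1 1 dvd grade {0, 1} (\<sigma> (\<tau> q)) \<or> \<not> Polynomial.monom 1 2 dvd grade {0, 1} (\<sigma> (\<tau> f))"
      using multiplicities_m0[OF True] by simp
  qed
  then show ?thesis using True by simp
next
  case False
  define \<pi> where "\<pi> r = ev 0 0 1 (\<sigma> r)" for r
  have "\<not> linear_type (ideal3 (\<tau> (var 0) * \<tau> q) (\<tau> (var 1) * \<tau> q) (\<tau> f))"
  proof (rule not_linear_type[where \<pi> = \<pi> and z = "\<tau> (var 2)"])
    show "\<tau> q = \<tau> (var 2) * hev m (\<lambda>i. cst (q1 i)) (\<tau> (var 0)) (\<tau> (var 1)) + hev (Suc m) (\<lambda>i. cst (q2 i)) (\<tau> (var 0)) (\<tau> (var 1))"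
      by (subst q_eq) (simp add: \<tau>.add \<tau>.mult \<tau>.map_hev)
    show "\<tau> f = \<tau> (var 2) * hev (Suc m) (\<lambda>i. cst (f1 i)) (\<tau> (var 0)) (\<tau> (var 1)) + hev (Suc (Suc m)) (\<lambda>i. cst (f2 i)) (\<tau> (var 0)) (\<tau> (var 1))"
      by (subst f_eq) (simp add: \<tau>.add \<tau>.mult \<tau>.map_hev)
    show "infinite (UNIV :: 'k set)" by (rule infinite_alg_closed)
    show "ring_map \<pi>" unfolding \<pi>_def by (rule ring_map_comp[OF ring_map_\<sigma> ev_ring_map])
    show "\<pi> (\<tau> (var 0)) = 0" "\<pi> (\<tau> (var 1)) = 0" "\<pi> (\<tau> (var 2)) = 1" by (simp_all add: \<pi>_def)
    show "(\<exists>i\<le>m. \<pi> (cst (q1 i)) \<noteq> 0) \<or> (\<exists>i\<le>Suc m. \<pi> (cst (f1 i)) \<noteq> 0)" using leading_nz by (simp add: \<pi>_def)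
    show "\<pi> r = 0 \<and> \<pi> s = 0 \<and> \<pi> t = 0" if rel: "r * (\<tau> (var 0) * \<tau> q) + s * (\<tau> (var 1) * \<tau> q) + t * \<tau> f = 0" for r s t
    proof -
      from arg_cong[OF rel, of \<sigma>] have "\<sigma> r * (var 0 * q) + \<sigma> s * (var 1 * q) + \<sigma> t * f = 0"
        by (simp add: \<sigma>.maps)
      from syzygies_vanish[OF False this] show ?thesis by (simp add: \<pi>_def)
    qed
  qed
  then show ?thesis using False by (simp add: T_eq)
qed

end

text \<open>
  At the first, proper, point below a base point of multiplicity \<open>d - 1\<close> all curves of the linear system
  have at least this multiplicity.
\<close>

lemma de_jonquieres_base_point:
  assumes "de_jonquieres d F"
  obtains p where "p \<in> proj_plane" "\<And>i. enat (d - 1) \<le> ord_origin (local_eq p (F i))"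
proof -
  let ?B = "base_points (base_ideal F) d"
  have d: "2 \<le> d" and F: "\<And>i. F i \<in> forms d" and fin: "finite ?B"
    and type: "image_mset (base_mult (base_ideal F) d) (mset_set ?B) = add_mset (d - 1) (replicate_mset (2 * d - 2) 1)"
    using assms by (auto simp: de_jonquieres_def plane_cremona_def has_homaloidal_type_def)
  have "d - 1 \<in># image_mset (base_mult (base_ideal F) d) (mset_set ?B)" unfolding type by simp
  then obtain p ts where pt: "(p, ts) \<in> ?B" "base_mult (base_ideal F) d (p, ts) = d - 1"
    using fin by auto
  \<comment> \<open>An infinite order, where \<open>the_enat\<close> is unspecified, satisfies the bound as well.\<close>
  have "enat (d - 1) \<le> min_ord (local_system (base_ideal F) d (p, ts))"
    using pt(2) by (cases "min_ord (local_system (base_ideal F) d (p, ts))") (auto simp: base_mult_def simp del: local_system.simps)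
  also have "\<dots> \<le> min_ord (local_system (base_ideal F) d (p, []))"
    using base_point_proper[OF pt(1)] ..
  finally have le: "enat (d - 1) \<le> min_ord (local_eq p ` (base_ideal F \<inter> forms d))" by simp
  have "enat (d - 1) \<le> ord_origin (local_eq p (F i))" for i
  proof -
    have "F i \<in> base_ideal F \<inter> forms d"
      using F genideal_type_subset[of "range F"] by (auto simp: base_ideal_def)
    then have "min_ord (local_eq p ` (base_ideal F \<inter> forms d)) \<le> ord_origin (local_eq p (F i))"
      unfolding min_ord_def by (intro INF_lower imageI)
    with le show ?thesis by (rule order_trans)
  qed
  moreover have "p \<in> proj_plane" using base_point_proper[OF pt(1)] ..
  ultimately show ?thesis by (rule that[rotated])
qed

lemma de_jonquieres_normal_form:
  fixes F :: "3 \<Rightarrow> (3, 'k::alg_closed_field) mpoly"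
  assumes "de_jonquieres (Suc (Suc m)) F"
  obtains \<tau> \<sigma> q f q1 q2 f1 f2 where "moved_normal_form \<tau> \<sigma> q f q1 q2 f1 f2 m"
    "base_ideal F = \<tau> ` ideal3 (var 0 * q) (var 1 * q) f"
proof -
  obtain e G D E where F: "\<And>i. F i \<in> forms (Suc (Suc m))" and cop: "\<And>h. (\<And>i. h dvd F i) \<Longrightarrow> h dvd 1"
    and G: "\<And>i. G i \<in> forms e" and nz: "D \<noteq> 0" "E \<noteq> 0"
    and GF: "\<And>i. subst cst F (G i) = D * var i" and FG: "\<And>i. subst cst G (F i) = E * var i"
    using assms unfolding de_jonquieres_def plane_cremona_def by metis
  obtain p where p: "p \<in> proj_plane" "\<And>i. enat (Suc m) \<le> ord_origin (local_eq p (F i))"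
    using de_jonquieres_base_point[OF assms] by auto
  obtain \<tau> \<sigma> :: "(3, 'k) mpoly \<Rightarrow> (3, 'k) mpoly" where cc: "coordinate_change \<tau> \<sigma>"
    and deg: "\<And>n h. h \<in> forms (Suc n) \<Longrightarrow> enat n \<le> ord_origin (local_eq p h) \<Longrightarrow> zdeg (\<sigma> h) \<le> 1"
    using coordinates_at_point[OF p(1)] by blast
  interpret coordinate_change \<tau> \<sigma> by (rule cc)
  interpret M: monoidal_map "\<lambda>i. \<sigma> (F i)" "\<lambda>j. subst cst G (\<tau> (var j))" "Suc m" e "\<sigma> D" E
    by (rule monoidal_map_\<sigma>[OF F deg[OF F p(2)] G nz GF FG])
  have coprime: "h dvd 1" if h: "\<And>i. h dvd \<sigma> (F i)" for h
  proof -
    have "\<tau> h dvd 1" using h by (intro cop) (simp add: \<tau>_dvd_iff)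
    then show ?thesis by (simp add: \<tau>_dvd_iff \<sigma>.one)
  qed
  obtain q f where qf: "q \<in> forms (Suc m)" "f \<in> forms (Suc (Suc m))" "zdeg q \<le> 1" "zdeg f \<le> 1" "q \<noteq> 0"
    "zdeg q \<noteq> 0 \<or> zdeg f \<noteq> 0" "\<And>h. h dvd q \<Longrightarrow> h dvd f \<Longrightarrow> h dvd 1"
    and eq: "ideal3 (\<sigma> (F 0)) (\<sigma> (F 1)) (\<sigma> (F 2)) = ideal3 (var 0 * q) (var 1 * q) f"
  proof (rule M.normal_form, goal_cases)
    case (1 h)
    show ?case by (rule coprime) (rule 1(2))
  next
    case (2 q f)
    show ?case by (rule 2(1)[OF 2(2-)])
  qed
  obtain q1 q2 where q: "q = var 2 * bf m q1 + bf (Suc m) q2" using forms_zdeg_1[OF qf(1,3)] .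
  obtain f1 f2 where f: "f = var 2 * bf (Suc m) f1 + bf (Suc (Suc m)) f2" using forms_zdeg_1[OF qf(2,4)] .
  have "moved_normal_form \<tau> \<sigma> q f q1 q2 f1 f2 m"
    by (intro moved_normal_form.intro cc normal_form.intro q f qf(5,6)) (rule qf(7))
  moreover have "base_ideal F = \<tau> ` ideal3 (var 0 * q) (var 1 * q) f"
    by (simp add: base_ideal_def genideal_range_3 \<tau>_ideal3 flip: eq)
  ultimately show ?thesis by (rule that)
qed

theorem corollary2p5:
  fixes F :: "3 \<Rightarrow> (3, 'k::alg_closed_field) mpoly" and d :: nat
  assumes "d \<ge> 2" and "de_jonquieres d F"
  shows "(cohen_macaulay (ring_of_type_algebra Quot base_ideal F) \<and>
            base_ideal F = saturation (base_ideal F)) \<and>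
         quotient_degree (base_ideal F) = of_nat (d * (d - 1) + 1) \<and>
         (linear_type (base_ideal F) \<longleftrightarrow> d = 2)"
proof -
  obtain m where d: "d = Suc (Suc m)" using \<open>d \<ge> 2\<close> by (metis add_2_eq_Suc le_Suc_ex)
  obtain \<tau> \<sigma> q f q1 q2 f1 f2 where nf: "moved_normal_form \<tau> \<sigma> q f q1 q2 f1 f2 m"
    and I: "base_ideal F = \<tau> ` ideal3 (var 0 * q) (var 1 * q) f"
    using de_jonquieres_normal_form assms(2) unfolding d by blast
  interpret moved_normal_form \<tau> \<sigma> q f q1 q2 f1 f2 m by (rule nf)
  have I: "base_ideal F = T" by (simp add: I I_def)
  have "d * (d - 1) + 1 = Suc m * Suc (Suc m) + 1" by (simp add: d)
  then show ?thesis
    unfolding I using cohen_macaulay_T saturated_T quotient_degree_T linear_type_T by (simp only: d) simp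
qed

end
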